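(* Let $\mu$ be a self-similar measure for a linear iterated function system that is regular. Then for every non-affine real-analytic diffeomorphism $g$ of $\mathbb{R}$, the measure $g\mu$ is pointwise $\beta$-normal for every Pisot number $\beta>1$.
   Context: An IFS is a finite family $\{f_0,\dots,f_{r-1}\}$ of strictly contracting maps of a compact interval $I$; it is linear if all $f_i$ are affine; regular if the $f_i$ are orientation-preserving injections and the intervals $f_i(I)$ are pairwise disjoint except possibly at endpoints. A self-similar measure is a Borel probability measure $\mu$ with $\mu=\sum_i p_if_i\mu$ for a probability vector with all $p_i>0$ ($f\mu$ = push-forward). A Pisot number is an algebraic integer $\beta>1$ whose conjugates have modulus $<1$ (integers $\ge2$ included). $T_\beta(x)=\beta x\bmod 1$; the Parry measure is the unique $T_\beta$-invariant Borel probability on $[0,1)$ absolutely continuous w.r.t. Lebesgue; $x$ is $\beta$-normal if $\frac1N\sum_{k<N}\delta_{T_\beta^kx}$ converges weak-* to the Parry measure; pointwise $\beta$-normal means almost every point is $\beta$-normal.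
   Formalization: The iterated function system is assumed to have at least two maps; with a single map the self-similar measure is a point mass at the fixed point, and the claim fails when g sends that point to 0. *)

theory Defs
  imports "HOL-Probability.Probability" "HOL-Computational_Algebra.Polynomial"
begin

definition aff :: "(nat \<Rightarrow> real) \<Rightarrow> (nat \<Rightarrow> real) \<Rightarrow> nat \<Rightarrow> real \<Rightarrow> real" where
  "aff a b i x = a i * x + b i"

definition regular_linear_IFS ::
  "real \<Rightarrow> real \<Rightarrow> nat \<Rightarrow> (nat \<Rightarrow> real) \<Rightarrow> (nat \<Rightarrow> real) \<Rightarrow> bool" where
  "regular_linear_IFS c d r a b \<longleftrightarrow>
     c < d \<and>
     (\<forall>i<r. 0 < a i \<and> a i < 1 \<and> aff a b i ` {c..d} \<subseteq> {c..d}) \<and>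
     (\<forall>i<r. \<forall>j<r. i \<noteq> j \<longrightarrow>
        aff a b i ` {c..d} \<inter> aff a b j ` {c..d} \<subseteq> {aff a b i c, aff a b i d})"

definition self_similar_measure ::
  "real \<Rightarrow> real \<Rightarrow> nat \<Rightarrow> (nat \<Rightarrow> real) \<Rightarrow> (nat \<Rightarrow> real) \<Rightarrow> (nat \<Rightarrow> real)
   \<Rightarrow> real measure \<Rightarrow> bool" where
  "self_similar_measure c d r a b p \<mu> \<longleftrightarrow>
     prob_space \<mu> \<and> sets \<mu> = sets borel \<and> emeasure \<mu> {c..d} = 1 \<and>
     (\<forall>i<r. 0 < p i) \<and> (\<Sum>i<r. p i) = 1 \<and>
     (\<forall>A \<in> sets borel. emeasure \<mu> A =
        (\<Sum>i<r. ennreal (p i) * emeasure \<mu> (aff a b i -` A)))"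

definition pisot :: "real \<Rightarrow> bool" where
  "pisot \<beta> \<longleftrightarrow> 1 < \<beta> \<and>
     (\<exists>q :: int poly. lead_coeff q = 1 \<and> irreducible q \<and>
        poly (map_poly of_int q) (complex_of_real \<beta>) = 0 \<and>
        (\<forall>z. poly (map_poly of_int q) z = 0 \<and> z \<noteq> complex_of_real \<beta> \<longrightarrow> cmod z < 1))"

definition beta_map :: "real \<Rightarrow> real \<Rightarrow> real" where
  "beta_map \<beta> x = frac (\<beta> * x)"

text \<open>Parry measure: T_beta-invariant Borel probability on [0,1) that is
  absolutely continuous w.r.t. Lebesgue measure (unique).\<close>
definition is_parry_measure :: "real \<Rightarrow> real measure \<Rightarrow> bool" where
  "is_parry_measure \<beta> \<nu> \<longleftrightarrow>
     prob_space \<nu> \<and> sets \<nu> = sets borel \<and> emeasure \<nu> {0..<1} = 1 \<and>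
     absolutely_continuous lborel \<nu> \<and>
     distr \<nu> borel (beta_map \<beta>) = \<nu>"

definition parry_measure :: "real \<Rightarrow> real measure" where
  "parry_measure \<beta> = (THE \<nu>. is_parry_measure \<beta> \<nu>)"

definition beta_normal :: "real \<Rightarrow> real \<Rightarrow> bool" where
  "beta_normal \<beta> x \<longleftrightarrow>
     (\<forall>h :: real \<Rightarrow> real. continuous_on UNIV h \<and> bounded (range h) \<longrightarrow>
        (\<lambda>N. (\<Sum>k<N. h ((beta_map \<beta> ^^ k) x)) / real N)
          \<longlonglongrightarrow> integral\<^sup>L (parry_measure \<beta>) h)"

definition pointwise_beta_normal :: "real \<Rightarrow> real measure \<Rightarrow> bool" where
  "pointwise_beta_normal \<beta> \<nu> \<longleftrightarrow> (AE x in \<nu>. beta_normal \<beta> x)"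

definition real_analytic :: "(real \<Rightarrow> real) \<Rightarrow> bool" where
  "real_analytic g \<longleftrightarrow>
     (\<forall>x. \<exists>\<rho>>0. \<exists>c :: nat \<Rightarrow> real. \<forall>y. \<bar>y - x\<bar> < \<rho> \<longrightarrow>
        (\<lambda>n. c n * (y - x) ^ n) sums g y)"

definition analytic_diffeo :: "(real \<Rightarrow> real) \<Rightarrow> bool" where
  "analytic_diffeo g \<longleftrightarrow> bij g \<and> real_analytic g \<and> real_analytic (inv g)"

definition affine_fun :: "(real \<Rightarrow> real) \<Rightarrow> bool" where
  "affine_fun g \<longleftrightarrow> (\<exists>s t. \<forall>x. g x = s * x + t)"

end

theory Submission
  imports Defs "HOL-Computational_Algebra.Polynomial_Factorial"
    "HOL-Computational_Algebra.Fundamental_Theorem_Algebra"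
begin

text \<open>
  A second moment computation (Davenport, Erdos, LeVeque) shows that for \<open>\<mu>\<close>-almost every \<open>x\<close> the
  averages of \<open>exp (i t \<beta>\<^sup>k g x)\<close> tend to 0 for all \<open>t \<noteq> 0\<close>, once the Fourier transform of the
  image measure decays at least like \<open>1 / ln \<xi>\<close>.  Since \<open>g\<close> is analytic and not affine, \<open>g''\<close> has
  finitely many zeros on the support and \<open>\<mu>\<close> has no atoms, so it suffices to treat cylinders on which
  \<open>g''\<close> does not vanish.  Linearising \<open>g\<close> on cylinders of size \<open>\<xi>\<^sup>-\<^sup>3\<^sup>/\<^sup>4\<close> reduces the decay to that of
  averages \<open>\<integral> FT (T * g' x) d\<mu> x\<close>, where \<open>FT\<close> is the modulus of the Fourier transform of \<open>\<mu>\<close>.  The words \<open>01\<close> and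
  \<open>10\<close> contribute a factor \<open>\<bar>cos\<bar>\<close> to \<open>FT\<close> which varies at the scale \<open>1 / T\<close>, while the remaining
  factor is almost constant at that scale; hence each step gains a fixed factor.

  For a Pisot number \<open>\<beta>\<close> the difference between \<open>T\<^sup>k y\<close> and \<open>\<beta>\<^sup>k y\<close> lies in \<open>\<int>[\<beta>]\<close> and has bounded
  conjugates, so visits of the orbit to an interval force \<open>(\<beta>\<^sup>i \<beta>\<^sup>k y)\<close> into few small cubes of a torus.
  This bounds the visiting frequency of intervals by a multiple of their length, which by the
  ergodicity of the \<open>\<beta>\<close>-transformation suffices for normality.
\<close>

section \<open>The \<open>\<beta>\<close>-transformation and its Parry measure\<close>

text \<open>The Fourier transform of \<open>\<mu>\<close> itself need not decay (the middle-third
  Cantor measure is an example), so no bound at a single frequency suffices; the curvature of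
  \<open>g\<close> spreads the frequencies \<open>T * g' x\<close>, and their average is small. To
  gain in a step, the remaining factor is smoothed over \<open>N\<close> further letters; this costs
  \<open>amin ^ (N + 2)\<close> in frequency and leaves an error of order \<open>amax ^ N\<close>.
  With \<open>N\<close> steps of depth \<open>N\<close>, about \<open>N^2\<close> powers of
  \<open>amin\<close> are spent, whence a decay like \<open>exp (- const * sqrt (ln \<xi>))\<close>.
  It beats the number of contraction ratios at one scale, which is polynomial in
  \<open>ln \<xi>\<close>. Keeping only \<open>1 / ln \<xi>\<close> is enough because the
  frequencies \<open>\<beta> ^ l - \<beta> ^ N\<close> grow exponentially, so that their
  correlations are \<open>O(1 / N)\<close>. Regularity provides two maps that do not commute, hence
  different translations for the words \<open>01\<close> and \<open>10\<close>. Finally,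
  \<open>T^k y\<close> and \<open>\<beta>^k * y\<close> need not agree modulo 1 for non-integral
  \<open>\<beta>\<close>; therefore frequencies from the whole ring generated by
  \<open>\<beta>\<close> are controlled, and counting cubes gives visit bounds up to a constant
  instead of exact frequencies.\<close>

definition bdd_borel :: "real \<Rightarrow> (real \<Rightarrow> real) \<Rightarrow> bool" where
  "bdd_borel B F \<longleftrightarrow> F \<in> borel_measurable borel \<and> (\<forall>x. \<bar>F x\<bar> \<le> B)"

text \<open>Initial segments are the test sets because the \<open>\<beta>\<close>-transformation
  wraps \<open>[0, t)\<close> around \<open>[0, 1)\<close> finitely many times and leaves one
  further initial segment: the family is closed under transfer.\<close>

definition mint :: "(real \<Rightarrow> real) \<Rightarrow> real \<Rightarrow> real" where
  "mint F t = (LINT x|lborel. indicator {0..<t} x * F x)"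

lemma bdd_borel_nonneg: "bdd_borel B F \<Longrightarrow> 0 \<le> B"
  unfolding bdd_borel_def using abs_ge_zero order_trans by blast

lemma bdd_borel_integrable:
  assumes "bdd_borel B F"
  shows "integrable lborel (\<lambda>x. indicator {a..<b} x * F x)"
proof (rule Bochner_Integration.integrable_bound[of _ "\<lambda>x. B * indicator {a..<b} x"])
  show "integrable lborel (\<lambda>x. B * indicator {a..<b} x)"
    by (cases "a \<le> b") auto
  show "(\<lambda>x. indicator {a..<b} x * F x) \<in> borel_measurable lborel"
    using assms by (auto simp: bdd_borel_def)
  show "AE x in lborel. norm (indicator {a..<b} x * F x) \<le> norm (B * indicator {a..<b} x)"
    using assms by (auto simp: bdd_borel_def indicator_def intro: order_trans[OF _ abs_ge_self])
qed

lemma mint_bound: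
  assumes "bdd_borel B F" "0 \<le> t"
  shows "\<bar>mint F t\<bar> \<le> B * t"
proof -
  have "norm (mint F t) \<le> (LINT x|lborel. B * indicator {0..<t} x)"
    unfolding mint_def
  proof (rule Bochner_Integration.integral_norm_bound_integral)
    show "integrable lborel (\<lambda>x. indicator {0..<t} x * F x)"
      using assms(1) by (rule bdd_borel_integrable)
    show "integrable lborel (\<lambda>x. B * indicator {0..<t} x)" using assms by simp
  qed (use assms in \<open>auto simp: bdd_borel_def indicator_def\<close>)
  also have "\<dots> = B * t" using assms by simp
  finally show ?thesis by simp
qed

lemma integral_frac:
  assumes F: "bdd_borel B F" and s: "0 \<le> s" "s < 1"
  shows "(LINT x|lborel. indicator {0..<real n + s} x * F (frac x)) = real n * mint F 1 + mint F s"
proof (induction n)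
  case 0
  have "(LINT x|lborel. indicator {0..<s} x * F (frac x)) = mint F s"
    unfolding mint_def
    by (rule Bochner_Integration.integral_cong)
       (use s in \<open>auto simp: indicator_def frac_eq\<close>)
  then show ?case by simp
next
  case (Suc n)
  define t where "t = real n + s"
  have t: "0 \<le> t" using s by (simp add: t_def)
  have bF: "bdd_borel B (\<lambda>x. F (frac x))"
    using F unfolding bdd_borel_def by (auto simp: frac_def)
  have "(LINT x|lborel. indicator {0..<t + 1} x * F (frac x))
     = (LINT x|lborel. indicator {0..<1} x * F (frac x) + indicator {1..<t+1} x * F (frac x))"
    by (rule Bochner_Integration.integral_cong) (use t in \<open>auto simp: indicator_def\<close>)
  also have "\<dots> = (LINT x|lborel. indicator {0..<1} x * F (frac x))
        + (LINT x|lborel. indicator {1..<t+1} x * F (frac x))"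
    by (rule Bochner_Integration.integral_add) (rule bdd_borel_integrable[OF bF])+
  also have "(LINT x|lborel. indicator {0..<1} x * F (frac x)) = mint F 1"
    unfolding mint_def
    by (rule Bochner_Integration.integral_cong) (auto simp: indicator_def frac_eq)
  also have "(LINT x|lborel. indicator {1..<t+1} x * F (frac x))
       = (LINT x|lborel. indicator {0..<t} x * F (frac x))"
    by (subst lborel_integral_real_affine[of 1 _ 1])
       (auto simp: indicator_def frac_1_eq add.commute intro!: Bochner_Integration.integral_cong)
  finally show ?case using Suc by (simp add: t_def algebra_simps)
qed

text \<open>The substitution \<open>y = \<beta> * x\<close> produces
  \<open>[0, \<beta> * t)\<close>, that is \<open>\<lfloor>\<beta> * t\<rfloor>\<close> full periods
  of \<open>frac\<close> and a remainder of length \<open>beta_map \<beta> t\<close>. This identity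
  takes the place of a transfer operator in what follows.\<close>

lemma mint_beta_map:
  assumes F: "bdd_borel B F" and t: "0 \<le> t" and b: "\<beta> > 0"
  shows "mint (\<lambda>x. F (beta_map \<beta> x)) t
    = (of_int \<lfloor>\<beta> * t\<rfloor> * mint F 1 + mint F (beta_map \<beta> t)) / \<beta>"
proof -
  have "mint (\<lambda>x. F (beta_map \<beta> x)) t
     = \<bar>1 / \<beta>\<bar> * (LINT y|lborel. indicator {0..<t} (y / \<beta>) * F (frac y))"
    unfolding mint_def beta_map_def
    by (subst lborel_integral_real_affine[of "1 / \<beta>" _ 0]) (use b in auto)
  also have "(LINT y|lborel. indicator {0..<t} (y / \<beta>) * F (frac y))
     = (LINT y|lborel. indicator {0..<\<beta> * t} y * F (frac y))"
    by (rule Bochner_Integration.integral_cong)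
       (use b in \<open>auto simp: indicator_def field_simps zero_le_divide_iff\<close>)
  also have "\<beta> * t = real (nat \<lfloor>\<beta> * t\<rfloor>) + frac (\<beta> * t)"
    using b t by (simp add: frac_def)
  also have "(LINT y|lborel. indicator {0..<\<dots>} y * F (frac y))
      = real (nat \<lfloor>\<beta> * t\<rfloor>) * mint F 1 + mint F (frac (\<beta> * t))"
    by (rule integral_frac[OF F]) (auto simp: frac_lt_1)
  finally show ?thesis using b t by (simp add: beta_map_def)
qed

locale beta_transformation =
  fixes \<beta> :: real
  assumes beta_gt_1: "\<beta> > 1"
begin

abbreviation "T \<equiv> beta_map \<beta>"

lemma beta_pos: "\<beta> > 0" using beta_gt_1 by simp

lemma T_measurable [measurable]: "T \<in> borel_measurable borel"
  unfolding beta_map_def[abs_def] frac_def by measurable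

lemma T_pow_measurable [measurable]: "(T ^^ k) \<in> borel_measurable borel"
proof (induction k)
  case (Suc k)
  have "(\<lambda>x. T ((T ^^ k) x)) \<in> borel_measurable borel"
    using Suc by measurable
  then show ?case by (simp add: comp_def)
qed simp

lemma T_range: "0 \<le> T x" "T x < 1"
  by (auto simp: beta_map_def frac_lt_1)

lemma bdd_T:
  assumes "bdd_borel B F" shows "bdd_borel B (\<lambda>x. F ((T ^^ k) x))"
proof -
  have [measurable]: "F \<in> borel_measurable borel" using assms by (simp add: bdd_borel_def)
  have "(\<lambda>x. F ((T ^^ k) x)) \<in> borel_measurable borel" by measurable
  then show ?thesis using assms by (simp add: bdd_borel_def)
qed

definition tsum :: "nat \<Rightarrow> (real \<Rightarrow> real) \<Rightarrow> real \<Rightarrow> real" where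
  "tsum n F x = (\<Sum>k<n. F ((T ^^ k) x))"

lemma bdd_tsum:
  assumes "bdd_borel B F" shows "bdd_borel (real n * B) (tsum n F)"
proof -
  have [measurable]: "F \<in> borel_measurable borel" using assms by (simp add: bdd_borel_def)
  have "\<bar>tsum n F x\<bar> \<le> real n * B" for x
    using sum_bounded_above[of "{..<n}" "\<lambda>k. \<bar>F ((T ^^ k) x)\<bar>" B] assms
    unfolding tsum_def by (intro order_trans[OF sum_abs]) (auto simp: bdd_borel_def)
  moreover have "tsum n F \<in> borel_measurable borel" unfolding tsum_def[abs_def] by measurable
  ultimately show ?thesis by (simp add: bdd_borel_def)
qed

lemma mint_tsum:
  assumes "bdd_borel B F" shows "mint (tsum n F) t = (\<Sum>k<n. mint (\<lambda>x. F ((T ^^ k) x)) t)"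
  unfolding mint_def tsum_def sum_distrib_left
  by (rule Bochner_Integration.integral_sum) (rule bdd_borel_integrable[OF bdd_T[OF assms]])

lemma mint_pow_Suc:
  assumes F: "bdd_borel B F" and t: "0 \<le> t"
  shows "mint (\<lambda>x. F ((T ^^ Suc k) x)) t
    = (of_int \<lfloor>\<beta> * t\<rfloor> * mint (\<lambda>x. F ((T ^^ k) x)) 1 + mint (\<lambda>x. F ((T ^^ k) x)) (T t)) / \<beta>"
  using mint_beta_map[OF bdd_T[OF F, of k] t beta_pos]
  by (simp add: funpow_swap1)

text \<open>The defect \<open>E t\<close> satisfies \<open>E t = E (T t) / \<beta> + O(1)\<close>, so it is bounded uniformly
  in \<open>n\<close>; no spectral gap is needed.\<close>

lemma mint_tsum_defect:
  assumes F: "bdd_borel B F" and t: "0 \<le> t" "t \<le> 1"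
  shows "\<bar>mint (tsum n F) t - t * mint (tsum n F) 1\<bar> \<le> 2 * B * \<beta> / (\<beta> - 1)"
proof -
  define E where "E t = mint (tsum n F) t - t * mint (tsum n F) 1" for t
  have B: "0 \<le> B" using F by (rule bdd_borel_nonneg)
  have eq: "E t = E (T t) / \<beta> + (mint F t - mint (\<lambda>x. F ((T ^^ n) x)) t)" if t: "0 \<le> t" for t
  proof -
    \<comment> \<open>Shifting the summation index by one trades the term \<open>k = 0\<close> for
      the term \<open>k = n\<close>.\<close>
    have "mint (tsum n F) t + mint (\<lambda>x. F ((T ^^ n) x)) t - mint F t
       = (\<Sum>k<n. mint (\<lambda>x. F ((T ^^ Suc k) x)) t)"
      unfolding mint_tsum[OF F]
      by (induction n) (simp_all add: id_def)
    also have "\<dots> = (of_int \<lfloor>\<beta> * t\<rfloor> * mint (tsum n F) 1 + mint (tsum n F) (T t)) / \<beta>"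
      unfolding mint_tsum[OF F] mint_pow_Suc[OF F t]
      by (simp add: sum_divide_distrib[symmetric] sum.distrib sum_distrib_left)
    finally have "mint (tsum n F) t + mint (\<lambda>x. F ((T ^^ n) x)) t - mint F t
       = (of_int \<lfloor>\<beta> * t\<rfloor> * mint (tsum n F) 1 + mint (tsum n F) (T t)) / \<beta>" .
    \<comment> \<open>With the integer part written as \<open>\<beta> * t - T t\<close>, the
      multiples of the total integral are absorbed by the defects at \<open>t\<close> and at
      \<open>T t\<close>.\<close>
    moreover have "of_int \<lfloor>\<beta> * t\<rfloor> = \<beta> * t - T t" by (simp add: beta_map_def frac_def)
    ultimately show ?thesis using beta_pos unfolding E_def by (simp add: field_simps)
  qed
  have bd: "\<bar>mint F t - mint (\<lambda>x. F ((T ^^ n) x)) t\<bar> \<le> 2 * B" if t: "0 \<le> t" "t \<le> 1" for t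
  proof -
    have "B * t \<le> B" using B t by (simp add: mult_left_le)
    then show ?thesis using mint_bound[OF F t(1)] mint_bound[OF bdd_T[OF F, of n] t(1)] by linarith
  qed
  \<comment> \<open>This bound grows with \<open>n\<close>, but it is inserted only at the end of a
    chain of \<open>j\<close> applications of \<open>eq\<close>, where it is damped by
    \<open>\<beta> ^ j\<close>; letting \<open>j\<close> tend to infinity removes it. The other
    constant \<open>2 * B * \<beta> / (\<beta> - 1)\<close> is the fixed point of
    \<open>x \<mapsto> x / \<beta> + 2 * B\<close>.\<close>
  have crude: "\<bar>E t\<bar> \<le> 2 * (real n * B)" if t: "0 \<le> t" "t \<le> 1" for t
  proof -
    have "\<bar>mint (tsum n F) t\<bar> \<le> real n * B"
      by (rule order_trans[OF mint_bound[OF bdd_tsum[OF F] t(1)]]) (use t B in \<open>simp add: mult_left_le\<close>)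
    moreover have "\<bar>t * mint (tsum n F) 1\<bar> \<le> 1 * (real n * B)"
      unfolding abs_mult using t mint_bound[OF bdd_tsum[OF F], of 1] by (intro mult_mono) auto
    ultimately show ?thesis unfolding E_def by linarith
  qed
  have main: "\<bar>E t\<bar> \<le> 2 * (real n * B) / \<beta> ^ j + 2 * B * \<beta> / (\<beta> - 1)" if t: "0 \<le> t" "t \<le> 1" for t j
    using t
  proof (induction j arbitrary: t)
    case 0
    have "0 \<le> 2 * B * \<beta> / (\<beta> - 1)" using B beta_gt_1 by simp
    then show ?case using crude[OF 0] by simp
  next
    case (Suc j)
    have "\<bar>E (T t)\<bar> \<le> 2 * (real n * B) / \<beta> ^ j + 2 * B * \<beta> / (\<beta> - 1)"
      by (rule Suc.IH) (use T_range[of t] in auto)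
    then have "\<bar>E (T t) / \<beta>\<bar> \<le> (2 * (real n * B) / \<beta> ^ j + 2 * B * \<beta> / (\<beta> - 1)) / \<beta>"
      using beta_pos by (simp add: divide_right_mono)
    also have "\<dots> = 2 * (real n * B) / \<beta> ^ Suc j + 2 * B * \<beta> / (\<beta> - 1) - 2 * B"
      using beta_gt_1 by (simp add: field_simps)
    finally show ?case using eq[OF Suc.prems(1)] bd[OF Suc.prems] by linarith
  qed
  have "(\<lambda>j. 2 * (real n * B) / \<beta> ^ j + 2 * B * \<beta> / (\<beta> - 1)) \<longlonglongrightarrow> 0 + 2 * B * \<beta> / (\<beta> - 1)"
    by (intro tendsto_add tendsto_const LIMSEQ_divide_realpow_zero beta_gt_1)
  then have "\<bar>E t\<bar> \<le> 0 + 2 * B * \<beta> / (\<beta> - 1)"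
    by (rule LIMSEQ_le_const) (use main[OF t] in blast)
  then show ?thesis by (simp add: E_def)
qed

section \<open>Parry's invariant density\<close>

definition "orb n = (T ^^ n) 1"

lemma orb_simps: "orb 0 = 1" "orb (Suc n) = T (orb n)"
  by (auto simp: orb_def)

lemma orb_range: "0 \<le> orb n" "orb n \<le> 1"
  using T_range by (induction n) (auto simp: orb_simps less_imp_le)

text \<open>Parry's formula, not normalised: the weight \<open>1 / \<beta> ^ n\<close> is collected
  for every \<open>n\<close> with \<open>x < T^n 1\<close>. The orbit starts at the point 1 itself,
  so the term \<open>n = 0\<close> is the indicator of \<open>[0, 1)\<close> and bounds the density
  below by 1 there.\<close>

definition pdens :: "real \<Rightarrow> real" where
  "pdens x = (\<Sum>n. indicator {0..<orb n} x / \<beta> ^ n)"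

lemma geo_summable: "summable (\<lambda>n. C / \<beta> ^ n)"
proof -
  have "summable (\<lambda>n. C * (1/\<beta>) ^ n)"
    by (intro summable_mult summable_geometric) (use beta_gt_1 in simp)
  then show ?thesis by (simp add: power_divide)
qed

lemma pdens_summable: "summable (\<lambda>n. indicator {0..<orb n} x / \<beta> ^ n :: real)"
  by (rule summable_comparison_test'[OF geo_summable[of 1], where N=0])
     (use beta_pos in \<open>auto simp: indicator_def\<close>)

lemma pdens_measurable [measurable]: "pdens \<in> borel_measurable borel"
  unfolding pdens_def[abs_def] by measurable

lemma pdens_nonneg: "0 \<le> pdens x"
  unfolding pdens_def by (rule suminf_nonneg[OF pdens_summable]) (use beta_pos in simp)

lemma pdens_outside: "x \<notin> {0..<1} \<Longrightarrow> pdens x = 0"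
proof -
  assume "x \<notin> {0..<1}"
  then have "\<And>n. x \<notin> {0..<orb n}" using orb_range(2) by (auto intro: less_le_trans)
  then show ?thesis by (simp add: pdens_def)
qed

lemma pdens_ge_1: "x \<in> {0..<1} \<Longrightarrow> 1 \<le> pdens x"
proof -
  assume x: "x \<in> {0..<1}"
  have "(\<Sum>n<1. indicator {0..<orb n} x / \<beta> ^ n) \<le> pdens x"
    unfolding pdens_def by (rule sum_le_suminf[OF pdens_summable]) (use beta_pos in auto)
  then show ?thesis using x by (simp add: orb_simps)
qed

lemma pdens_le: "pdens x \<le> \<beta> / (\<beta> - 1)"
proof -
  have "pdens x \<le> (\<Sum>n. 1 / \<beta> ^ n)"
    unfolding pdens_def by (rule suminf_le[OF _ pdens_summable geo_summable])
      (use beta_pos in \<open>auto simp: indicator_def\<close>)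
  also have "\<dots> = (\<Sum>n. (1 / \<beta>) ^ n)" by (simp add: power_divide)
  also have "\<dots> = \<beta> / (\<beta> - 1)"
    by (subst suminf_geometric) (use beta_gt_1 in \<open>auto simp: field_simps\<close>)
  finally show ?thesis .
qed

definition pint :: "(real \<Rightarrow> real) \<Rightarrow> real" where
  "pint F = (LINT x|lborel. F x * pdens x)"

lemma pint_integrable: "bdd_borel B F \<Longrightarrow> integrable lborel (\<lambda>x. F x * pdens x)"
proof -
  assume F: "bdd_borel B F"
  define K where "K = B * (\<beta> / (\<beta> - 1))"
  have K: "0 \<le> K" using bdd_borel_nonneg[OF F] beta_gt_1 by (simp add: K_def)
  have *: "norm (F x * pdens x) \<le> norm (K * indicator {0..<1} x)" for x
  proof (cases "x \<in> {0..<1}")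
    case True
    have "\<bar>F x\<bar> * pdens x \<le> K" unfolding K_def
      by (rule mult_mono) (use F pdens_le pdens_nonneg bdd_borel_nonneg[OF F] in \<open>auto simp: bdd_borel_def\<close>)
    then show ?thesis using True K pdens_nonneg[of x] by (simp add: abs_mult)
  qed (use pdens_outside[of x] in simp)
  show ?thesis
    by (rule Bochner_Integration.integrable_bound[of _ "\<lambda>x. K * indicator {0..<1} x"])
       (use F * in \<open>auto simp: bdd_borel_def\<close>)
qed

text \<open>Integration against the density becomes a geometrically weighted sum of interval
  integrals along the orbit of 1, so identities for \<open>mint\<close> carry over to
  \<open>pint\<close>. The exchange of sum and integral is dominated by
  \<open>B / \<beta> ^ n\<close>.\<close>

lemma pint_sums:
  assumes F: "bdd_borel B F"
  shows "(\<lambda>n. mint F (orb n) / \<beta> ^ n) sums pint F"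
proof -
  let ?f = "\<lambda>n x. (indicator {0..<orb n} x * F x) / \<beta> ^ n"
  have B: "0 \<le> B" using F by (rule bdd_borel_nonneg)
  have i: "integrable lborel (?f n)" for n
    by (intro integrable_divide bdd_borel_integrable[OF F])
  have bd: "norm (?f n x) \<le> B / \<beta> ^ n" for n x
    using F beta_pos B by (auto simp: bdd_borel_def indicator_def divide_right_mono)
  have s: "summable (\<lambda>n. norm (?f n x))" for x
    by (rule summable_comparison_test'[OF geo_summable[of B], where N=0]) (use bd in auto)
  have "(LINT x|lborel. norm (?f n x)) \<le> B / \<beta> ^ n" for n
  proof -
    have "(LINT x|lborel. norm (?f n x)) \<le> (LINT x|lborel. (B / \<beta> ^ n) * indicator {0..<orb n} x)"
    proof (rule integral_mono)
      show "integrable lborel (\<lambda>x. norm (?f n x))" by (rule integrable_norm[OF i])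
      show "integrable lborel (\<lambda>x. (B / \<beta> ^ n) * indicator {0..<orb n} x)"
        using orb_range by (intro integrable_mult_right) simp
    qed (use F beta_pos in \<open>auto simp: bdd_borel_def indicator_def divide_right_mono\<close>)
    also have "\<dots> = (B / \<beta> ^ n) * orb n" using orb_range by simp
    also have "\<dots> \<le> (B / \<beta> ^ n) * 1" using orb_range[of n] B beta_pos by (intro mult_left_mono) auto
    finally show ?thesis by simp
  qed
  then have s2: "summable (\<lambda>n. (LINT x|lborel. norm (?f n x)))"
    by (intro summable_comparison_test'[OF geo_summable[of B], where N=0]) auto
  have "(\<lambda>n. (LINT x|lborel. ?f n x)) sums (LINT x|lborel. (\<Sum>n. ?f n x))"
    by (rule sums_integral[OF i _ s2]) (use s in auto)
  moreover have "(\<Sum>n. ?f n x) = F x * pdens x" for x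
    unfolding pdens_def suminf_mult[OF pdens_summable, symmetric]
    by (simp add: mult.commute)
  ultimately show ?thesis unfolding pint_def mint_def by simp
qed

definition "pmass = pint (\<lambda>_. 1)"

lemma bdd_one: "bdd_borel 1 (\<lambda>_. 1)" by (simp add: bdd_borel_def)

lemma mint_one: "0 \<le> t \<Longrightarrow> mint (\<lambda>_. 1) t = t" by (simp add: mint_def)

lemma pmass_sums: "(\<lambda>n. orb n / \<beta> ^ n) sums pmass"
  using pint_sums[OF bdd_one] orb_range unfolding pmass_def by (simp add: mint_one)

lemma pmass_ge_1: "1 \<le> pmass"
  using sum_le_suminf[OF sums_summable[OF pmass_sums], of "{..<1}"] orb_range beta_pos
    sums_unique[OF pmass_sums] by (simp add: orb_simps)

text \<open>At \<open>t = orb n\<close> the number of full periods is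
  \<open>\<beta> * orb n - orb (Suc n)\<close>; after division by \<open>\<beta> ^ Suc n\<close>
  these numbers telescope to 1. So the full periods contribute exactly \<open>mint F 1\<close>, the
  term \<open>n = 0\<close> that is missing from the shifted series formed by the
  remainders.\<close>

lemma pint_invariant:
  assumes F: "bdd_borel B F" shows "pint (\<lambda>x. F (T x)) = pint F"
proof -
  have FT: "bdd_borel B (\<lambda>x. F (T x))" using bdd_T[OF F, of 1] by simp
  let ?u = "\<lambda>n. orb n / \<beta> ^ n" and ?v = "\<lambda>n. mint F (orb n) / \<beta> ^ n"
  have eq: "mint (\<lambda>x. F (T x)) (orb n) / \<beta> ^ n
     = (?u n - ?u (Suc n)) * mint F 1 + ?v (Suc n)" for n
  proof -
    have "of_int \<lfloor>\<beta> * orb n\<rfloor> = \<beta> * orb n - orb (Suc n)"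
      by (simp add: orb_simps beta_map_def frac_def)
    then have "mint (\<lambda>x. F (T x)) (orb n) = ((\<beta> * orb n - orb (Suc n)) * mint F 1 + mint F (orb (Suc n))) / \<beta>"
      using mint_beta_map[OF F orb_range(1)[of n] beta_pos] by (simp add: orb_simps)
    then show ?thesis using beta_pos by (simp add: field_simps)
  qed
  have u0: "?u \<longlonglongrightarrow> 0" using summable_LIMSEQ_zero[OF sums_summable[OF pmass_sums]] .
  have "(\<lambda>n. ?u n - ?u (Suc n)) sums (?u 0 - 0)" by (rule telescope_sums'[OF u0])
  then have "(\<lambda>n. (?u n - ?u (Suc n)) * mint F 1) sums (1 * mint F 1)"
    by (intro sums_mult2) (simp add: orb_simps)
  moreover have "(\<lambda>n. ?v (Suc n)) sums (pint F - ?v 0)"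
    using sums_split_initial_segment[OF pint_sums[OF F], of 1] by simp
  ultimately have "(\<lambda>n. mint (\<lambda>x. F (T x)) (orb n) / \<beta> ^ n) sums (1 * mint F 1 + (pint F - ?v 0))"
    unfolding eq by (rule sums_add)
  then have "(\<lambda>n. mint (\<lambda>x. F (T x)) (orb n) / \<beta> ^ n) sums pint F" by (simp add: orb_simps)
  then show ?thesis using pint_sums[OF FT] sums_unique2 by blast
qed

lemma pint_invariant_pow:
  assumes F: "bdd_borel B F" shows "pint (\<lambda>x. F ((T ^^ k) x)) = pint F"
proof (induction k)
  case (Suc k)
  then show ?case using pint_invariant[OF bdd_T[OF F, of k]] by (simp add: funpow_swap1)
qed simp

lemma pint_tsum:
  assumes F: "bdd_borel B F" shows "pint (tsum n F) = real n * pint F"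
proof -
  have "pint (tsum n F) = (\<Sum>k<n. pint (\<lambda>x. F ((T ^^ k) x)))"
    unfolding pint_def tsum_def sum_distrib_right
    by (rule Bochner_Integration.integral_sum) (rule pint_integrable[OF bdd_T[OF F]])
  then show ?thesis by (simp add: pint_invariant_pow[OF F])
qed

definition "pmean F = pint F / pmass"

text \<open>Up to a bounded error the integral over \<open>[0, t)\<close> is \<open>t\<close> times
  that over \<open>[0, 1)\<close>. Weighting this along the orbit of 1 gives
  \<open>pint (tsum n F)\<close>, which is \<open>n * pint F\<close> by invariance, on one side and
  \<open>pmass\<close> times the integral over \<open>[0, 1)\<close> on the other; this identifies
  the growth rate. The point is that \<open>C\<close> is uniform in \<open>n\<close> and
  \<open>t\<close>.\<close>

lemma mint_tsum_asymp:
  assumes F: "bdd_borel B F"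
  obtains C where "\<And>n t. 0 \<le> t \<Longrightarrow> t \<le> 1 \<Longrightarrow> \<bar>mint (tsum n F) t - real n * (t * pmean F)\<bar> \<le> C"
proof -
  let ?C = "2 * B * \<beta> / (\<beta> - 1)" let ?D = "\<beta> / (\<beta> - 1)"
  have B: "0 \<le> B" using F by (rule bdd_borel_nonneg)
  have C0: "0 \<le> ?C" using B beta_gt_1 by simp
  have 1: "\<bar>mint (tsum n F) 1 - real n * pmean F\<bar> \<le> ?C * ?D" for n
  proof -
    let ?X = "mint (tsum n F) 1"
    have "(\<lambda>j. mint (tsum n F) (orb j) / \<beta> ^ j - orb j / \<beta> ^ j * ?X) sums (real n * pint F - pmass * ?X)"
      using sums_diff[OF pint_sums[OF bdd_tsum[OF F, of n]] sums_mult2[OF pmass_sums, of ?X]] pint_tsum[OF F]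
      by simp
    then have s: "(\<lambda>j. (mint (tsum n F) (orb j) - orb j * ?X) / \<beta> ^ j) sums (real n * pint F - pmass * ?X)"
      by (simp add: diff_divide_distrib mult.commute)
    have bd: "norm ((mint (tsum n F) (orb j) - orb j * ?X) / \<beta> ^ j) \<le> ?C / \<beta> ^ j" for j
      using divide_right_mono[OF mint_tsum_defect[OF F orb_range, of n j], of "\<beta> ^ j"] beta_pos by simp
    have "norm (\<Sum>j. (mint (tsum n F) (orb j) - orb j * ?X) / \<beta> ^ j) \<le> (\<Sum>j. ?C / \<beta> ^ j)"
      by (rule norm_suminf_le[OF bd geo_summable])
    then have "\<bar>real n * pint F - pmass * ?X\<bar> \<le> (\<Sum>j. ?C / \<beta> ^ j)"
      using sums_unique[OF s] by simp
    also have "\<dots> = ?C * (\<Sum>j. (1/\<beta>) ^ j)"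
      by (subst suminf_mult[symmetric]) (use beta_gt_1 in \<open>auto simp: power_divide intro!: summable_geometric\<close>)
    also have "(\<Sum>j. (1/\<beta>) ^ j) = ?D"
      by (subst suminf_geometric) (use beta_gt_1 in \<open>auto simp: field_simps\<close>)
    finally have *: "\<bar>real n * pint F - pmass * ?X\<bar> \<le> ?C * ?D" .
    have "\<bar>?X - real n * pmean F\<bar> = \<bar>real n * pint F - pmass * ?X\<bar> / pmass"
    proof -
      have "?X - real n * pmean F = - (real n * pint F - pmass * ?X) / pmass"
        using pmass_ge_1 unfolding pmean_def by (simp add: field_simps)
      then show ?thesis using pmass_ge_1 by (simp add: abs_divide)
    qed
    also have "\<dots> \<le> \<bar>real n * pint F - pmass * ?X\<bar> / 1"
      using pmass_ge_1 by (intro divide_left_mono) auto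
    finally show ?thesis using * by simp
  qed
  show thesis
  proof (rule that)
    fix n :: nat and t :: real assume t: "0 \<le> t" "t \<le> 1"
    have "\<bar>t * (mint (tsum n F) 1 - real n * pmean F)\<bar> \<le> 1 * (?C * ?D)"
      unfolding abs_mult using t 1[of n] by (intro mult_mono) auto
    then show "\<bar>mint (tsum n F) t - real n * (t * pmean F)\<bar> \<le> ?C + ?C * ?D"
      using mint_tsum_defect[OF F t, of n] by (auto simp: algebra_simps abs_le_iff)
  qed
qed

end

section \<open>Weak convergence of Birkhoff averages\<close>

lemma cesaro_null:
  fixes x :: "nat \<Rightarrow> real"
  assumes "x \<longlonglongrightarrow> 0" shows "(\<lambda>n. (\<Sum>k<n. x k) / real n) \<longlonglongrightarrow> 0"
proof (rule LIMSEQ_I)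
  fix e :: real assume e: "e > 0"
  obtain K where K: "\<And>k. k \<ge> K \<Longrightarrow> \<bar>x k\<bar> < e / 2"
    using LIMSEQ_D[OF assms, of "e/2"] e by auto
  define S where "S = (\<Sum>k<K. \<bar>x k\<bar>)"
  have S: "0 \<le> S" by (simp add: S_def sum_nonneg)
  obtain M where M: "real M > 2 * S / e" using reals_Archimedean2 by blast
  have "norm ((\<Sum>k<n. x k) / real n - 0) < e" if n: "n \<ge> max (max K M) 1" for n
  proof -
    have "(\<Sum>k<n. x k) = (\<Sum>k<K. x k) + (\<Sum>k=K..<n. x k)"
      using n sum.atLeastLessThan_concat[of 0 K n x] by (simp add: atLeast0LessThan)
    also have "\<bar>\<dots>\<bar> \<le> S + real n * (e / 2)"
    proof -
      have "\<bar>\<Sum>k<K. x k\<bar> \<le> S" unfolding S_def by (rule sum_abs)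
      moreover have "\<bar>\<Sum>k=K..<n. x k\<bar> \<le> (\<Sum>k=K..<n. e / 2)"
        by (rule order_trans[OF sum_abs sum_mono]) (use K in \<open>auto simp: less_imp_le\<close>)
      moreover have "(\<Sum>k=K..<n. e / 2) \<le> real n * (e / 2)" using e by (simp add: mult_right_mono)
      ultimately show ?thesis by linarith
    qed
    also have "\<dots> < real n * e"
    proof -
      have "2 * S < real M * e" using M e by (simp add: field_simps)
      also have "\<dots> \<le> real n * e" using n e by (intro mult_right_mono) auto
      finally show ?thesis by simp
    qed
    finally show ?thesis using n by (simp add: abs_divide field_simps)
  qed
  then show "\<exists>N. \<forall>n\<ge>N. norm ((\<Sum>k<n. x k) / real n - 0) < e" by blast
qed

lemma bdd_integrable:
  assumes "finite_measure M" "sets M = sets borel" "bdd_borel B F"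
  shows "integrable M F"
proof -
  interpret finite_measure M by fact
  have "F \<in> borel_measurable M"
    using assms by (simp add: bdd_borel_def measurable_cong_sets[OF assms(2) refl])
  then show ?thesis using assms(3) by (intro integrable_const_bound[of _ B]) (auto simp: bdd_borel_def)
qed

lemma bdd_times_integrable:
  fixes g :: "real \<Rightarrow> real"
  assumes "sets M = sets borel" "integrable M g" "bdd_borel B F"
  shows "integrable M (\<lambda>x. g x * F x)"
proof (rule Bochner_Integration.integrable_bound[of _ "\<lambda>x. B * g x"])
  have [measurable]: "F \<in> borel_measurable M"
    using assms by (simp add: bdd_borel_def measurable_cong_sets[OF assms(1) refl])
  show "(\<lambda>x. g x * F x) \<in> borel_measurable M" using assms(2) by measurable
  show "AE x in M. norm (g x * F x) \<le> norm (B * g x)"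
  proof (rule AE_I2)
    show "norm (g x * F x) \<le> norm (B * g x)" for x
      using assms(3) bdd_borel_nonneg[OF assms(3)] mult_right_mono[of "\<bar>F x\<bar>" B "\<bar>g x\<bar>"]
      by (simp add: bdd_borel_def abs_mult mult.commute)
  qed
qed (use assms(2) in simp)

lemma integral_times_bdd_le:
  fixes g :: "real \<Rightarrow> real"
  assumes "sets M = sets borel" "integrable M g" "bdd_borel B F"
  shows "\<bar>LINT x|M. g x * F x\<bar> \<le> B * (LINT x|M. \<bar>g x\<bar>)"
proof -
  have "\<bar>LINT x|M. g x * F x\<bar> \<le> (LINT x|M. \<bar>g x * F x\<bar>)" by (rule integral_abs_bound)
  also have "\<dots> \<le> (LINT x|M. B * \<bar>g x\<bar>)"
  proof (rule integral_mono)
    show "integrable M (\<lambda>x. \<bar>g x * F x\<bar>)" by (rule integrable_abs[OF bdd_times_integrable[OF assms]])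
    show "\<bar>g x * F x\<bar> \<le> B * \<bar>g x\<bar>" for x
      using assms(3) mult_right_mono[of "\<bar>F x\<bar>" B "\<bar>g x\<bar>"]
      by (simp add: bdd_borel_def abs_mult mult.commute)
  qed (use assms(2) in simp)
  finally show ?thesis by simp
qed

text \<open>A Dynkin argument passes from half-lines to Borel sets, and the density of simple
  functions in L1 does the rest; the common bound \<open>B\<close> makes both passages uniform in
  \<open>n\<close>.\<close>

lemma weak_null_limit:
  fixes \<Phi> :: "nat \<Rightarrow> real \<Rightarrow> real"
  assumes M: "finite_measure M" "sets M = sets borel"
    and bd: "\<And>n. bdd_borel B (\<Phi> n)"
    and half: "\<And>t. (\<lambda>n. LINT x|M. indicator {..<t} x * \<Phi> n x) \<longlonglongrightarrow> 0"
    and total: "(\<lambda>n. LINT x|M. \<Phi> n x) \<longlonglongrightarrow> 0"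
    and g: "integrable M g"
  shows "(\<lambda>n. LINT x|M. g x * \<Phi> n x) \<longlonglongrightarrow> 0"
proof -
  interpret finite_measure M by (rule M)
  have indI: "integrable M (indicator A :: real \<Rightarrow> real)" if "A \<in> sets borel" for A
    using that M(2) by (intro integrable_real_indicator) (auto simp: emeasure_eq_measure)
  have intI: "integrable M (\<lambda>x. indicator A x * \<Phi> n x)" if "A \<in> sets borel" for A n
    by (rule bdd_times_integrable[OF M(2) indI[OF that] bd])
  have gen: "(borel :: real measure) = sigma UNIV (range lessThan)"
    using borel_eq_lessThan[where 'a=real] by (simp add: eucl_lessThan lessThan_def)
  have sets: "(\<lambda>n. LINT x|M. indicator A x * \<Phi> n x) \<longlonglongrightarrow> 0" if "A \<in> sets borel" for A
  proof -
    have A: "A \<in> sigma_sets UNIV (range lessThan)"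
      using that by (subst (asm) gen) simp
    have bor: "X \<in> sets borel" if "X \<in> sigma_sets UNIV (range lessThan)" for X :: "real set"
      using that by (subst gen) simp
    have IS: "Int_stable (range lessThan :: real set set)"
    proof (unfold Int_stable_def, safe)
      fix a b :: real
      show "{..<a} \<inter> {..<b} \<in> range lessThan" by (rule range_eqI[of _ _ "min a b"]) auto
    qed
    have PW: "range lessThan \<subseteq> Pow (UNIV :: real set)" by simp
    show ?thesis
      using IS PW A
    proof (induction rule: sigma_sets_induct_disjoint)
      case (basic A)
      then show ?case using half by auto
    next
      case empty
      show ?case by simp
    next
      case (compl A)
      have "(LINT x|M. indicator (UNIV - A) x * \<Phi> n x) = (LINT x|M. \<Phi> n x) - (LINT x|M. indicator A x * \<Phi> n x)" for n
      proof -
        have "(LINT x|M. indicator (UNIV - A) x * \<Phi> n x) = (LINT x|M. \<Phi> n x - indicator A x * \<Phi> n x)"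
          by (rule Bochner_Integration.integral_cong) (auto simp: indicator_def)
        then show ?thesis
          by (simp add: Bochner_Integration.integral_diff[OF bdd_integrable[OF M bd] intI[OF bor[OF compl(1)]]])
      qed
      then show ?case using tendsto_diff[OF total compl.IH] by simp
    next
      case (union A)
      have Ab: "A i \<in> sets borel" for i using union(2) bor by auto
      have AM: "range A \<subseteq> sets M" using Ab M(2) by auto
      have sm: "(\<lambda>i. measure M (A i)) sums measure M (\<Union>i. A i)"
        by (rule finite_measure_UNION[OF AM union(1)])
      have B0: "0 \<le> B" using bd bdd_borel_nonneg by blast
      have le: "\<bar>LINT x|M. indicator (A i) x * \<Phi> n x\<bar> \<le> B * measure M (A i)" for i n
        using integral_times_bdd_le[OF M(2) indI[OF Ab] bd, of i n] Ab M(2) by simp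
      have s: "(LINT x|M. indicator (\<Union>i. A i) x * \<Phi> n x) = (\<Sum>i. LINT x|M. indicator (A i) x * \<Phi> n x)" for n
      proof -
        have sm0: "(\<lambda>i. indicator (A i) x :: real) sums indicator (\<Union>i. A i) x" for x
          using indicator_sums[of A x] union(1) by (auto simp: disjoint_family_on_def)
        have smx: "(\<lambda>i. indicator (A i) x * \<Phi> n x) sums (indicator (\<Union>i. A i) x * \<Phi> n x)" for x
          by (rule sums_mult2[OF sm0])
        have "(LINT x|M. (\<Sum>i. indicator (A i) x * \<Phi> n x)) = (\<Sum>i. LINT x|M. indicator (A i) x * \<Phi> n x)"
        proof (rule integral_suminf)
          have "summable (\<lambda>i. indicator (A i) x * \<bar>\<Phi> n x\<bar>)" for x
            by (rule sums_summable[OF sums_mult2[OF sm0]])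
          then show "AE x in M. summable (\<lambda>i. norm (indicator (A i) x * \<Phi> n x))"
            by (simp add: abs_mult)
          have "(LINT x|M. norm (indicator (A i) x * \<Phi> n x)) \<le> B * measure M (A i)" for i
          proof -
            have "bdd_borel B (\<lambda>x. \<bar>\<Phi> n x\<bar>)" using bd[of n]
              by (auto simp: bdd_borel_def intro!: borel_measurable_abs)
            from integral_times_bdd_le[OF M(2) indI[OF Ab[of i]] this] show ?thesis
              using Ab M(2) by (simp add: abs_mult)
          qed
          then show "summable (\<lambda>i. LINT x|M. norm (indicator (A i) x * \<Phi> n x))"
            by (intro summable_comparison_test'[OF summable_mult[OF sums_summable[OF sm], of B], where N=0]) auto
        qed (rule intI[OF Ab])
        then show ?thesis using smx by (simp add: sums_iff)
      qed
      \<comment> \<open>The masses of the disjoint pieces are summable, so Tannery's theorem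
        exchanges the limit with the sum over \<open>i\<close>.\<close>
      have "(\<lambda>n. \<Sum>i. LINT x|M. indicator (A i) x * \<Phi> n x) \<longlonglongrightarrow> (\<Sum>i. 0)"
        using tannerys_theorem[of "\<lambda>i n. LINT x|M. indicator (A i) x * \<Phi> n x" "\<lambda>_. 0" sequentially
            "\<lambda>i. B * measure M (A i)", OF union.IH]
          summable_mult[OF sums_summable[OF sm], of B] le by (simp add: always_eventually)
      then show ?case by (simp add: s)
    qed
  qed
  show ?thesis
    using g
  proof (induction g rule: integrable_induct)
    case (base A c)
    then have "A \<in> sets borel" using M(2) by simp
    from tendsto_mult_left[OF sets[OF this], of c] show ?case
      by (simp add: mult.commute mult.left_commute integral_mult_right_zero[symmetric]
          del: integral_mult_right_zero integral_mult_left_zero)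
  next
    case (add f g)
    then show ?case
      using tendsto_add[OF add.IH(1,2)] add.hyps
      by (simp add: distrib_right Bochner_Integration.integral_add bdd_times_integrable[OF M(2) _ bd])
  next
    case (lim f s)
    have B0: "0 \<le> B" using bd bdd_borel_nonneg by blast
    have "(\<lambda>i. LINT x|M. \<bar>f x - s i x\<bar>) \<longlonglongrightarrow> (LINT x|M. 0)"
    proof (rule integral_dominated_convergence[where w="\<lambda>x. 3 * \<bar>f x\<bar>"])
      show "AE x in M. (\<lambda>i. \<bar>f x - s i x\<bar>) \<longlonglongrightarrow> 0"
      proof (rule AE_I2)
        fix x assume "x \<in> space M"
        then have "(\<lambda>i. \<bar>f x - s i x\<bar>) \<longlonglongrightarrow> \<bar>f x - f x\<bar>"
          by (intro tendsto_rabs tendsto_diff tendsto_const lim.hyps(2))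
        then show "(\<lambda>i. \<bar>f x - s i x\<bar>) \<longlonglongrightarrow> 0" by simp
      qed
      show "AE x in M. norm \<bar>f x - s i x\<bar> \<le> 3 * \<bar>f x\<bar>" for i
      proof (rule AE_I2)
        fix x assume "x \<in> space M"
        from lim.hyps(3)[OF this, of i] show "norm \<bar>f x - s i x\<bar> \<le> 3 * \<bar>f x\<bar>" by simp
      qed
    qed (use lim in auto)
    then have conv: "(\<lambda>i. LINT x|M. \<bar>f x - s i x\<bar>) \<longlonglongrightarrow> 0" by simp
    show ?case
    proof (rule LIMSEQ_I)
      fix e :: real assume e: "e > 0"
      obtain i where i: "(LINT x|M. \<bar>f x - s i x\<bar>) < e / (2 * (B + 1))"
        using LIMSEQ_D[OF conv, of "e / (2 * (B + 1))"] e B0 by (auto simp: abs_less_iff)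
      obtain N where N: "\<And>n. n \<ge> N \<Longrightarrow> \<bar>LINT x|M. s i x * \<Phi> n x\<bar> < e / 2"
        using LIMSEQ_D[OF lim.IH[of i], of "e/2"] e by auto
      have "norm ((LINT x|M. f x * \<Phi> n x) - 0) < e" if "n \<ge> N" for n
      proof -
        have d: "integrable M (\<lambda>x. f x - s i x)" using lim by simp
        have "(LINT x|M. f x * \<Phi> n x) = (LINT x|M. (f x - s i x) * \<Phi> n x) + (LINT x|M. s i x * \<Phi> n x)"
          by (subst Bochner_Integration.integral_add[symmetric])
             (auto intro!: bdd_times_integrable[OF M(2) _ bd] d lim simp: left_diff_distrib)
        moreover have "\<bar>LINT x|M. (f x - s i x) * \<Phi> n x\<bar> \<le> B * (LINT x|M. \<bar>f x - s i x\<bar>)"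
          by (rule integral_times_bdd_le[OF M(2) d bd])
        moreover have "B * (LINT x|M. \<bar>f x - s i x\<bar>) \<le> e / 2"
        proof -
          have "B * (LINT x|M. \<bar>f x - s i x\<bar>) \<le> (B + 1) * (e / (2 * (B + 1)))"
            using i B0 by (intro mult_mono) auto
          also have "\<dots> = e / 2" using B0 by (simp add: field_simps)
          finally show ?thesis .
        qed
        ultimately show ?thesis using N[OF that] by simp
      qed
      then show "\<exists>N. \<forall>n\<ge>N. norm ((LINT x|M. f x * \<Phi> n x) - 0) < e" by blast
    qed
  qed
qed

abbreviation unit_leb :: "real measure" where
  "unit_leb \<equiv> density lborel (indicator {0..<1})"

lemma unit_leb: "finite_measure unit_leb" "sets unit_leb = sets borel"
  by (auto intro!: finite_measureI simp: emeasure_density)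

lemma unit_leb_integral:
  fixes f :: "real \<Rightarrow> real"
  assumes "f \<in> borel_measurable borel"
  shows "(LINT x|unit_leb. f x) = (LINT x|lborel. indicator {0..<1} x * f x)"
proof -
  have "unit_leb = density lborel (\<lambda>x. ennreal (indicator {0..<1} x))"
    by (simp add: ennreal_indicator)
  then show ?thesis using assms by (simp add: integral_density)
qed

lemma bdd_borel_diff_const:
  "bdd_borel B F \<Longrightarrow> bdd_borel (B + \<bar>c\<bar>) (\<lambda>x. F x - c)"
  unfolding bdd_borel_def by (auto intro: order_trans[OF abs_triangle_ineq4] add_right_mono)

lemma bdd_borel_mult: "bdd_borel B F \<Longrightarrow> bdd_borel C G \<Longrightarrow> bdd_borel (B * C) (\<lambda>x. F x * G x)"
  using bdd_borel_nonneg[of B F] unfolding bdd_borel_def by (auto simp: abs_mult intro!: mult_mono)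

context beta_transformation
begin

lemma bdd_average:
  assumes "bdd_borel B F" shows "bdd_borel B (\<lambda>x. tsum n F x / real n)"
proof (cases "n = 0")
  case True
  then show ?thesis using bdd_borel_nonneg[OF assms] by (simp add: bdd_borel_def)
next
  case False
  then show ?thesis using bdd_tsum[OF assms, of n] unfolding bdd_borel_def
    by (auto simp: abs_divide field_simps)
qed

lemma birkhoff_weak:
  assumes F: "bdd_borel B F" and g: "integrable unit_leb g"
  shows "(\<lambda>n. LINT x|unit_leb. g x * (tsum n F x / real n - pmean F)) \<longlonglongrightarrow> 0"
proof (rule weak_null_limit[OF unit_leb _ _ _ g])
  let ?R = "\<lambda>n x. tsum n F x / real n - pmean F"
  show bd: "bdd_borel (B + \<bar>pmean F\<bar>) (?R n)" for n
    by (rule bdd_borel_diff_const[OF bdd_average[OF F]])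
  obtain C where C: "\<And>n t. 0 \<le> t \<Longrightarrow> t \<le> 1 \<Longrightarrow> \<bar>mint (tsum n F) t - real n * (t * pmean F)\<bar> \<le> C"
    using mint_tsum_asymp[OF F] by blast
  have lim: "(\<lambda>n. LINT x|lborel. indicator {0..<t} x * ?R n x) \<longlonglongrightarrow> 0" if t: "0 \<le> t" "t \<le> 1" for t
  proof (rule Lim_null_comparison)
    show "\<forall>\<^sub>F n in sequentially. norm (LINT x|lborel. indicator {0..<t} x * ?R n x) \<le> C / real n"
    proof (rule eventually_sequentiallyI[of 1])
      fix n :: nat assume n: "1 \<le> n"
      have "(LINT x|lborel. indicator {0..<t} x * ?R n x)
         = (LINT x|lborel. (indicator {0..<t} x * tsum n F x) / real n - indicator {0..<t} x * pmean F)"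
        by (rule Bochner_Integration.integral_cong) (auto simp: indicator_def)
      also have "\<dots> = mint (tsum n F) t / real n - t * pmean F"
        unfolding mint_def
        by (subst Bochner_Integration.integral_diff)
           (use t in \<open>auto intro!: integrable_divide bdd_borel_integrable[OF bdd_tsum[OF F]]\<close>)
      also have "\<dots> = (mint (tsum n F) t - real n * (t * pmean F)) / real n"
        using n by (simp add: field_simps)
      finally show "norm (LINT x|lborel. indicator {0..<t} x * ?R n x) \<le> C / real n"
        using C[OF t, of n] n by (simp add: abs_divide divide_right_mono)
    qed
    show "(\<lambda>n. C / real n) \<longlonglongrightarrow> 0" by (rule lim_const_over_n)
  qed
  have [measurable]: "?R n \<in> borel_measurable borel" for n using bd[of n] by (simp add: bdd_borel_def)
  show "(\<lambda>n. LINT x|unit_leb. indicator {..<t} x * ?R n x) \<longlonglongrightarrow> 0" for t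
  proof -
    have "(LINT x|unit_leb. indicator {..<t} x * ?R n x)
        = (LINT x|lborel. indicator {0..<min 1 (max 0 t)} x * ?R n x)" for n
      by (subst unit_leb_integral, measurable)
         (rule Bochner_Integration.integral_cong, auto simp: indicator_def)
    then show ?thesis using lim[of "min 1 (max 0 t)"] by simp
  qed
  show "(\<lambda>n. LINT x|unit_leb. ?R n x) \<longlonglongrightarrow> 0"
  proof -
    have m: "?R n \<in> borel_measurable borel" for n by measurable
    show ?thesis using lim[of 1] by (simp add: unit_leb_integral[OF m])
  qed
qed

section \<open>The Parry measure and its uniqueness\<close>

definition "pmeasure = density lborel (\<lambda>x. ennreal (pdens x / pmass))"

lemma pmeasure_integral:
  assumes "bdd_borel B F" shows "integral\<^sup>L pmeasure F = pmean F"
proof -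
  have "integral\<^sup>L pmeasure F = (LINT x|lborel. (F x * pdens x) / pmass)"
    unfolding pmeasure_def using assms pdens_nonneg pmass_ge_1
    by (subst integral_density) (auto simp: bdd_borel_def mult.commute)
  then show ?thesis by (simp add: pmean_def pint_def)
qed

lemma pmeasure_emeasure:
  assumes "A \<in> sets borel" shows "emeasure pmeasure A = ennreal (pmean (indicator A))"
proof -
  have bd: "bdd_borel 1 (indicator A)" using assms by (auto simp: bdd_borel_def indicator_def)
  have i: "integrable lborel (\<lambda>x. indicator A x * pdens x / pmass)"
    by (rule integrable_divide[OF pint_integrable[OF bd]])
  have "emeasure pmeasure A = (\<integral>\<^sup>+x. ennreal (indicator A x * pdens x / pmass) \<partial>lborel)"
    unfolding pmeasure_def using assms
    by (subst emeasure_density) (auto intro!: nn_integral_cong simp: indicator_def)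
  also have "\<dots> = ennreal (LINT x|lborel. indicator A x * pdens x / pmass)"
    by (rule nn_integral_eq_integral[OF i]) (use pdens_nonneg pmass_ge_1 in auto)
  finally show ?thesis by (simp add: pmean_def pint_def)
qed

lemma pmean_one: "pmean (\<lambda>_. 1) = 1" using pmass_ge_1 by (simp add: pmean_def pmass_def)

lemma pmeasure_parry: "is_parry_measure \<beta> pmeasure"
  unfolding is_parry_measure_def
proof (intro conjI)
  show s: "sets pmeasure = sets borel" by (simp add: pmeasure_def)
  have sp: "space pmeasure = UNIV" by (simp add: pmeasure_def)
  show p: "prob_space pmeasure"
    by (rule prob_spaceI) (simp add: sp pmeasure_emeasure pmean_one)
  have "pint (indicator {0..<1}) = pmass" unfolding pmass_def pint_def
    by (rule Bochner_Integration.integral_cong) (use pdens_outside in \<open>auto simp: indicator_def\<close>)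
  then show "emeasure pmeasure {0..<1} = 1" using pmass_ge_1 by (simp add: pmeasure_emeasure pmean_def)
  show "absolutely_continuous lborel pmeasure"
    unfolding pmeasure_def by (rule absolutely_continuousI_density) simp
  have m: "T \<in> measurable pmeasure borel" by (simp add: measurable_cong_sets[OF s refl])
  show "distr pmeasure borel T = pmeasure"
  proof (rule measure_eqI)
    fix A assume "A \<in> sets (distr pmeasure borel T)"
    then have A [measurable]: "A \<in> sets borel" by simp
    have bd: "bdd_borel 1 (indicator A)" using A by (auto simp: bdd_borel_def indicator_def)
    have "T -` A \<inter> space borel \<in> sets borel" by measurable
    then have "emeasure pmeasure (T -` A) = ennreal (pmean (indicator (T -` A)))"
      by (intro pmeasure_emeasure) simp
    also have "pmean (indicator (T -` A)) = pmean (indicator A)"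
      using pint_invariant[OF bd] by (simp add: pmean_def indicator_def[abs_def])
    finally show "emeasure (distr pmeasure borel T) A = emeasure pmeasure A"
      using A m by (simp add: emeasure_distr sp pmeasure_emeasure)
  qed (simp add: s)
qed

text \<open>For the Lebesgue density \<open>D\<close> of \<open>\<nu>\<close>, the pairing of
  \<open>D\<close> with the centred averages is independent of \<open>n \<ge> 1\<close> by
  invariance and tends to 0 by weak convergence, so it is 0. Uniqueness is what gives the definite
  description \<open>parry_measure\<close> its value.\<close>

lemma parry_unique:
  assumes nu: "is_parry_measure \<beta> \<nu>" shows "\<nu> = pmeasure"
proof -
  interpret N: prob_space \<nu> using nu by (simp add: is_parry_measure_def)
  have s: "sets \<nu> = sets borel" and one: "emeasure \<nu> {0..<1} = 1"
    and ac: "absolutely_continuous lborel \<nu>" and inv: "distr \<nu> borel T = \<nu>"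
    using nu by (auto simp: is_parry_measure_def)
  have sp: "space \<nu> = UNIV" using sets_eq_imp_space_eq[OF s] by simp
  have [measurable_cong]: "sets \<nu> = sets borel" by (rule s)
  have ae01: "AE x in \<nu>. x \<in> {0..<1}"
    using one by (subst N.AE_in_set_eq_1) (auto simp: s measure_def)
  have sl: "sets \<nu> = sets lborel" by (simp add: s)
  obtain D where D: "D \<in> borel_measurable lborel" "AE x in lborel. RN_deriv lborel \<nu> x = ennreal (D x)"
    "\<And>x. 0 \<le> D x"
    using sigma_finite_measure.real_RN_deriv[OF sigma_finite_lborel N.finite_measure_axioms ac sl] by blast
  have [measurable]: "D \<in> borel_measurable borel" using D(1) by simp
  have nuD: "\<nu> = density lborel (\<lambda>x. ennreal (D x))"
    using sigma_finite_measure.density_RN_deriv[OF sigma_finite_lborel ac] s D(2)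
      density_cong[of "RN_deriv lborel \<nu>" lborel "\<lambda>x. ennreal (D x)"] by simp
  have intnu: "(LINT x|\<nu>. F x) = (LINT x|unit_leb. D x * F x)" if F: "F \<in> borel_measurable borel"
    for F :: "real \<Rightarrow> real"
  proof -
    have "(LINT x|\<nu>. F x) = (LINT x|\<nu>. indicator {0..<1} x * F x)"
      by (rule integral_cong_AE) (use F ae01 in \<open>auto simp: indicator_def\<close>)
    also have "\<dots> = (LINT x|lborel. indicator {0..<1} x * (D x * F x))"
      by (subst nuD, subst integral_density) (use F D in \<open>auto simp: mult.left_commute\<close>)
    also have "\<dots> = (LINT x|unit_leb. D x * F x)" using F by (simp add: unit_leb_integral)
    finally show ?thesis .
  qed
  have Dint: "integrable unit_leb D"
  proof -
    have "integrable lborel D"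
    proof (rule integrableI_nonneg)
      have "(\<integral>\<^sup>+x. ennreal (D x) \<partial>lborel) = emeasure \<nu> UNIV"
        by (subst nuD) (simp add: emeasure_density)
      then show "(\<integral>\<^sup>+x. ennreal (D x) \<partial>lborel) < \<infinity>" using N.emeasure_space_1 sp by simp
    qed (use D in auto)
    then have "integrable lborel (\<lambda>x. indicator {0..<1} x * D x)"
      using integrable_mult_indicator[of "{0..<1}" lborel D] by simp
    moreover have "unit_leb = density lborel (\<lambda>x. ennreal (indicator {0..<1} x))"
      by (simp add: ennreal_indicator)
    ultimately show ?thesis by (simp add: integrable_density)
  qed
  have key: "(LINT x|\<nu>. F x) = pmean F" if F: "bdd_borel B F" for B F
  proof -
    have [measurable]: "F \<in> borel_measurable borel" using F by (simp add: bdd_borel_def)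
    have iN: "integrable \<nu> G" if "bdd_borel C G" for C G
      by (rule bdd_integrable[OF N.finite_measure_axioms s that])
    have step: "(LINT x|\<nu>. G (T x)) = (LINT x|\<nu>. G x)" if "bdd_borel C G" for C G
    proof -
      have "(LINT x|distr \<nu> borel T. G x) = (LINT x|\<nu>. G (T x))"
        by (rule integral_distr) (use that in \<open>auto simp: bdd_borel_def\<close>)
      then show ?thesis by (simp add: inv)
    qed
    have pow: "(LINT x|\<nu>. F ((T ^^ k) x)) = (LINT x|\<nu>. F x)" for k
    proof (induction k)
      case (Suc k)
      then show ?case using step[OF bdd_T[OF F, of k]] by (simp add: funpow_swap1)
    qed simp
    have eq: "(LINT x|unit_leb. D x * (tsum n F x / real n - pmean F)) = (LINT x|\<nu>. F x) - pmean F" if "n \<ge> 1" for n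
    proof -
      have bd: "bdd_borel (B + \<bar>pmean F\<bar>) (\<lambda>x. tsum n F x / real n - pmean F)"
        by (rule bdd_borel_diff_const[OF bdd_average[OF F]])
      have "(LINT x|unit_leb. D x * (tsum n F x / real n - pmean F)) = (LINT x|\<nu>. tsum n F x / real n - pmean F)"
        by (rule intnu[symmetric]) (use bd in \<open>simp add: bdd_borel_def\<close>)
      also have "\<dots> = (LINT x|\<nu>. tsum n F x / real n) - pmean F"
        by (subst Bochner_Integration.integral_diff) (auto intro!: iN bdd_average[OF F] simp: N.prob_space)
      also have "(LINT x|\<nu>. tsum n F x / real n) = (\<Sum>k<n. LINT x|\<nu>. F ((T ^^ k) x)) / real n"
        unfolding tsum_def by (simp add: Bochner_Integration.integral_sum iN[OF bdd_T[OF F]])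
      finally show ?thesis using that by (simp add: pow)
    qed
    have "(\<lambda>n. LINT x|unit_leb. D x * (tsum n F x / real n - pmean F)) \<longlonglongrightarrow> (LINT x|\<nu>. F x) - pmean F"
      by (rule tendsto_eventually) (rule eventually_sequentiallyI[of 1], rule eq)
    then show ?thesis using LIMSEQ_unique[OF birkhoff_weak[OF F Dint]] by fastforce
  qed
  show ?thesis
  proof (rule measure_eqI)
    show "sets \<nu> = sets pmeasure" by (simp add: s pmeasure_def)
    fix A assume "A \<in> sets \<nu>"
    then have A: "A \<in> sets borel" by (simp add: s)
    have "bdd_borel 1 (indicator A)" using A by (auto simp: bdd_borel_def indicator_def)
    from key[OF this] have "measure \<nu> A = pmean (indicator A)" using A sp by simp
    then show "emeasure \<nu> A = emeasure pmeasure A"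
      by (simp add: N.emeasure_eq_measure pmeasure_emeasure[OF A])
  qed
qed

lemma parry_measure_eq: "parry_measure \<beta> = pmeasure"
  unfolding parry_measure_def using pmeasure_parry parry_unique by (rule the_equality)

section \<open>The mean ergodic theorem\<close>

lemma tsum_Suc: "tsum (Suc n) F x = F x + tsum n F (T x)"
  unfolding tsum_def by (subst sum.lessThan_Suc_shift) (simp add: funpow_swap1)

lemma pint_add:
  assumes "bdd_borel B F" "bdd_borel C G" shows "pint (\<lambda>x. F x + G x) = pint F + pint G"
  unfolding pint_def distrib_right
  by (rule Bochner_Integration.integral_add[OF pint_integrable[OF assms(1)] pint_integrable[OF assms(2)]])

lemma pint_cmult: "pint (\<lambda>x. c * F x) = c * pint F"
  unfolding pint_def by (simp add: mult.assoc)

text \<open>For the Birkhoff sums, \<open>S_(n+1) = F + S_n o T\<close>; with invariance this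
  expresses the increment of the second moment through the correlation of \<open>F\<close> with
  \<open>S_(n+1)\<close>. Weak convergence tested against \<open>F * pdens\<close> makes this
  correlation \<open>o(n)\<close>, hence the second moment is \<open>o(n^2)\<close>.\<close>

lemma mean_ergodic_L2:
  assumes F: "bdd_borel B F" and zero: "pint F = 0"
  shows "(\<lambda>n. pint (\<lambda>x. (tsum n F x / real n)\<^sup>2)) \<longlonglongrightarrow> 0"
proof -
  define \<sigma> where "\<sigma> n = pint (\<lambda>x. F x * tsum n F x)" for n
  have FF: "bdd_borel (B * B) (\<lambda>x. F x * F x)" by (rule bdd_borel_mult[OF F F])
  have rec: "pint (\<lambda>x. (tsum (Suc n) F x)\<^sup>2) = pint (\<lambda>x. (tsum n F x)\<^sup>2) + (2 * \<sigma> (Suc n) - pint (\<lambda>x. F x * F x))" for n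
  proof -
    note b1 = bdd_borel_mult[OF bdd_tsum[OF F, of n] bdd_tsum[OF F, of n]]
    note b2 = bdd_borel_mult[OF F bdd_tsum[OF F, of "Suc n"]]
    have eq: "(tsum (Suc n) F x)\<^sup>2 = tsum n F (T x) * tsum n F (T x)
        + (2 * (F x * tsum (Suc n) F x) + (-1) * (F x * F x))" for x
      unfolding tsum_Suc by (simp add: power2_eq_square algebra_simps)
    have c: "bdd_borel (\<bar>k\<bar> * C) (\<lambda>x. k * G x)" if "bdd_borel C G" for k C G
      using that by (auto simp: bdd_borel_def abs_mult intro: mult_left_mono)
    have s: "bdd_borel (C + C') (\<lambda>x. G x + G' x)" if "bdd_borel C G" "bdd_borel C' G'" for C C' G G'
      using that by (auto simp: bdd_borel_def intro: order_trans[OF abs_triangle_ineq] add_mono)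
    note bT = bdd_T[OF b1, of 1, simplified]
    have "pint (\<lambda>x. (tsum (Suc n) F x)\<^sup>2) = pint (\<lambda>x. tsum n F (T x) * tsum n F (T x))
        + (2 * \<sigma> (Suc n) + (-1) * pint (\<lambda>x. F x * F x))"
      unfolding eq \<sigma>_def
      by (subst pint_add[OF bT s[OF c[OF b2] c[OF FF]]], subst pint_add[OF c[OF b2] c[OF FF]])
         (simp only: pint_cmult)
    also have "pint (\<lambda>x. tsum n F (T x) * tsum n F (T x)) = pint (\<lambda>x. tsum n F x * tsum n F x)"
      by (rule pint_invariant[OF b1])
    finally show ?thesis by (simp add: power2_eq_square)
  qed
  have sig: "(\<lambda>n. \<sigma> n / real n) \<longlonglongrightarrow> 0"
  proof -
    have bd: "bdd_borel (B * (\<beta> / (\<beta> - 1))) (\<lambda>x. F x * pdens x)"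
      by (rule bdd_borel_mult[OF F]) (use pdens_le pdens_nonneg in \<open>auto simp: bdd_borel_def\<close>)
    have "(\<lambda>n. LINT x|unit_leb. (F x * pdens x) * (tsum n F x / real n - pmean F)) \<longlonglongrightarrow> 0"
      by (rule birkhoff_weak[OF F bdd_integrable[OF unit_leb bd]])
    moreover have "(LINT x|unit_leb. (F x * pdens x) * (tsum n F x / real n - pmean F)) = \<sigma> n / real n" for n
    proof -
      have [measurable]: "F \<in> borel_measurable borel" "tsum n F \<in> borel_measurable borel"
        using F bdd_tsum[OF F, of n] by (auto simp: bdd_borel_def)
      have "(LINT x|unit_leb. (F x * pdens x) * (tsum n F x / real n - pmean F))
          = (LINT x|lborel. (F x * tsum n F x * pdens x) / real n)"
        unfolding pmean_def zero
        by (subst unit_leb_integral, measurable)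
           (rule Bochner_Integration.integral_cong, use pdens_outside in \<open>auto simp: indicator_def\<close>)
      then show ?thesis by (simp add: \<sigma>_def pint_def)
    qed
    ultimately show ?thesis by simp
  qed
  \<comment> \<open>Increments divided by their index: the second moment is then at most
    \<open>n\<close> times the sum of the \<open>\<bar>\<epsilon> k\<bar>\<close>, and division by
    \<open>n^2\<close> leaves a Cesaro mean.\<close>
  define \<epsilon> where "\<epsilon> n = (2 * \<sigma> (Suc n) - pint (\<lambda>x. F x * F x)) / real (Suc n)" for n
  have S: "pint (\<lambda>x. (tsum n F x)\<^sup>2) = (\<Sum>k<n. real (Suc k) * \<epsilon> k)" for n
  proof (induction n)
    case 0
    show ?case by (simp add: tsum_def pint_def)
  next
    case (Suc n)
    then show ?case by (simp add: rec \<epsilon>_def)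
  qed
  have "(\<lambda>n. 2 * (\<sigma> (Suc n) / real (Suc n)) - pint (\<lambda>x. F x * F x) / real (Suc n)) \<longlonglongrightarrow> 2 * 0 - 0"
    by (intro tendsto_diff tendsto_mult tendsto_const LIMSEQ_Suc[OF sig] LIMSEQ_Suc[OF lim_const_over_n])
  then have "\<epsilon> \<longlonglongrightarrow> 0" unfolding \<epsilon>_def[abs_def] by (simp add: diff_divide_distrib)
  then have ces: "(\<lambda>n. (\<Sum>k<n. \<bar>\<epsilon> k\<bar>) / real n) \<longlonglongrightarrow> 0"
    by (intro cesaro_null tendsto_rabs_zero)
  show ?thesis
  proof (rule Lim_null_comparison[OF _ ces], rule eventually_sequentiallyI[of 1])
    fix n :: nat assume n: "1 \<le> n"
    have "pint (\<lambda>x. (tsum n F x / real n)\<^sup>2) = (1 / (real n)\<^sup>2) * pint (\<lambda>x. (tsum n F x)\<^sup>2)"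
      by (subst pint_cmult[symmetric]) (simp add: power_divide)
    moreover have "\<bar>\<Sum>k<n. real (Suc k) * \<epsilon> k\<bar> \<le> (\<Sum>k<n. real n * \<bar>\<epsilon> k\<bar>)"
      by (rule order_trans[OF sum_abs sum_mono]) (auto simp: abs_mult intro!: mult_right_mono)
    ultimately have "norm (pint (\<lambda>x. (tsum n F x / real n)\<^sup>2)) \<le> (1 / (real n)\<^sup>2) * (real n * (\<Sum>k<n. \<bar>\<epsilon> k\<bar>))"
      unfolding S
      by (simp only: real_norm_def abs_mult sum_distrib_left[symmetric]) (intro mult_mono, auto)
    then show "norm (pint (\<lambda>x. (tsum n F x / real n)\<^sup>2)) \<le> (\<Sum>k<n. \<bar>\<epsilon> k\<bar>) / real n"
      using n by (simp add: power2_eq_square)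
  qed
qed

text \<open>Lebesgue measure replaces the Parry measure because visiting frequencies will be
  compared with interval lengths. The change is allowed by \<open>pdens \<ge> 1\<close> on
  \<open>[0, 1)\<close>, and \<open>\<bar>R\<bar> \<le> R^2 / (2 * e) + e / 2\<close> leads from L2
  to L1.\<close>

lemma mean_ergodic_L1:
  assumes F: "bdd_borel B F" and e: "e > 0"
  obtains n where "n \<ge> 1" "mint (\<lambda>x. \<bar>tsum n F x / real n - pmean F\<bar>) 1 \<le> e"
proof -
  let ?G = "\<lambda>x. F x - pmean F"
  have G: "bdd_borel (B + \<bar>pmean F\<bar>) ?G" by (rule bdd_borel_diff_const[OF F])
  have "pint ?G = 0"
  proof -
    have "pint ?G = pint (\<lambda>x. F x + (- pmean F) * 1)" by simp
    also have "\<dots> = pint F + pint (\<lambda>x. (- pmean F) * 1)"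
      by (rule pint_add[OF F, of "\<bar>pmean F\<bar>"]) (simp add: bdd_borel_def)
    finally show ?thesis using pmass_ge_1 by (simp only: pint_cmult) (simp add: pmass_def[symmetric] pmean_def)
  qed
  from LIMSEQ_D[OF mean_ergodic_L2[OF G this], of "e\<^sup>2"] e
  obtain N where N: "\<And>n. n \<ge> N \<Longrightarrow> \<bar>pint (\<lambda>x. (tsum n ?G x / real n)\<^sup>2)\<bar> < e\<^sup>2" by auto
  define n where "n = max N 1"
  define R where "R x = tsum n F x / real n - pmean F" for x
  have n: "n \<ge> 1" "n \<ge> N" by (auto simp: n_def)
  have tG: "tsum n ?G x / real n = R x" for x
    using n by (simp add: R_def tsum_def sum_subtractf diff_divide_distrib)
  have R: "bdd_borel (B + \<bar>pmean F\<bar>) R"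
    unfolding R_def[abs_def] by (rule bdd_borel_diff_const[OF bdd_average[OF F]])
  have RR: "bdd_borel ((B + \<bar>pmean F\<bar>) * (B + \<bar>pmean F\<bar>)) (\<lambda>x. (R x)\<^sup>2)"
    using bdd_borel_mult[OF R R] by (simp add: power2_eq_square)
  have small: "pint (\<lambda>x. (R x)\<^sup>2) \<le> e\<^sup>2" using N[OF n(2)] unfolding tG by simp
  have "mint (\<lambda>x. \<bar>R x\<bar>) 1 \<le> (LINT x|lborel. ((R x)\<^sup>2 * pdens x) / (2 * e) + (e / 2) * indicator {0..<1} x)"
    unfolding mint_def
  proof (rule integral_mono)
    show "integrable lborel (\<lambda>x. indicator {0..<1} x * \<bar>R x\<bar>)"
      by (rule bdd_borel_integrable) (use R in \<open>auto simp: bdd_borel_def\<close>)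
    show "integrable lborel (\<lambda>x. ((R x)\<^sup>2 * pdens x) / (2 * e) + (e / 2) * indicator {0..<1} x)"
      by (intro Bochner_Integration.integrable_add integrable_divide pint_integrable[OF RR]) simp
    fix x
    show "indicator {0..<1} x * \<bar>R x\<bar> \<le> ((R x)\<^sup>2 * pdens x) / (2 * e) + (e / 2) * indicator {0..<1} x"
    proof (cases "x \<in> {0..<1}")
      case True
      have "0 \<le> (\<bar>R x\<bar> - e)\<^sup>2" by simp
      then have "\<bar>R x\<bar> * (2 * e) \<le> (R x)\<^sup>2 * 1 + e * e" by (simp add: power2_diff power2_eq_square algebra_simps)
      also have "(R x)\<^sup>2 * 1 \<le> (R x)\<^sup>2 * pdens x" by (rule mult_left_mono[OF pdens_ge_1[OF True]]) simp
      finally show ?thesis using True e by (simp add: field_simps)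
    qed (use e pdens_nonneg in auto)
  qed
  also have "\<dots> = pint (\<lambda>x. (R x)\<^sup>2) / (2 * e) + e / 2"
    unfolding pint_def
    by (subst Bochner_Integration.integral_add) (auto intro!: integrable_divide pint_integrable[OF RR])
  also have "\<dots> \<le> e\<^sup>2 / (2 * e) + e / 2" using small e by (intro add_right_mono divide_right_mono) auto
  also have "\<dots> = e" using e by (simp add: power2_eq_square)
  finally show thesis using that[OF n(1)] by (simp add: R_def)
qed

end

section \<open>A criterion for \<open>\<beta>\<close>-normality\<close>

text \<open>Upper Darboux sums of an almost everywhere continuous function, seen as integrals of
  step functions that converge dominatedly. Suprema are taken over the closed cells
  \<open>I\<close>, which is how visits will be counted, while the half-open cells \<open>J\<close>
  partition \<open>[0, 1)\<close>.\<close>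

lemma upper_sum_limit:
  fixes G :: "real \<Rightarrow> real"
  assumes G: "bdd_borel K G" and G0: "\<And>x. 0 \<le> G x" and cont: "AE x in lborel. isCont G x"
  shows "(\<lambda>m. (\<Sum>j<Suc m. Sup (G ` {real j / Suc m..(real j + 1) / Suc m})) / Suc m)
    \<longlonglongrightarrow> mint G 1"
proof -
  define I where "I m j = {real j / Suc m..(real j + 1) / Suc m}" for m j :: nat
  define J where "J m j = {real j / Suc m..<(real j + 1) / Suc m}" for m j :: nat
  define s where "s m j = Sup (G ` I m j)" for m j
  define U where "U m x = (\<Sum>j<Suc m. s m j * indicator (J m j) x)" for m x
  have K: "\<And>x. G x \<le> K" "0 \<le> K" using G bdd_borel_nonneg[OF G] by (auto simp: bdd_borel_def abs_le_iff)
  have bdd: "bdd_above (G ` X)" for X using K(1) by (intro bdd_aboveI[of _ K]) auto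
  have ne: "I m j \<noteq> {}" for m j by (simp add: I_def divide_right_mono)
  have s_upper: "G x \<le> s m j" if "x \<in> I m j" for x m j
    unfolding s_def by (rule cSup_upper[OF _ bdd]) (use that in auto)
  have s_le: "s m j \<le> c" if "\<And>x. x \<in> I m j \<Longrightarrow> G x \<le> c" for m j c
    unfolding s_def by (rule cSup_least) (use that ne in auto)
  have s_bd: "0 \<le> s m j" "s m j \<le> K" for m j
  proof -
    obtain x where "x \<in> I m j" using ne by blast
    then show "0 \<le> s m j" using s_upper G0 order_trans by blast
    show "s m j \<le> K" by (rule s_le) (rule K(1))
  qed
  have Uval: "U m x = s m (nat \<lfloor>Suc m * x\<rfloor>) \<and> x \<in> I m (nat \<lfloor>Suc m * x\<rfloor>)" if x: "x \<in> {0..<1}" for m and x :: real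
  proof -
    define j0 where "j0 = nat \<lfloor>Suc m * x\<rfloor>"
    have j0: "real j0 \<le> Suc m * x" "Suc m * x < real j0 + 1" using x unfolding j0_def by auto
    have "real j0 < Suc m" using j0(1) x by (simp add: less_le_trans[OF _ ] mult_less_cancel_left_pos le_less_trans)
    then have lt: "j0 < Suc m" by simp
    have iff: "x \<in> J m j \<longleftrightarrow> j = j0" for j
    proof
      assume "x \<in> J m j"
      then have "real j \<le> Suc m * x" "Suc m * x < real j + 1" by (auto simp: J_def field_simps)
      then show "j = j0" using j0 by linarith
    qed (use j0 in \<open>auto simp: J_def field_simps\<close>)
    have "U m x = (\<Sum>j<Suc m. if j = j0 then s m j0 else 0)"
      unfolding U_def by (rule sum.cong) (auto simp: iff indicator_def)
    also have "\<dots> = s m j0" using lt by simp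
    finally show ?thesis unfolding j0_def[symmetric] I_def using j0
      by (auto simp: field_simps simp del: of_nat_Suc)
  qed
  have Uout: "U m x = 0" if x: "x \<notin> {0..<1}" for m and x :: real
  proof -
    have "x \<notin> J m j" if "j < Suc m" for j
    proof
      assume "x \<in> J m j"
      then have *: "real j / Suc m \<le> x" "x < (real j + 1) / Suc m" by (auto simp: J_def)
      have "(real j + 1) / Suc m \<le> 1" using that by (simp add: field_simps)
      then have "x < 1" by (rule less_le_trans[OF *(2)])
      moreover have "0 \<le> x" by (rule order_trans[OF _ *(1)]) simp
      ultimately show False using x by auto
    qed
    then show ?thesis by (simp add: U_def)
  qed
  have lim: "(\<lambda>m. U m x) \<longlonglongrightarrow> indicator {0..<1} x * G x" if c: "isCont G x" for x
  proof (cases "x \<in> {0..<1}")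
    case True
    show ?thesis
    proof (rule LIMSEQ_I)
      fix e :: real assume e: "e > 0"
      then obtain d where d: "d > 0" "\<And>y. \<bar>y - x\<bar> < d \<Longrightarrow> \<bar>G y - G x\<bar> < e / 2"
        using c unfolding continuous_at_eps_delta by (metis dist_real_def half_gt_zero)
      obtain N where N: "inverse (real (Suc N)) < d" using d(1) reals_Archimedean by blast
      have "norm (U m x - indicator {0..<1} x * G x) < e" if "m \<ge> N" for m
      proof -
        define j where "j = nat \<lfloor>Suc m * x\<rfloor>"
        have U: "U m x = s m j" "x \<in> I m j" using Uval[OF True, of m] by (auto simp: j_def)
        have "inverse (real (Suc m)) < d"
          using N that le_less_trans[OF le_imp_inverse_le, of "real (Suc N)" "real (Suc m)" d] by simp
        then have near: "\<bar>y - x\<bar> < d" if "y \<in> I m j" for y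
          using that U(2) by (auto simp: I_def add_divide_distrib inverse_eq_divide abs_less_iff)
        have "s m j \<le> G x + e / 2"
        proof (rule s_le)
          fix z assume "z \<in> I m j"
          from d(2)[OF near[OF this]] show "G z \<le> G x + e / 2" by linarith
        qed
        then show ?thesis using s_upper[OF U(2)] True e U(1) by simp
      qed
      then show "\<exists>N. \<forall>m\<ge>N. norm (U m x - indicator {0..<1} x * G x) < e" by blast
    qed
  qed (simp add: Uout)
  have meas: "U m \<in> borel_measurable borel" for m unfolding U_def[abs_def] J_def by measurable
  have "(\<lambda>m. LINT x|lborel. U m x) \<longlonglongrightarrow> (LINT x|lborel. indicator {0..<1} x * G x)"
  proof (rule integral_dominated_convergence[where w="\<lambda>x. K * indicator {0..<1} x"])
    show "AE x in lborel. (\<lambda>m. U m x) \<longlonglongrightarrow> indicator {0..<1} x * G x" using cont lim by auto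
    show "AE x in lborel. norm (U m x) \<le> K * indicator {0..<1} x" for m
    proof (rule AE_I2)
      show "norm (U m x) \<le> K * indicator {0..<1} x" for x
        using Uval[of x m] Uout[of x m] s_bd by (cases "x \<in> {0..<1}") auto
    qed
  qed (use G meas in \<open>auto simp: bdd_borel_def\<close>)
  moreover have "(LINT x|lborel. U m x) = (\<Sum>j<Suc m. s m j) / Suc m" for m
  proof -
    have "(LINT x|lborel. U m x) = (\<Sum>j<Suc m. LINT x|lborel. s m j * indicator (J m j) x)"
      unfolding U_def by (rule Bochner_Integration.integral_sum) (simp add: J_def divide_right_mono)
    also have "\<dots> = (\<Sum>j<Suc m. s m j / Suc m)"
      by (rule sum.cong) (auto simp: J_def divide_right_mono diff_divide_distrib[symmetric])
    also have "\<dots> = (\<Sum>j<Suc m. s m j) / Suc m" by (rule sum_divide_distrib[symmetric])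
    finally show ?thesis .
  qed
  ultimately show ?thesis by (simp add: mint_def s_def I_def)
qed

context beta_transformation
begin

lemma countable_T_vimage: "countable S \<Longrightarrow> countable {x. (T ^^ k) x \<in> S}"
proof (induction k arbitrary: S)
  case (Suc k)
  have "{x. T x \<in> S} \<subseteq> (\<lambda>(s, m :: int). (s + m) / \<beta>) ` (S \<times> UNIV)"
  proof
    fix x assume x: "x \<in> {x. T x \<in> S}"
    have "x = (T x + of_int \<lfloor>\<beta> * x\<rfloor>) / \<beta>" using beta_pos by (simp add: beta_map_def frac_def)
    then show "x \<in> (\<lambda>(s, m :: int). (s + m) / \<beta>) ` (S \<times> UNIV)" using x by force
  qed
  then have "countable {x. T x \<in> S}"
    by (rule countable_subset) (use Suc.prems in auto)
  from Suc.IH[OF this] show ?case by simp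
qed simp

lemma isCont_T: "\<beta> * x \<notin> \<int> \<Longrightarrow> isCont T x"
proof -
  assume "\<beta> * x \<notin> \<int>"
  then have "isCont frac (\<beta> * x)" using continuous_frac by blast
  then show ?thesis unfolding beta_map_def[abs_def]
    by (intro isCont_o2[of x "\<lambda>x. \<beta> * x" frac]) auto
qed

lemma isCont_T_pow: "(\<And>i. i < k \<Longrightarrow> \<beta> * (T ^^ i) x \<notin> \<int>) \<Longrightarrow> isCont (T ^^ k) x"
proof (induction k)
  case 0
  then show ?case by (simp add: id_def)
next
  case (Suc k)
  have "isCont (\<lambda>x. T ((T ^^ k) x)) x"
    by (rule isCont_o2[OF Suc.IH isCont_T]) (use Suc.prems in auto)
  then show ?case by (simp add: comp_def)
qed

text \<open>A discontinuity of \<open>T ^^ k\<close> requires that an earlier iterate meets a point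
  of \<open>\<int> / \<beta>\<close>. Preimages of countable sets under \<open>T\<close> are
  countable, since \<open>x\<close> is determined by \<open>T x\<close> and an integer.\<close>

lemma AE_isCont_T_pow: "AE x in lborel. \<forall>k. isCont (T ^^ k) x"
proof -
  have "countable {x. \<beta> * (T ^^ i) x \<in> \<int>}" for i
  proof -
    have "{x. \<beta> * (T ^^ i) x \<in> \<int>} = {x. (T ^^ i) x \<in> (\<lambda>m. m / \<beta>) ` \<int>}"
      using beta_pos by (auto simp: image_iff field_simps)
    moreover have "countable ((\<lambda>m. m / \<beta>) ` (\<int> :: real set))"
      by (intro countable_image) (simp add: Ints_def)
    ultimately show ?thesis using countable_T_vimage by simp
  qed
  then have "countable (\<Union>i. {x. \<beta> * (T ^^ i) x \<in> \<int>})" by (intro countable_UN) auto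
  then have "AE x in lborel. x \<notin> (\<Union>i. {x. \<beta> * (T ^^ i) x \<in> \<int>})"
    by (intro AE_not_in countable_imp_null_set_lborel)
  then show ?thesis by eventually_elim (auto intro: isCont_T_pow)
qed

text \<open>Pyatetskii-Shapiro's criterion: an upper bound for the visiting frequencies of intervals,
  off by a constant factor, already forces genericity.\<close>

lemma beta_normal_of_upper_density:
  assumes Q: "Q \<ge> (1 :: nat)" and C: "C \<ge> 0"
    and upper: "\<And>L u e. L \<ge> (1 :: nat) \<Longrightarrow> e > 0 \<Longrightarrow> \<forall>\<^sub>F N in sequentially.
      real (card {k. k < N \<and> (T ^^ k) y \<in> {u..u + 1 / real (Q * L)}}) \<le> (C / real (Q * L) + e) * real N"
  shows "beta_normal \<beta> y"
  unfolding beta_normal_def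
proof (intro allI impI)
  fix h :: "real \<Rightarrow> real"
  assume h: "continuous_on UNIV h \<and> bounded (range h)"
  then obtain B where B: "\<And>x. \<bar>h x\<bar> \<le> B" unfolding bounded_iff by auto
  have hb: "bdd_borel B h" using h B by (auto simp: bdd_borel_def borel_measurable_continuous_onI)
  have B0: "0 \<le> B" using hb by (rule bdd_borel_nonneg)
  define L where "L = pmean h"
  have int_eq: "integral\<^sup>L (parry_measure \<beta>) h = L"
    unfolding L_def parry_measure_eq by (rule pmeasure_integral[OF hb])
  define Y where "Y k = (T ^^ k) y" for k
  have Y_range: "0 \<le> Y k" "Y k < 1" if "k \<ge> 1" for k
    using that T_range by (cases k; simp add: Y_def)+
  show "(\<lambda>N. (\<Sum>k<N. h ((T ^^ k) y)) / real N) \<longlonglongrightarrow> integral\<^sup>L (parry_measure \<beta>) h"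
    unfolding int_eq
  proof (rule LIMSEQ_I)
    fix e :: real assume e: "e > 0"
    \<comment> \<open>The upper sum will be at most \<open>2 * \<epsilon>\<close>, and
      \<open>C\<close> times it may use up half of \<open>e\<close>.\<close>
    define \<epsilon> where "\<epsilon> = e / (4 * (C + 1))"
    have eps: "\<epsilon> > 0" "C * (2 * \<epsilon>) \<le> e / 2"
    proof -
      show "\<epsilon> > 0" using e C by (simp add: \<epsilon>_def)
      have "C * (2 * \<epsilon>) = (e / 2) * (C / (C + 1))" using C by (simp add: \<epsilon>_def field_simps)
      also have "\<dots> \<le> (e / 2) * 1" using e C by (intro mult_left_mono) auto
      finally show "C * (2 * \<epsilon>) \<le> e / 2" by simp
    qed
    obtain n where n: "n \<ge> 1" and small: "mint (\<lambda>x. \<bar>tsum n h x / real n - L\<bar>) 1 \<le> \<epsilon>"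
      unfolding L_def using mean_ergodic_L1[OF hb eps(1)] by blast
    \<comment> \<open>The deviation of the \<open>n\<close>-step average has small Lebesgue mean.
      Being continuous almost everywhere, it is controlled along the orbit by an upper sum together
      with the assumed visit bounds.\<close>
    define G where "G x = \<bar>tsum n h x / real n - L\<bar>" for x
    define K where "K = B + \<bar>L\<bar>"
    have bG: "bdd_borel K G"
      using bdd_borel_diff_const[OF bdd_average[OF hb, of n], of L] unfolding K_def G_def bdd_borel_def
      by (auto intro!: borel_measurable_abs)
    have K0: "0 \<le> K" using bG by (rule bdd_borel_nonneg)
    have Gle: "G x \<le> K" "0 \<le> G x" for x using bG by (auto simp: bdd_borel_def G_def)
    have cont: "AE x in lborel. isCont G x"
      using AE_isCont_T_pow
    proof eventually_elim
      case (elim x)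
      have "isCont (\<lambda>x. h ((T ^^ k) x)) x" for k
        by (rule isCont_o2[of x "T ^^ k" h]) (use elim h in \<open>auto simp: continuous_on_eq_continuous_at\<close>)
      then have "isCont (\<lambda>x. tsum n h x) x" unfolding tsum_def by (intro continuous_intros)
      then show ?case unfolding G_def[abs_def] using n by (intro continuous_intros) auto
    qed
    define s where "s M j = Sup (G ` {real j / real M..(real j + 1) / real M})" for M j :: nat
    have "(\<lambda>m. (\<Sum>j<Suc m. s (Suc m) j) / Suc m) \<longlonglongrightarrow> mint G 1"
      unfolding s_def by (rule upper_sum_limit[OF bG Gle(2) cont])
    from LIMSEQ_D[OF this eps(1)] obtain m0 where
      m0: "\<And>m. m \<ge> m0 \<Longrightarrow> \<bar>(\<Sum>j<Suc m. s (Suc m) j) / Suc m - mint G 1\<bar> < \<epsilon>" by auto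
    \<comment> \<open>The number of cells is a multiple of \<open>Q\<close>, since
      \<open>upper\<close> speaks of lengths \<open>1 / (Q * L)\<close>.\<close>
    define M where "M = Q * (Suc m0)"
    have M: "M \<ge> 1" "M - 1 \<ge> m0" "Suc (M - 1) = M" using Q unfolding M_def by (cases Q; simp)+
    have sumM: "(\<Sum>j<M. s M j) / M \<le> 2 * \<epsilon>"
      using m0[OF M(2)] small unfolding M(3) G_def[symmetric] by (simp add: abs_less_iff)
    have sK: "0 \<le> s M j" "s M j \<le> K" and sG: "x \<in> {real j / real M..(real j + 1) / real M} \<Longrightarrow> G x \<le> s M j" for j x
    proof -
      let ?I = "{real j / real M..(real j + 1) / real M}"
      have bdd: "bdd_above (G ` ?I)" using Gle by (intro bdd_aboveI[of _ K]) auto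
      show up: "x \<in> ?I \<Longrightarrow> G x \<le> s M j" for x
        unfolding s_def by (rule cSup_upper[OF _ bdd]) auto
      have mem: "real j / real M \<in> ?I" by (simp add: divide_right_mono)
      show "0 \<le> s M j" using up[OF mem] Gle(2) order_trans by blast
      show "s M j \<le> K" unfolding s_def by (rule cSup_least) (use mem Gle in auto)
    qed
    \<comment> \<open>Slack per cell, small enough that all \<open>M\<close> cells together lose at
      most \<open>e / 8\<close>.\<close>
    define \<delta> where "\<delta> = e / (8 * (K + 1) * M)"
    have del: "\<delta> > 0" "M * (K * \<delta>) \<le> e / 8"
    proof -
      show "\<delta> > 0" using e K0 M by (simp add: \<delta>_def)
      have "real M > 0" using M by simp
      then have "M * (K * \<delta>) = (e / 8) * (K / (K + 1))" using K0 by (simp add: \<delta>_def divide_simps)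
      also have "\<dots> \<le> (e / 8) * 1" using e K0 by (intro mult_left_mono) auto
      finally show "M * (K * \<delta>) \<le> e / 8" by simp
    qed
    define cnt where "cnt N j = card {k. k < N \<and> Y k \<in> {real j / real M..(real j + 1) / real M}}" for N j
    have ev: "\<forall>\<^sub>F N in sequentially. \<forall>j\<in>{..<M}. real (cnt N j) \<le> (C / real M + \<delta>) * real N"
    proof (rule eventually_ball_finite, simp, intro ballI)
      fix j
      show "\<forall>\<^sub>F N in sequentially. real (cnt N j) \<le> (C / real M + \<delta>) * real N"
        using upper[of "Suc m0" \<delta> "real j / real M"] del(1)
        unfolding cnt_def Y_def M_def[symmetric] by (simp add: add_divide_distrib)
    qed
    have bound1: "(\<Sum>k<N. G (Y k)) \<le> K + (\<Sum>j<M. s M j * real (cnt N j))" for N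
    proof -
      have "(\<Sum>j<M. s M j * real (cnt N j))
         = (\<Sum>j<M. \<Sum>k<N. if Y k \<in> {real j / real M..(real j + 1) / real M} then s M j else 0)"
      proof (rule sum.cong[OF refl])
        fix j
        have "{k. k < N \<and> Y k \<in> {real j / real M..(real j + 1) / real M}}
          = {..<N} \<inter> {k. Y k \<in> {real j / real M..(real j + 1) / real M}}" by auto
        then show "s M j * real (cnt N j) = (\<Sum>k<N. if Y k \<in> {real j / real M..(real j + 1) / real M} then s M j else 0)"
          unfolding cnt_def by (simp add: sum.If_cases mult.commute)
      qed
      also have "\<dots> = (\<Sum>k<N. \<Sum>j<M. if Y k \<in> {real j / real M..(real j + 1) / real M} then s M j else 0)"
        by (rule sum.swap)
      finally have eq: "(\<Sum>j<M. s M j * real (cnt N j))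
         = (\<Sum>k<N. \<Sum>j<M. if Y k \<in> {real j / real M..(real j + 1) / real M} then s M j else 0)" .
      \<comment> \<open>The index \<open>k = 0\<close> is charged separately with \<open>K\<close>:
        \<open>y\<close> itself need not lie in \<open>[0, 1)\<close>.\<close>
      have "G (Y k) \<le> (\<Sum>j<M. if Y k \<in> {real j / real M..(real j + 1) / real M} then s M j else 0)
           + (if k = 0 then K else 0)" for k
      proof (cases "k = 0")
        case True
        have "0 \<le> (\<Sum>j<M. if Y k \<in> {real j / real M..(real j + 1) / real M} then s M j else 0)"
          using sK by (intro sum_nonneg) auto
        then show ?thesis using True Gle(1)[of "Y k"] by simp
      next
        case False
        define j where "j = nat \<lfloor>real M * Y k\<rfloor>"
        have j: "real j \<le> real M * Y k" "real M * Y k < real j + 1"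
          using Y_range[of k] False unfolding j_def by auto
        have "real M * Y k < real M * 1" using Y_range[of k] False M by (intro mult_strict_left_mono) auto
        then have "j < M" using j by linarith
        moreover have mem: "Y k \<in> {real j / real M..(real j + 1) / real M}" using j M by (auto simp: field_simps)
        ultimately have "s M j \<le> (\<Sum>j<M. if Y k \<in> {real j / real M..(real j + 1) / real M} then s M j else 0)"
          using member_le_sum[of j "{..<M}" "\<lambda>j. if Y k \<in> {real j / real M..(real j + 1) / real M} then s M j else 0"] sK
          by simp
        then show ?thesis using sG[OF mem] False by simp
      qed
      then have "(\<Sum>k<N. G (Y k)) \<le> (\<Sum>k<N. (\<Sum>j<M. if Y k \<in> {real j / real M..(real j + 1) / real M} then s M j else 0)
           + (if k = 0 then K else 0))" by (intro sum_mono)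
      also have "\<dots> \<le> (\<Sum>j<M. s M j * real (cnt N j)) + K"
        unfolding sum.distrib eq using K0 by (cases N) (auto simp: sum.delta)
      finally show ?thesis by simp
    qed
    \<comment> \<open>Replacing \<open>h\<close> by its \<open>n\<close>-step average along the
      orbit costs only boundary terms, since a shift by \<open>i\<close> changes the sum by at most
      \<open>2 * i * B\<close>.\<close>
    have bound2: "\<bar>(\<Sum>k<N. h (Y k)) - real N * L\<bar> \<le> 2 * real n * B + (\<Sum>k<N. G (Y k))" for N
    proof -
      have shift: "\<bar>(\<Sum>k<N. h (Y (k + i))) - (\<Sum>k<N. h (Y k))\<bar> \<le> 2 * real i * B" for i
      proof (induction i)
        case (Suc i)
        have "(\<Sum>k<N. h (Y (k + Suc i))) = (\<Sum>k<N. h (Y (k + i))) + h (Y (N + i)) - h (Y i)"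
          by (induction N) auto
        then show ?case using Suc.IH B[of "Y (N + i)"] B[of "Y i"] by (simp add: algebra_simps abs_le_iff)
      qed simp
      have "(\<Sum>k<N. tsum n h (Y k)) = (\<Sum>i<n. \<Sum>k<N. h (Y (k + i)))"
        unfolding tsum_def Y_def by (subst sum.swap) (simp add: funpow_add add.commute)
      then have "\<bar>(\<Sum>k<N. tsum n h (Y k)) - real n * (\<Sum>k<N. h (Y k))\<bar> = \<bar>\<Sum>i<n. (\<Sum>k<N. h (Y (k + i))) - (\<Sum>k<N. h (Y k))\<bar>"
        by (simp add: sum_subtractf)
      also have "\<dots> \<le> (\<Sum>i<n. 2 * real n * B)"
      proof (rule order_trans[OF sum_abs sum_mono])
        fix i assume "i \<in> {..<n}"
        then have "2 * real i * B \<le> 2 * real n * B" using B0 by (intro mult_right_mono) auto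
        then show "\<bar>(\<Sum>k<N. h (Y (k + i))) - (\<Sum>k<N. h (Y k))\<bar> \<le> 2 * real n * B" using shift[of i] by linarith
      qed
      finally have 1: "\<bar>(\<Sum>k<N. tsum n h (Y k)) - real n * (\<Sum>k<N. h (Y k))\<bar> \<le> real n * (2 * real n * B)" by simp
      have "(\<Sum>k<N. tsum n h (Y k)) - real n * (\<Sum>k<N. h (Y k))
         = real n * ((\<Sum>k<N. tsum n h (Y k) / real n) - (\<Sum>k<N. h (Y k)))"
        using n by (simp add: sum_divide_distrib[symmetric] right_diff_distrib)
      with 1 have "real n * \<bar>(\<Sum>k<N. tsum n h (Y k) / real n) - (\<Sum>k<N. h (Y k))\<bar> \<le> real n * (2 * real n * B)"
        by (simp add: abs_mult)
      then have 2: "\<bar>(\<Sum>k<N. tsum n h (Y k) / real n) - (\<Sum>k<N. h (Y k))\<bar> \<le> 2 * real n * B"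
        using n by simp
      have "\<bar>(\<Sum>k<N. tsum n h (Y k) / real n) - real N * L\<bar> = \<bar>\<Sum>k<N. tsum n h (Y k) / real n - L\<bar>"
        by (simp add: sum_subtractf)
      also have "\<dots> \<le> (\<Sum>k<N. G (Y k))" unfolding G_def by (rule sum_abs)
      finally show ?thesis using 2 by linarith
    qed
    obtain N0 where N0: "\<And>N. N \<ge> N0 \<Longrightarrow> \<forall>j\<in>{..<M}. real (cnt N j) \<le> (C / real M + \<delta>) * real N"
      using ev unfolding eventually_sequentially by blast
    obtain N1 where N1: "real N1 > (2 * real n * B + K) / (e / 8)" using reals_Archimedean2 by blast
    have "norm ((\<Sum>k<N. h ((T ^^ k) y)) / real N - L) < e" if N: "N \<ge> max (max N0 N1) 1" for N
    proof -
      have "(\<Sum>j<M. s M j * real (cnt N j)) \<le> (\<Sum>j<M. s M j * (C / real M * real N) + K * \<delta> * real N)"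
      proof (rule sum_mono)
        fix j assume "j \<in> {..<M}"
        then have "s M j * real (cnt N j) \<le> s M j * ((C / real M + \<delta>) * real N)"
          using N0[of N] N sK by (intro mult_left_mono) auto
        also have "\<dots> = s M j * (C / real M * real N) + s M j * (\<delta> * real N)" by (simp add: algebra_simps)
        also have "s M j * (\<delta> * real N) \<le> K * (\<delta> * real N)" using sK del by (intro mult_right_mono) auto
        finally show "s M j * real (cnt N j) \<le> s M j * (C / real M * real N) + K * \<delta> * real N" by (simp add: mult.assoc)
      qed
      also have "\<dots> = (\<Sum>j<M. s M j) * (C / real M * real N) + real M * (K * \<delta> * real N)"
        unfolding sum.distrib sum_distrib_right by simp
      also have "\<dots> = ((\<Sum>j<M. s M j) / M) * C * real N + M * (K * \<delta>) * real N"
        by (simp add: mult.assoc)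
      also have "\<dots> \<le> (2 * \<epsilon>) * C * real N + (e / 8) * real N"
        using sumM C del(2) by (intro add_mono mult_right_mono) auto
      also have "\<dots> \<le> (e / 2) * real N + (e / 8) * real N"
        using eps(2) by (intro add_mono mult_right_mono) (auto simp: mult.commute)
      finally have 1: "(\<Sum>j<M. s M j * real (cnt N j)) \<le> (5 * e / 8) * real N" by (simp add: algebra_simps)
      have "2 * real n * B + K < real N1 * (e / 8)" using N1 e by (simp add: field_simps)
      also have "\<dots> \<le> real N * (e / 8)" using N e by (intro mult_right_mono) auto
      finally have 2: "2 * real n * B + K < (e / 8) * real N" by (simp add: mult.commute)
      have "\<bar>(\<Sum>k<N. h (Y k)) - real N * L\<bar> < (3 * e / 4) * real N"
        using bound2[of N] bound1[of N] 1 2 by (simp add: algebra_simps)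
      also have "\<dots> \<le> e * real N" using e by (intro mult_right_mono) auto
      finally have "\<bar>(\<Sum>k<N. h (Y k)) - real N * L\<bar> < e * real N" .
      moreover have "(\<Sum>k<N. h (Y k)) / real N - L = ((\<Sum>k<N. h (Y k)) - real N * L) / real N"
        using N by (simp add: field_simps)
      ultimately show ?thesis using N by (simp add: Y_def abs_divide field_simps)
    qed
    then show "\<exists>no. \<forall>N\<ge>no. norm ((\<Sum>k<N. h ((T ^^ k) y)) / real N - L) < e" by blast
  qed
qed

end

section \<open>Pisot numbers\<close>

abbreviation cpoly :: "int poly \<Rightarrow> complex poly" where
  "cpoly \<equiv> map_poly of_int"

lemma coeff_cpoly [simp]: "coeff (cpoly P) i = of_int (coeff P i)"
  by (simp add: coeff_map_poly)

lemma cpoly_add: "cpoly (P + Q) = cpoly P + cpoly Q"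
  by (intro poly_eqI) simp

lemma cpoly_mult: "cpoly (P * Q) = cpoly P * cpoly Q"
  by (intro poly_eqI) (simp add: coeff_mult)

lemma cpoly_smult: "cpoly (smult a P) = smult (of_int a) (cpoly P)"
  by (intro poly_eqI) simp

lemma cpoly_pderiv: "cpoly (pderiv P) = pderiv (cpoly P)"
  by (intro poly_eqI) (simp add: coeff_pderiv)

lemma degree_cpoly [simp]: "degree (cpoly P) = degree P"
  by (rule degree_map_poly) simp

text \<open>Over the integers one has pseudo-division: dividing \<open>q\<close> by a polynomial
  \<open>R\<close> of least degree vanishing at \<open>z\<close> gives
  \<open>smult a q = R * Q\<close>. As \<open>q\<close> is prime in the factorial ring of integer
  polynomials, it divides \<open>R\<close> or \<open>Q\<close>.\<close>

lemma irreducible_minimal_degree: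
  fixes q P :: "int poly"
  assumes q: "irreducible q" and qz: "poly (cpoly q) z = 0"
    and P: "P \<noteq> 0" "poly (cpoly P) z = 0"
  shows "degree q \<le> degree P"
proof -
  define S where "S = {P. P \<noteq> 0 \<and> poly (cpoly P) z = 0}"
  obtain R where R: "R \<in> S" and min: "\<And>P. P \<in> S \<Longrightarrow> degree R \<le> degree P"
    using P ex_has_least_nat[of "\<lambda>P. P \<in> S" P degree] by (auto simp: S_def)
  have R0: "R \<noteq> 0" "poly (cpoly R) z = 0" using R by (auto simp: S_def)
  obtain a Q where a: "a \<noteq> 0" and eq: "smult a q = R * Q + pseudo_mod q R"
    using pseudo_mod(1)[OF R0(1)] by blast
  have "poly (cpoly (smult a q)) z = 0" using qz by (simp add: cpoly_smult)
  then have "poly (cpoly (pseudo_mod q R)) z = 0"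
    unfolding eq using R0 by (simp add: cpoly_add cpoly_mult)
  then have "pseudo_mod q R = 0"
    using pseudo_mod(2)[OF R0(1), of q] min[of "pseudo_mod q R"]
    unfolding S_def mem_Collect_eq by linarith
  then have eq': "smult a q = R * Q" using eq by simp
  have "prime_elem q" using q by (rule irreducible_imp_prime_elem)
  moreover have "q dvd R * Q" unfolding eq'[symmetric] by (rule dvd_smult) simp
  ultimately consider "q dvd R" | "q dvd Q" using prime_elem_dvd_multD by blast
  then have "degree q \<le> degree R"
  proof cases
    case 1
    then show ?thesis using R0(1) by (rule dvd_imp_degree_le)
  next
    \<comment> \<open>Cancelling \<open>q\<close> exhibits a nonzero constant as a multiple of
      \<open>R\<close>, so \<open>R\<close> would be a nonzero constant with a root.\<close>
    case 2
    then obtain Q' where Q': "Q = q * Q'" by (elim dvdE)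
    have q0: "q \<noteq> 0" using q by auto
    have "q * [:a:] = q * (R * Q')" using eq' Q' by (simp add: mult_ac)
    then have RQ: "[:a:] = R * Q'" using q0 mult_cancel_left by blast
    then have "Q' \<noteq> 0" using a by auto
    then have "degree R = 0" using RQ R0 degree_mult_eq[of R Q'] degree_pCons_0[of a] by simp
    then obtain c where "R = [:c:]" by (elim degree_eq_zeroE)
    then show ?thesis using R0 by (simp add: map_poly_pCons)
  qed
  also have "\<dots> \<le> degree P" using min P by (simp add: S_def)
  finally show ?thesis .
qed

section \<open>Power sums of the roots of a monic irreducible polynomial\<close>

locale monic_irreducible =
  fixes q :: "int poly"
  assumes monic: "lead_coeff q = 1" and irr: "irreducible q" and deg: "degree q \<ge> 1"
begin

definition "roots = {z. poly (cpoly q) z = 0}"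

lemma q_nonzero: "cpoly q \<noteq> 0"
  using deg degree_cpoly[of q] by (metis degree_0 not_one_le_zero)

lemma finite_roots: "finite roots"
  unfolding roots_def using q_nonzero by (rule poly_roots_finite)

text \<open>A multiple root would be a root of the derivative, whose smaller degree contradicts
  minimality.\<close>

lemma rsquarefree_q: "rsquarefree (cpoly q)"
  unfolding rsquarefree_roots
proof (intro allI notI)
  fix z assume z: "poly (cpoly q) z = 0 \<and> poly (pderiv (cpoly q)) z = 0"
  have "pderiv q \<noteq> 0" using deg by (simp add: pderiv_eq_0_iff)
  then have "degree q \<le> degree (pderiv q)"
    using irreducible_minimal_degree[OF irr, of z "pderiv q"] z by (simp add: cpoly_pderiv)
  then show False using deg by (simp add: degree_pderiv)
qed

lemma q_factor: "cpoly q = (\<Prod>z\<in>roots. [:-z, 1:])"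
  using complex_poly_decompose_rsquarefree[OF rsquarefree_q] monic by (simp add: roots_def)

definition "cofactor z = (\<Prod>w\<in>roots - {z}. [:-w, 1:])"

lemma q_cofactor: "z \<in> roots \<Longrightarrow> cpoly q = [:-z, 1:] * cofactor z"
  unfolding q_factor cofactor_def by (rule prod.remove[OF finite_roots])

lemma degree_cofactor: "z \<in> roots \<Longrightarrow> Suc (degree (cofactor z)) = degree q"
proof -
  assume z: "z \<in> roots"
  have "cofactor z \<noteq> 0" using q_cofactor[OF z] q_nonzero by auto
  then have "degree (cpoly q) = 1 + degree (cofactor z)"
    unfolding q_cofactor[OF z] by (subst degree_mult_eq) auto
  then show ?thesis by simp
qed

text \<open>Synthetic division by \<open>X - z\<close>: comparing coefficients gives a downward
  recursion that starts with 0 above the degree.\<close>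

lemma coeff_cofactor:
  assumes z: "z \<in> roots"
  shows "coeff (cofactor z) i = (\<Sum>k<degree q - i. of_int (coeff q (i + 1 + k)) * z ^ k)"
proof (induction "degree q - i" arbitrary: i)
  case 0
  then have "degree (cofactor z) < i" using degree_cofactor[OF z] by simp
  then show ?case using 0 by (simp add: coeff_eq_0)
next
  case (Suc n)
  have "coeff (cpoly q) (Suc i) = coeff (cofactor z) i - z * coeff (cofactor z) (Suc i)"
    unfolding q_cofactor[OF z] by simp
  then have "coeff (cofactor z) i = of_int (coeff q (Suc i)) + z * coeff (cofactor z) (Suc i)"
    by simp
  also have "coeff (cofactor z) (Suc i) = (\<Sum>k<n. of_int (coeff q (Suc i + 1 + k)) * z ^ k)"
  proof -
    have n: "n = degree q - Suc i" using Suc.hyps(2) by simp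
    show ?thesis using Suc.hyps(1)[OF n] unfolding n .
  qed
  finally show ?case unfolding Suc.hyps(2)[symmetric] sum.lessThan_Suc_shift
    by (simp add: sum_distrib_left mult_ac)
qed

definition "power_sum m = (\<Sum>z\<in>roots. z ^ m)"

text \<open>Newton's identities, by comparing coefficients in the product rule, which presents the
  derivative of \<open>q\<close> as the sum of \<open>q / (X - z)\<close> over the roots.\<close>

lemma newton:
  assumes "i < degree q"
  shows "(\<Sum>k<degree q - i. of_int (coeff q (i + 1 + k)) * power_sum k) = of_nat (Suc i) * of_int (coeff q (Suc i))"
proof -
  have "pderiv (cpoly q) = (\<Sum>z\<in>roots. cofactor z)"
    unfolding q_factor pderiv_prod cofactor_def by (simp add: pderiv_pCons)
  then have "coeff (pderiv (cpoly q)) i = (\<Sum>z\<in>roots. coeff (cofactor z) i)"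
    by (simp add: coeff_sum)
  also have "\<dots> = (\<Sum>k<degree q - i. of_int (coeff q (i + 1 + k)) * power_sum k)"
    unfolding power_sum_def sum_distrib_left by (subst sum.swap) (simp add: coeff_cofactor)
  finally show ?thesis by (simp add: coeff_pderiv)
qed

lemma power_sum_recurrence:
  assumes "degree q \<le> m"
  shows "power_sum m = - (\<Sum>j<degree q. of_int (coeff q j) * power_sum (m - degree q + j))"
proof -
  have "(\<Sum>j\<le>degree q. of_int (coeff q j) * power_sum (m - degree q + j))
      = (\<Sum>z\<in>roots. z ^ (m - degree q) * poly (cpoly q) z)"
    unfolding power_sum_def sum_distrib_left poly_altdef degree_cpoly coeff_cpoly
    by (subst sum.swap) (intro sum.cong refl, simp add: power_add)
  also have "\<dots> = 0" by (simp add: roots_def)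
  finally have "(\<Sum>j<degree q. of_int (coeff q j) * power_sum (m - degree q + j)) + power_sum m = 0"
    using assms monic unfolding lessThan_Suc_atMost[symmetric] sum.lessThan_Suc by simp
  then show ?thesis by (simp only: add_eq_0_iff)
qed

text \<open>Below the degree, Newton's identity with \<open>i = degree q - 1 - m\<close> contains
  \<open>power_sum m\<close> with coefficient 1 because \<open>q\<close> is monic; from the degree
  on, the linear recurrence applies. Both express it through earlier power sums with integer
  coefficients.\<close>

lemma power_sum_Ints: "power_sum m \<in> \<int>"
proof (induction m rule: less_induct)
  case (less m)
  show ?case
  proof (cases "m < degree q")
    case True
    define i where "i = degree q - 1 - m"
    have i: "i < degree q" "degree q - i = Suc m" "i + 1 + m = degree q" using True by (auto simp: i_def)
    from newton[OF i(1)] have "power_sum m = of_nat (Suc i) * of_int (coeff q (Suc i))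
        - (\<Sum>k<m. of_int (coeff q (i + 1 + k)) * power_sum k)"
      using monic unfolding i(2) sum.lessThan_Suc i(3) by (simp add: algebra_simps)
    also have "\<dots> \<in> \<int>" by (intro Ints_diff Ints_mult Ints_sum) (use less in auto)
    finally show ?thesis .
  next
    case False
    then have "power_sum m = - (\<Sum>j<degree q. of_int (coeff q j) * power_sum (m - degree q + j))"
      by (intro power_sum_recurrence) simp
    also have "\<dots> \<in> \<int>"
    proof (intro Ints_minus Ints_sum Ints_mult)
      fix j assume "j \<in> {..<degree q}"
      then show "power_sum (m - degree q + j) \<in> \<int>" using False by (intro less.IH) auto
    qed auto
    finally show ?thesis .
  qed
qed

end

text \<open>The traces of the powers of a Pisot number are integers close to these powers; the vector of
  errors lies in the hyperplane with normal \<open>\<kappa>\<close>, the coefficients of \<open>q / (X - \<beta>)\<close>.\<close>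

lemma pisot_traces:
  assumes "pisot \<beta>"
  obtains s :: nat and p :: "nat \<Rightarrow> int" and \<kappa> :: "nat \<Rightarrow> real" where
    "s \<ge> 1"
    "\<And>c :: nat \<Rightarrow> int. (\<Sum>i<s. of_int (c i) * \<beta> ^ i) = 0 \<Longrightarrow> \<forall>i<s. c i = 0"
    "summable (\<lambda>m. \<bar>of_int (p m) - \<beta> ^ m\<bar>)"
    "\<kappa> (s - 1) = 1"
    "\<And>m. (\<Sum>i<s. \<kappa> i * (of_int (p (m + i)) - \<beta> ^ (m + i))) = 0"
proof -
  let ?b = "complex_of_real \<beta>"
  from assms obtain q where b1: "1 < \<beta>" and q: "lead_coeff q = 1" "irreducible q" "poly (cpoly q) ?b = 0"
    and small: "\<And>z. poly (cpoly q) z = 0 \<Longrightarrow> z \<noteq> ?b \<Longrightarrow> cmod z < 1"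
    unfolding pisot_def by blast
  have "degree q \<ge> 1"
  proof (rule ccontr)
    assume "\<not> degree q \<ge> 1"
    then obtain c where "q = [:c:]" by (metis degree_eq_zeroE less_one not_less)
    then show False using q by (simp add: map_poly_pCons)
  qed
  with q interpret monic_irreducible q by unfold_locales auto
  define s where "s = degree q"
  have bR: "?b \<in> roots" using q by (simp add: roots_def)
  \<comment> \<open>The trace of \<open>\<beta> ^ m\<close>; its distance from
    \<open>\<beta> ^ m\<close> is the power sum of the other conjugates, all of modulus less than
    1.\<close>
  define p where "p m = (THE k :: int. of_int k = power_sum m)" for m
  have p: "of_int (p m) = power_sum m" for m
  proof -
    obtain k :: int where "power_sum m = of_int k" using power_sum_Ints[of m] by (elim Ints_cases)
    then show ?thesis by (simp add: p_def)
  qed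
  have err: "complex_of_real (of_int (p m) - \<beta> ^ m) = (\<Sum>z\<in>roots - {?b}. z ^ m)" for m
    using sum.remove[OF finite_roots bR, of "\<lambda>z. z ^ m"] p[of m] unfolding power_sum_def by simp
  define \<kappa> where "\<kappa> i = Re (coeff (cofactor ?b) i)" for i
  have kap: "complex_of_real (\<kappa> i) = coeff (cofactor ?b) i" for i
  proof -
    have "coeff (cofactor ?b) i = complex_of_real (\<Sum>k<degree q - i. of_int (coeff q (i + 1 + k)) * \<beta> ^ k)"
      unfolding coeff_cofactor[OF bR] by simp
    then show ?thesis unfolding \<kappa>_def by (metis Re_complex_of_real)
  qed
  show thesis
  proof (rule that[of s p \<kappa>])
    show "s \<ge> 1" using deg by (simp add: s_def)
    show "\<forall>i<s. c i = 0" if c: "(\<Sum>i<s. of_int (c i) * \<beta> ^ i) = 0" for c :: "nat \<Rightarrow> int"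
    proof (rule ccontr)
      assume "\<not> (\<forall>i<s. c i = 0)"
      then obtain i0 where i0: "i0 < s" "c i0 \<noteq> 0" by blast
      define P where "P = (\<Sum>i<s. monom (c i) i)"
      have co: "coeff P i = (if i < s then c i else 0)" for i
        unfolding P_def by (simp add: coeff_sum if_distrib cong: if_cong)
      have "P \<noteq> 0" using i0 co[of i0] by auto
      have "degree P < s"
        using \<open>s \<ge> 1\<close> by (intro degree_lessI) (auto simp: co)
      have "poly (cpoly P) ?b = (\<Sum>i<s. of_int (c i) * ?b ^ i)"
      proof -
        have "poly (cpoly P) ?b = (\<Sum>i\<le>degree P. of_int (coeff P i) * ?b ^ i)"
          by (simp add: poly_altdef)
        also have "\<dots> = (\<Sum>i<s. of_int (coeff P i) * ?b ^ i)"
          by (rule sum.mono_neutral_left) (use \<open>degree P < s\<close> in \<open>auto simp: coeff_eq_0\<close>)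
        finally show ?thesis by (simp add: co)
      qed
      also have "\<dots> = complex_of_real (\<Sum>i<s. of_int (c i) * \<beta> ^ i)" by simp
      also have "\<dots> = 0" using c by simp
      finally show False
        using irreducible_minimal_degree[OF irr q(3) \<open>P \<noteq> 0\<close>] \<open>degree P < s\<close> by (simp add: s_def)
    qed
    show "summable (\<lambda>m. \<bar>of_int (p m) - \<beta> ^ m\<bar>)"
    proof (rule summable_comparison_test'[where N=0])
      show "summable (\<lambda>m. \<Sum>z\<in>roots - {?b}. cmod z ^ m)"
        by (intro summable_sum summable_geometric) (use small in \<open>auto simp: roots_def\<close>)
      fix m
      have "\<bar>of_int (p m) - \<beta> ^ m\<bar> = cmod (\<Sum>z\<in>roots - {?b}. z ^ m)"
        unfolding err[symmetric] by (simp only: norm_of_real)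
      also have "\<dots> \<le> (\<Sum>z\<in>roots - {?b}. cmod z ^ m)"
        by (rule order_trans[OF norm_sum]) (simp add: norm_power)
      finally show "norm \<bar>of_int (p m) - \<beta> ^ m\<bar> \<le> (\<Sum>z\<in>roots - {?b}. cmod z ^ m)" by simp
    qed
    have dc: "degree (cofactor ?b) = s - 1" using degree_cofactor[OF bR] by (simp add: s_def)
    have "lead_coeff (cofactor ?b) = 1" unfolding cofactor_def by (simp add: lead_coeff_prod)
    then show "\<kappa> (s - 1) = 1" unfolding dc \<kappa>_def by simp
    fix m
    have "complex_of_real (\<Sum>i<s. \<kappa> i * (of_int (p (m + i)) - \<beta> ^ (m + i)))
        = (\<Sum>i<s. coeff (cofactor ?b) i * (\<Sum>z\<in>roots - {?b}. z ^ (m + i)))"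
      unfolding of_real_sum of_real_mult kap err ..
    also have "\<dots> = (\<Sum>z\<in>roots - {?b}. z ^ m * (\<Sum>i<s. coeff (cofactor ?b) i * z ^ i))"
      unfolding sum_distrib_left by (subst sum.swap) (simp add: power_add mult_ac)
    also have "\<dots> = (\<Sum>z\<in>roots - {?b}. z ^ m * poly (cofactor ?b) z)"
    proof -
      have "{..<s} = {..degree (cofactor ?b)}" using dc \<open>s \<ge> 1\<close> by auto
      then show ?thesis by (simp add: poly_altdef)
    qed
    also have "\<dots> = 0"
    proof (rule sum.neutral, rule ballI)
      \<comment> \<open>Every conjugate other than \<open>\<beta>\<close> is a root of
        \<open>q / (X - \<beta>)\<close>; this is why its coefficients annihilate the
        errors.\<close>
      fix z assume z: "z \<in> roots - {?b}"
      then have "poly (cofactor ?b) z = 0"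
        unfolding cofactor_def poly_prod using finite_roots by (intro prod_zero) auto
      then show "z ^ m * poly (cofactor ?b) z = 0" by simp
    qed
    finally show "(\<Sum>i<s. \<kappa> i * (of_int (p (m + i)) - \<beta> ^ (m + i))) = 0"
      using of_real_eq_0_iff by blast
  qed
qed

section \<open>From exponential sums to \<open>\<beta>\<close>-normality\<close>

text \<open>Expanding the square leaves the diagonal, where each term is 1; the averages off the
  diagonal vanish in the limit by assumption.\<close>

lemma trig_sum_square_average:
  fixes \<omega> :: "'a \<Rightarrow> real" and u :: "'a \<Rightarrow> complex" and x :: "nat \<Rightarrow> real"
  assumes fin: "finite X" and u: "\<And>J. J \<in> X \<Longrightarrow> cmod (u J) = 1"
    and null: "\<And>J J'. J \<in> X \<Longrightarrow> J' \<in> X \<Longrightarrow> J \<noteq> J' \<Longrightarrow>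
      (\<lambda>N. (\<Sum>k<N. cis ((\<omega> J - \<omega> J') * x k)) / of_nat N) \<longlonglongrightarrow> 0"
  shows "(\<lambda>N. (\<Sum>k<N. (cmod (\<Sum>J\<in>X. u J * cis (\<omega> J * x k)))\<^sup>2) / real N) \<longlonglongrightarrow> real (card X)"
proof -
  have sq: "complex_of_real ((cmod (\<Sum>J\<in>X. u J * cis (\<omega> J * x k)))\<^sup>2)
     = (\<Sum>J\<in>X. \<Sum>J'\<in>X. u J * cnj (u J') * cis ((\<omega> J - \<omega> J') * x k))" for k
  proof -
    have c: "cis (\<omega> J * x k) * cnj (cis (\<omega> J' * x k)) = cis ((\<omega> J - \<omega> J') * x k)" for J J'
      by (simp add: cis_cnj cis_mult left_diff_distrib)
    have "u J * cis (\<omega> J * x k) * (cnj (u J') * cnj (cis (\<omega> J' * x k)))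
        = u J * cnj (u J') * cis ((\<omega> J - \<omega> J') * x k)" for J J'
      unfolding c[symmetric] by (simp only: mult_ac)
    then show ?thesis
      unfolding complex_norm_square cnj_sum complex_cnj_mult sum_product by (simp only:)
  qed
  have avg: "complex_of_real ((\<Sum>k<N. (cmod (\<Sum>J\<in>X. u J * cis (\<omega> J * x k)))\<^sup>2) / real N)
     = (\<Sum>J\<in>X. \<Sum>J'\<in>X. u J * cnj (u J') * ((\<Sum>k<N. cis ((\<omega> J - \<omega> J') * x k)) / of_nat N))" for N
  proof -
    have "complex_of_real (\<Sum>k<N. (cmod (\<Sum>J\<in>X. u J * cis (\<omega> J * x k)))\<^sup>2)
       = (\<Sum>k<N. \<Sum>J\<in>X. \<Sum>J'\<in>X. u J * cnj (u J') * cis ((\<omega> J - \<omega> J') * x k))"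
      unfolding of_real_sum sq ..
    also have "\<dots> = (\<Sum>J\<in>X. \<Sum>k<N. \<Sum>J'\<in>X. u J * cnj (u J') * cis ((\<omega> J - \<omega> J') * x k))"
      by (rule sum.swap)
    also have "\<dots> = (\<Sum>J\<in>X. \<Sum>J'\<in>X. \<Sum>k<N. u J * cnj (u J') * cis ((\<omega> J - \<omega> J') * x k))"
      by (intro sum.cong refl) (rule sum.swap)
    finally show ?thesis
      unfolding of_real_divide of_real_of_nat_eq
      by (simp only: sum_divide_distrib[symmetric] sum_distrib_left[symmetric] times_divide_eq_right)
  qed
  have "(\<lambda>N. \<Sum>J\<in>X. \<Sum>J'\<in>X. u J * cnj (u J') * ((\<Sum>k<N. cis ((\<omega> J - \<omega> J') * x k)) / of_nat N))
     \<longlonglongrightarrow> (\<Sum>J\<in>X. \<Sum>J'\<in>X. u J * cnj (u J') * (if J = J' then 1 else 0))"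
  proof (intro tendsto_sum tendsto_mult tendsto_const)
    fix J J' assume J: "J \<in> X" "J' \<in> X"
    show "(\<lambda>N. (\<Sum>k<N. cis ((\<omega> J - \<omega> J') * x k)) / of_nat N) \<longlonglongrightarrow> (if J = J' then 1 else 0)"
    proof (cases "J = J'")
      case True
      have "\<forall>\<^sub>F N in sequentially. (\<Sum>k<N. cis ((\<omega> J - \<omega> J') * x k)) / of_nat N = 1"
        by (rule eventually_sequentiallyI[of 1]) (simp add: True)
      then show ?thesis using True by (simp add: tendsto_eventually)
    qed (use null[OF J] in simp)
  qed
  moreover have "(\<Sum>J\<in>X. \<Sum>J'\<in>X. u J * cnj (u J') * (if J = J' then 1 else 0)) = complex_of_real (real (card X))"
  proof -
    have "(\<Sum>J'\<in>X. u J * cnj (u J') * (if J = J' then 1 else 0)) = 1" if "J \<in> X" for J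
    proof -
      have "(\<Sum>J'\<in>X. u J * cnj (u J') * (if J = J' then 1 else 0)) = (\<Sum>J'\<in>X. if J = J' then u J * cnj (u J') else 0)"
        by (intro sum.cong) auto
      also have "\<dots> = u J * cnj (u J)" using that fin by simp
      also have "\<dots> = 1" using u[OF that] by (simp add: complex_norm_square[symmetric])
      finally show ?thesis .
    qed
    then show ?thesis by simp
  qed
  ultimately have "(\<lambda>N. complex_of_real ((\<Sum>k<N. (cmod (\<Sum>J\<in>X. u J * cis (\<omega> J * x k)))\<^sup>2) / real N))
     \<longlonglongrightarrow> complex_of_real (real (card X))"
    unfolding avg by simp
  then show ?thesis by (simp only: tendsto_of_real_iff)
qed

lemma cis_2pi_int_add: "cis (2 * pi * (of_int m + t)) = cis (2 * pi * t)"
proof -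
  have "cis (2 * pi * of_int m) = 1" by (rule cis_multiple_2pi) simp
  then show ?thesis by (simp only: distrib_left cis_mult[symmetric] mult_1)
qed

text \<open>The points \<open>\<beta> ^ k * y\<close> are not reduced modulo 1, because reduction
  does not commute with multiplication by a non-integral \<open>\<beta>\<close>. The frequencies
  \<open>t\<close> to be inserted are \<open>2 * pi\<close> times integer polynomials in
  \<open>\<beta>\<close>.\<close>

definition weyl_null :: "real \<Rightarrow> real \<Rightarrow> real \<Rightarrow> bool" where
  "weyl_null \<beta> t y \<longleftrightarrow> (\<lambda>N. (\<Sum>k<N. cis (t * \<beta> ^ k * y)) / of_nat N) \<longlonglongrightarrow> 0"

context beta_transformation
begin

lemma T_pow_expansion:
  "(T ^^ k) y = \<beta> ^ k * y - (\<Sum>j<k. of_int \<lfloor>\<beta> * (T ^^ j) y\<rfloor> * \<beta> ^ (k - 1 - j))"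
proof (induction k)
  case (Suc k)
  have "(\<Sum>j<k. of_int \<lfloor>\<beta> * (T ^^ j) y\<rfloor> * \<beta> ^ (k - j)) = \<beta> * (\<Sum>j<k. of_int \<lfloor>\<beta> * (T ^^ j) y\<rfloor> * \<beta> ^ (k - 1 - j))"
    unfolding sum_distrib_left
  proof (rule sum.cong[OF refl])
    fix j assume "j \<in> {..<k}"
    then have "k - j = Suc (k - 1 - j)" by auto
    then show "of_int \<lfloor>\<beta> * (T ^^ j) y\<rfloor> * \<beta> ^ (k - j) = \<beta> * (of_int \<lfloor>\<beta> * (T ^^ j) y\<rfloor> * \<beta> ^ (k - 1 - j))" by simp
  qed
  moreover have "(T ^^ Suc k) y = \<beta> * (T ^^ k) y - of_int \<lfloor>\<beta> * (T ^^ k) y\<rfloor>"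
    by (simp add: beta_map_def frac_def)
  moreover have "\<beta> * (T ^^ k) y = \<beta> * (\<beta> ^ k * y) - \<beta> * (\<Sum>j<k. of_int \<lfloor>\<beta> * (T ^^ j) y\<rfloor> * \<beta> ^ (k - 1 - j))"
    using arg_cong[OF Suc.IH, of "\<lambda>z. \<beta> * z"] by (simp only: right_diff_distrib)
  ultimately show ?case
    unfolding sum.lessThan_Suc diff_Suc_1 power_Suc mult.assoc by (simp del: funpow.simps)
qed simp

lemma digit_bound: "\<bar>of_int \<lfloor>\<beta> * (T ^^ j) y\<rfloor> :: real\<bar> \<le> \<beta> * (\<bar>y\<bar> + 1) + 1"
proof -
  have "\<bar>(T ^^ j) y\<bar> \<le> \<bar>y\<bar> + 1"
    using T_range[of "(T ^^ (j - 1)) y"] by (cases j) auto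
  then have "\<beta> * \<bar>(T ^^ j) y\<bar> \<le> \<beta> * (\<bar>y\<bar> + 1)" using beta_pos by (intro mult_left_mono) auto
  then have "\<bar>\<beta> * (T ^^ j) y\<bar> \<le> \<beta> * (\<bar>y\<bar> + 1)" using beta_pos by (simp add: abs_mult)
  then show ?thesis by linarith
qed

text \<open>In the digit expansion of \<open>(T ^^ k) y\<close> every power of
  \<open>\<beta>\<close> is replaced by its integer trace. The error \<open>w\<close> is a sum of
  bounded digits times summable trace errors, hence bounded uniformly in \<open>k\<close>, and it
  inherits the hyperplane relation term by term.\<close>

lemma lattice_approximation:
  fixes p :: "nat \<Rightarrow> int" and \<kappa> :: "nat \<Rightarrow> real"
  assumes sm: "summable (\<lambda>m. \<bar>of_int (p m) - \<beta> ^ m\<bar>)"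
    and hyper: "\<And>m. (\<Sum>i<s. \<kappa> i * (of_int (p (m + i)) - \<beta> ^ (m + i))) = 0"
  obtains R where "R \<ge> 0"
    "\<And>k. \<exists>w. (\<forall>i. \<bar>w i\<bar> \<le> R \<and> (\<exists>c :: int. \<beta> ^ i * (\<beta> ^ k * y) = \<beta> ^ i * (T ^^ k) y + of_int c - w i))
        \<and> (\<Sum>i<s. \<kappa> i * w i) = 0"
proof -
  define \<epsilon> where "\<epsilon> m = of_int (p m) - \<beta> ^ m" for m
  define D where "D = \<beta> * (\<bar>y\<bar> + 1) + 1"
  define R where "R = D * (\<Sum>m. \<bar>\<epsilon> m\<bar>)"
  define d where "d j = \<lfloor>\<beta> * (T ^^ j) y\<rfloor>" for j
  have D0: "0 \<le> D" using beta_pos by (simp add: D_def)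
  have sm': "summable (\<lambda>m. \<bar>\<epsilon> m\<bar>)" using sm by (simp add: \<epsilon>_def)
  have R0: "R \<ge> 0" unfolding R_def using D0 suminf_nonneg[OF sm'] by simp
  show thesis
  proof (rule that[OF R0])
    fix k
    define w where "w i = (\<Sum>j<k. of_int (d j) * \<epsilon> (k - 1 - j + i))" for i
    have 1: "\<bar>w i\<bar> \<le> R" for i
    proof -
      have "\<bar>w i\<bar> \<le> (\<Sum>j<k. D * \<bar>\<epsilon> (k - 1 - j + i)\<bar>)"
        unfolding w_def
        by (rule order_trans[OF sum_abs sum_mono])
           (use digit_bound[of _ y] in \<open>auto simp: abs_mult d_def D_def intro!: mult_right_mono\<close>)
      also have "\<dots> = D * (\<Sum>j<k. \<bar>\<epsilon> (j + i)\<bar>)"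
        unfolding sum_distrib_left[symmetric]
        by (subst sum.nat_diff_reindex[symmetric]) simp
      also have "(\<Sum>j<k. \<bar>\<epsilon> (j + i)\<bar>) \<le> (\<Sum>m. \<bar>\<epsilon> m\<bar>)"
      proof -
        have "(\<Sum>j<k. \<bar>\<epsilon> (j + i)\<bar>) = (\<Sum>m\<in>{i..<k + i}. \<bar>\<epsilon> m\<bar>)"
          using sum.shift_bounds_nat_ivl[of "\<lambda>m. \<bar>\<epsilon> m\<bar>" 0 i k] by (simp add: atLeast0LessThan)
        also have "\<dots> \<le> (\<Sum>m. \<bar>\<epsilon> m\<bar>)" by (rule sum_le_suminf[OF sm']) auto
        finally show ?thesis .
      qed
      finally show ?thesis using D0 by (simp add: R_def mult_left_mono)
    qed
    have 2: "\<exists>c :: int. \<beta> ^ i * (\<beta> ^ k * y) = \<beta> ^ i * (T ^^ k) y + of_int c - w i" for i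
    proof
      have "of_int (\<Sum>j<k. d j * p (k - 1 - j + i)) - w i = (\<Sum>j<k. of_int (d j) * (\<beta> ^ i * \<beta> ^ (k - 1 - j)))"
      proof -
        have "a * b - a * (b - c * c') = a * (c' * c)" for a b c c' :: real by (simp add: algebra_simps)
        then show ?thesis
          unfolding w_def \<epsilon>_def of_int_sum of_int_mult sum_subtractf[symmetric] power_add by simp
      qed
      also have "\<dots> = \<beta> ^ i * (\<Sum>j<k. of_int (d j) * \<beta> ^ (k - 1 - j))"
        by (simp add: sum_distrib_left mult_ac)
      also have "\<dots> = \<beta> ^ i * (\<beta> ^ k * y) - \<beta> ^ i * (T ^^ k) y"
        unfolding T_pow_expansion[of k y] d_def by (simp add: right_diff_distrib)
      finally show "\<beta> ^ i * (\<beta> ^ k * y) = \<beta> ^ i * (T ^^ k) y + of_int (\<Sum>j<k. d j * p (k - 1 - j + i)) - w i" by simp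
    qed
    have 3: "(\<Sum>i<s. \<kappa> i * w i) = 0"
    proof -
      have "(\<Sum>i<s. \<kappa> i * w i) = (\<Sum>j<k. of_int (d j) * (\<Sum>i<s. \<kappa> i * \<epsilon> (k - 1 - j + i)))"
        unfolding w_def sum_distrib_left by (subst sum.swap) (simp only: mult_ac)
      moreover have "(\<Sum>i<s. \<kappa> i * \<epsilon> (k - 1 - j + i)) = 0" for j
        using hyper[of "k - 1 - j"] unfolding \<epsilon>_def .
      ultimately show ?thesis by (simp only: mult_zero_right sum.neutral_const)
    qed
    show "\<exists>w. (\<forall>i. \<bar>w i\<bar> \<le> R \<and> (\<exists>c :: int. \<beta> ^ i * (\<beta> ^ k * y) = \<beta> ^ i * (T ^^ k) y + of_int c - w i))
        \<and> (\<Sum>i<s. \<kappa> i * w i) = 0"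
      using 1 2 3 by blast
  qed
qed

text \<open>If \<open>T\<^sup>k y\<close> lies in an interval of length \<open>\<epsilon>\<close>, then the vector \<open>(\<beta>\<^sup>i \<beta>\<^sup>k y)\<close> lies modulo
  integers in one of \<open>O(\<epsilon>\<^sup>1\<^sup>-\<^sup>s)\<close> cubes of side \<open>O(\<epsilon>)\<close>, because the error vectors are bounded
  and confined to a hyperplane.  Each cube is visited with frequency \<open>O(\<epsilon>\<^sup>s)\<close>.\<close>

lemma weyl_imp_beta_normal:
  assumes pisot: "pisot \<beta>"
    and weyl: "\<And>c n. (\<Sum>i<n. of_int (c i) * \<beta> ^ i) \<noteq> 0 \<Longrightarrow> weyl_null \<beta> (2 * pi * (\<Sum>i<n. of_int (c i) * \<beta> ^ i)) y"
  shows "beta_normal \<beta> y"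
proof -
  obtain s :: nat and p :: "nat \<Rightarrow> int" and \<kappa> :: "nat \<Rightarrow> real" where
    s1: "s \<ge> 1"
    and indep: "\<And>c :: nat \<Rightarrow> int. (\<Sum>i<s. of_int (c i) * \<beta> ^ i) = 0 \<Longrightarrow> \<forall>i<s. c i = 0"
    and sm: "summable (\<lambda>m. \<bar>of_int (p m) - \<beta> ^ m\<bar>)"
    and k1: "\<kappa> (s - 1) = 1"
    and hyper: "\<And>m. (\<Sum>i<s. \<kappa> i * (of_int (p (m + i)) - \<beta> ^ (m + i))) = 0"
    by (rule pisot_traces[OF pisot], rule that)
  obtain R where R0: "R \<ge> 0" and approx:
    "\<And>k. \<exists>w. (\<forall>i. \<bar>w i\<bar> \<le> R \<and> (\<exists>c :: int. \<beta> ^ i * (\<beta> ^ k * y) = \<beta> ^ i * (T ^^ k) y + of_int c - w i))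
        \<and> (\<Sum>i<s. \<kappa> i * w i) = 0"
    by (rule lattice_approximation[OF sm hyper, of y], rule that)
  \<comment> \<open>In units of the interval length \<open>\<epsilon>\<close>, the summands bound
    the uncertainty of \<open>(T ^^ k) y\<close> after multiplication by \<open>\<beta> ^ i\<close>,
    the rounding of \<open>w i\<close>, and the rounding passed on to the last coordinate by the
    hyperplane relation.\<close>
  define C1 where "C1 = \<beta> ^ s + 1 + (\<Sum>i<s. \<bar>\<kappa> i\<bar>)"
  have C1: "C1 \<ge> 1" using beta_pos by (simp add: C1_def sum_nonneg)
  \<comment> \<open>The factor 6 keeps the total phase error over the box of frequencies below
    \<open>2 * pi / 6 = pi / 3\<close>, where the cosine is still at least 1/2.\<close>
  define Q where "Q = nat \<lceil>6 * real s * C1\<rceil>"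
  have Q6: "6 * real s * C1 \<le> real Q" unfolding Q_def by linarith
  have "6 * real s * C1 \<ge> 1 * 1" using s1 C1 by (intro mult_mono) auto
  then have Q1: "Q \<ge> 1" using Q6 by linarith
  define C where "C = 4 * real Q * (2 * R * real Q + 5) ^ (s - 1)"
  show ?thesis
  proof (rule beta_normal_of_upper_density[OF Q1])
    show "C \<ge> 0" using R0 by (simp add: C_def)
    fix L :: nat and u e :: real
    assume L: "L \<ge> 1" and e: "e > 0"
    define \<epsilon> where "\<epsilon> = 1 / real (Q * L)"
    have eps: "\<epsilon> > 0" using Q1 L by (simp add: \<epsilon>_def)
    \<comment> \<open>Exponents of a trigonometric polynomial with \<open>L ^ s\<close> terms. Its
      squared modulus averages to \<open>L ^ s\<close> but is of order \<open>L ^ (2 * s)\<close>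
      near the point \<open>P v\<close>, so it detects visits to a cube of side about
      \<open>1 / L\<close>.\<close>
    define X where "X = ({..<s} \<rightarrow>\<^sub>E {..<L} :: (nat \<Rightarrow> nat) set)"
    have X: "finite X" "card X = L ^ s"
      unfolding X_def by (rule finite_PiE, simp, simp) (subst card_PiE, simp_all)
    define b where "b = \<lceil>R / \<epsilon>\<rceil> + 1"
    define V where "V = ({..<s - 1} \<rightarrow>\<^sub>E {-b..b} :: (nat \<Rightarrow> int) set)"
    have "0 \<le> R / \<epsilon>" using R0 eps by simp
    then have b0: "b \<ge> 1" unfolding b_def by linarith
    have V: "finite V" "card V = nat (2 * b + 1) ^ (s - 1)"
      unfolding V_def by (rule finite_PiE, simp, simp) (subst card_PiE, simp_all)
    \<comment> \<open>Since \<open>\<kappa> (s - 1) = 1\<close>, the last coordinate of the error is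
      minus the \<open>\<kappa>\<close>-combination of the others. Only \<open>s - 1\<close>
      integers \<open>v i\<close> are free, which saves one factor \<open>1 / \<epsilon>\<close> in
      the number of cubes.\<close>
    define P where "P v i = (if i < s - 1 then \<beta> ^ i * u - of_int (v i) * \<epsilon>
        else \<beta> ^ i * u + \<epsilon> * (\<Sum>i<s - 1. \<kappa> i * of_int (v i)))" for v :: "nat \<Rightarrow> int" and i
    define \<omega> where "\<omega> J = 2 * pi * (\<Sum>i<s. real (J i) * \<beta> ^ i)" for J :: "nat \<Rightarrow> nat"
    define U where "U v J = cis (- (2 * pi * (\<Sum>i<s. real (J i) * P v i)))" for v and J :: "nat \<Rightarrow> nat"
    define f where "f v k = (cmod (\<Sum>J\<in>X. U v J * cis (\<omega> J * (\<beta> ^ k * y))))\<^sup>2" for v k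
    have avg: "(\<lambda>N. (\<Sum>k<N. f v k) / real N) \<longlonglongrightarrow> real (L ^ s)" for v
      unfolding f_def X(2)[symmetric]
    proof (rule trig_sum_square_average[OF X(1)])
      fix J J' assume J: "J \<in> X" "J' \<in> X" "J \<noteq> J'"
      define c where "c i = int (J i) - int (J' i)" for i
      have eq: "\<omega> J - \<omega> J' = 2 * pi * (\<Sum>i<s. of_int (c i) * \<beta> ^ i)"
        unfolding \<omega>_def c_def by (simp add: sum_subtractf left_diff_distrib right_diff_distrib)
      have "\<exists>i<s. c i \<noteq> 0"
      proof (rule ccontr)
        assume "\<not> (\<exists>i<s. c i \<noteq> 0)"
        then have "\<And>i. i \<in> {..<s} \<Longrightarrow> J i = J' i" by (auto simp: c_def)
        then have "J = J'" using J(1,2) unfolding X_def by (intro PiE_ext) auto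
        then show False using J(3) by simp
      qed
      then have "(\<Sum>i<s. of_int (c i) * \<beta> ^ i) \<noteq> 0" using indep by blast
      from weyl[OF this] show "(\<lambda>N. (\<Sum>k<N. cis ((\<omega> J - \<omega> J') * (\<beta> ^ k * y))) / of_nat N) \<longlonglongrightarrow> 0"
        unfolding weyl_null_def eq by (simp add: mult.assoc)
    qed (simp add: U_def)
    have large: "\<exists>v\<in>V. (real L ^ s / 2)\<^sup>2 \<le> f v k" if k: "(T ^^ k) y \<in> {u..u + \<epsilon>}" for k
    proof -
      obtain w where w: "\<And>i. \<bar>w i\<bar> \<le> R" "\<And>i. \<exists>c :: int. \<beta> ^ i * (\<beta> ^ k * y) = \<beta> ^ i * (T ^^ k) y + of_int c - w i"
        and w0: "(\<Sum>i<s. \<kappa> i * w i) = 0" using approx[of k] by blast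
      define v where "v = restrict (\<lambda>i. \<lfloor>w i / \<epsilon>\<rfloor>) {..<s - 1}"
      have vw: "0 \<le> w i - of_int (v i) * \<epsilon> \<and> w i - of_int (v i) * \<epsilon> \<le> \<epsilon>" if "i < s - 1" for i
      proof -
        have "of_int \<lfloor>w i / \<epsilon>\<rfloor> * \<epsilon> \<le> w i"
          using of_int_floor_le[of "w i / \<epsilon>"] eps by (simp only: pos_le_divide_eq)
        moreover have "w i < (of_int \<lfloor>w i / \<epsilon>\<rfloor> + 1) * \<epsilon>"
          using floor_correct[of "w i / \<epsilon>"] eps by (simp only: pos_divide_less_eq of_int_add of_int_1)
        ultimately show ?thesis using that by (simp add: v_def algebra_simps)
      qed
      have "v \<in> V"
      proof -
        have "\<lfloor>w i / \<epsilon>\<rfloor> \<in> {-b..b}" for i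
        proof -
          have "\<bar>w i / \<epsilon>\<bar> \<le> R / \<epsilon>" using w(1)[of i] eps by (simp add: abs_divide divide_right_mono)
          then have "w i / \<epsilon> \<le> R / \<epsilon>" "- (R / \<epsilon>) \<le> w i / \<epsilon>" by (auto simp only: abs_le_iff)
          then have "\<lfloor>w i / \<epsilon>\<rfloor> \<le> \<lfloor>R / \<epsilon>\<rfloor>" "\<lfloor>- (R / \<epsilon>)\<rfloor> \<le> \<lfloor>w i / \<epsilon>\<rfloor>"
            by (auto intro: floor_mono)
          moreover have "\<lfloor>R / \<epsilon>\<rfloor> \<le> \<lceil>R / \<epsilon>\<rceil>" by (rule floor_le_ceiling)
          moreover have "\<lceil>R / \<epsilon>\<rceil> = - \<lfloor>- (R / \<epsilon>)\<rfloor>" by (rule ceiling_def)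
          ultimately show ?thesis unfolding b_def atLeastAtMost_iff by presburger
        qed
        then show ?thesis unfolding V_def v_def by auto
      qed
      obtain c :: "nat \<Rightarrow> int" where c: "\<And>i. \<beta> ^ i * (\<beta> ^ k * y) = \<beta> ^ i * (T ^^ k) y + of_int (c i) - w i"
        using w(2) by metis
      define \<tau> where "\<tau> i = \<beta> ^ i * (\<beta> ^ k * y) - of_int (c i) - P v i" for i
      have tau: "\<bar>\<tau> i\<bar> \<le> 1 / (6 * real s * real L)" if i: "i < s" for i
      proof -
        have T1: "\<bar>\<beta> ^ i * ((T ^^ k) y - u)\<bar> \<le> \<beta> ^ s * \<epsilon>"
          unfolding abs_mult using k beta_gt_1 i by (intro mult_mono) (auto intro: power_increasing)
        have "\<bar>\<tau> i\<bar> \<le> \<beta> ^ s * \<epsilon> + (1 + (\<Sum>i<s. \<bar>\<kappa> i\<bar>)) * \<epsilon>"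
        proof (cases "i < s - 1")
          case True
          have "\<tau> i = \<beta> ^ i * ((T ^^ k) y - u) - (w i - of_int (v i) * \<epsilon>)"
            using True unfolding \<tau>_def P_def c by (simp add: algebra_simps)
          then have "\<bar>\<tau> i\<bar> \<le> \<beta> ^ s * \<epsilon> + \<epsilon>" using T1 vw[OF True] by linarith
          moreover have "0 \<le> (\<Sum>i<s. \<bar>\<kappa> i\<bar>) * \<epsilon>" using eps by (simp add: sum_nonneg)
          ultimately show ?thesis by (simp add: distrib_right)
        next
          case False
          then have ieq: "i = s - 1" using i by simp
          have "s = Suc (s - 1)" using s1 by simp
          then have "(\<Sum>i<s - 1. \<kappa> i * w i) + w (s - 1) = 0"
            using w0 k1 sum.lessThan_Suc[of "\<lambda>i. \<kappa> i * w i" "s - 1"] by simp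
          then have "\<tau> i = \<beta> ^ i * ((T ^^ k) y - u) + (\<Sum>i<s - 1. \<kappa> i * (w i - of_int (v i) * \<epsilon>))"
            unfolding \<tau>_def P_def c ieq by (simp add: algebra_simps sum_subtractf sum_distrib_left)
          moreover have "\<bar>\<Sum>i<s - 1. \<kappa> i * (w i - of_int (v i) * \<epsilon>)\<bar> \<le> (\<Sum>i<s - 1. \<bar>\<kappa> i\<bar> * \<epsilon>)"
            by (rule order_trans[OF sum_abs sum_mono]) (use vw in \<open>auto simp: abs_mult intro!: mult_left_mono\<close>)
          moreover have "(\<Sum>i<s - 1. \<bar>\<kappa> i\<bar> * \<epsilon>) \<le> (\<Sum>i<s. \<bar>\<kappa> i\<bar> * \<epsilon>)"
            by (rule sum_mono2) (use eps in auto)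
          ultimately show ?thesis using T1 eps by (simp add: distrib_right sum_distrib_right)
        qed
        also have "\<dots> = C1 * \<epsilon>" by (simp add: C1_def algebra_simps)
        also have "\<dots> \<le> 1 / (6 * real s * real L)"
        proof -
          have "C1 * (6 * real s * real L) \<le> real Q * real L" using Q6 L by (simp add: mult_right_mono mult_ac)
          then show ?thesis using Q1 L s1 unfolding \<epsilon>_def by (simp add: field_simps)
        qed
        finally show ?thesis .
      qed
      have summand: "1 / 2 \<le> Re (U v J * cis (\<omega> J * (\<beta> ^ k * y)))" if J: "J \<in> X" for J
      proof -
        define S where "S = (\<Sum>i<s. real (J i) * \<tau> i)"
        have "\<bar>S\<bar> \<le> (\<Sum>i<s. real L * (1 / (6 * real s * real L)))"
          unfolding S_def
        proof (rule order_trans[OF sum_abs sum_mono])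
          fix i assume i: "i \<in> {..<s}"
          have "J i < L" using J i by (auto simp: X_def)
          then show "\<bar>real (J i) * \<tau> i\<bar> \<le> real L * (1 / (6 * real s * real L))"
            unfolding abs_mult using tau[of i] i by (intro mult_mono) auto
        qed
        also have "\<dots> = 1 / 6" using L s1 by simp
        finally have S: "\<bar>S\<bar> \<le> 1 / 6" .
        have "(\<Sum>i<s. real (J i) * \<beta> ^ i) * (\<beta> ^ k * y) - (\<Sum>i<s. real (J i) * P v i)
          = of_int (\<Sum>i<s. int (J i) * c i) + S"
        proof -
          have "real (J i) * \<beta> ^ i * (\<beta> ^ k * y) - real (J i) * P v i = real (J i) * of_int (c i) + real (J i) * \<tau> i" for i
            unfolding \<tau>_def by (simp add: algebra_simps)
          then show ?thesis
            unfolding sum_distrib_right S_def by (simp add: sum_subtractf[symmetric] sum.distrib[symmetric])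
        qed
        moreover have "- (2 * pi * (\<Sum>i<s. real (J i) * P v i)) + \<omega> J * (\<beta> ^ k * y)
            = 2 * pi * ((\<Sum>i<s. real (J i) * \<beta> ^ i) * (\<beta> ^ k * y) - (\<Sum>i<s. real (J i) * P v i))"
          unfolding \<omega>_def right_diff_distrib mult.assoc by simp
        ultimately have "- (2 * pi * (\<Sum>i<s. real (J i) * P v i)) + \<omega> J * (\<beta> ^ k * y)
            = 2 * pi * (of_int (\<Sum>i<s. int (J i) * c i) + S)" by (simp only:)
        then have "U v J * cis (\<omega> J * (\<beta> ^ k * y)) = cis (2 * pi * S)"
          unfolding U_def cis_mult by (simp only: cis_2pi_int_add)
        moreover have "cos (pi / 3) \<le> cos \<bar>2 * pi * S\<bar>"
        proof (rule cos_monotone_0_pi_le)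
          have "\<bar>2 * pi * S\<bar> = 2 * pi * \<bar>S\<bar>" by (simp add: abs_mult)
          also have "\<dots> \<le> 2 * pi * (1 / 6)" by (rule mult_left_mono[OF S]) simp
          finally show "\<bar>2 * pi * S\<bar> \<le> pi / 3" by simp
        qed auto
        ultimately show ?thesis by (simp add: cos_60)
      qed
      have "real L ^ s / 2 = (\<Sum>J\<in>X. 1 / 2)" by (simp add: X)
      also have "\<dots> \<le> (\<Sum>J\<in>X. Re (U v J * cis (\<omega> J * (\<beta> ^ k * y))))" by (rule sum_mono[OF summand])
      also have "\<dots> \<le> cmod (\<Sum>J\<in>X. U v J * cis (\<omega> J * (\<beta> ^ k * y)))"
        unfolding Re_sum[symmetric] by (rule complex_Re_le_cmod)
      finally have "(real L ^ s / 2)\<^sup>2 \<le> f v k" unfolding f_def by (rule power_mono) simp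
      then show ?thesis using \<open>v \<in> V\<close> by blast
    qed
    have count: "real (card {k. k < N \<and> (T ^^ k) y \<in> {u..u + \<epsilon>}}) * (real L ^ s / 2)\<^sup>2 \<le> (\<Sum>v\<in>V. \<Sum>k<N. f v k)" for N
    proof -
      have "real (card {k. k < N \<and> (T ^^ k) y \<in> {u..u + \<epsilon>}}) * (real L ^ s / 2)\<^sup>2
         = (\<Sum>k\<in>{k. k < N \<and> (T ^^ k) y \<in> {u..u + \<epsilon>}}. (real L ^ s / 2)\<^sup>2)" by simp
      also have "\<dots> \<le> (\<Sum>k\<in>{k. k < N \<and> (T ^^ k) y \<in> {u..u + \<epsilon>}}. \<Sum>v\<in>V. f v k)"
      proof (rule sum_mono)
        fix k assume "k \<in> {k. k < N \<and> (T ^^ k) y \<in> {u..u + \<epsilon>}}"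
        then obtain v where "v \<in> V" "(real L ^ s / 2)\<^sup>2 \<le> f v k" using large by blast
        moreover from this have "f v k \<le> (\<Sum>v\<in>V. f v k)"
          by (intro member_le_sum) (auto simp: f_def V)
        ultimately show "(real L ^ s / 2)\<^sup>2 \<le> (\<Sum>v\<in>V. f v k)" by linarith
      qed
      also have "\<dots> \<le> (\<Sum>k<N. \<Sum>v\<in>V. f v k)"
        by (rule sum_mono2) (auto simp: f_def intro!: sum_nonneg)
      also have "\<dots> = (\<Sum>v\<in>V. \<Sum>k<N. f v k)" by (rule sum.swap)
      finally show ?thesis .
    qed
    have "(\<lambda>N. \<Sum>v\<in>V. (\<Sum>k<N. f v k) / real N) \<longlonglongrightarrow> (\<Sum>v\<in>V. real (L ^ s))"
      by (intro tendsto_sum avg)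
    then have lim: "(\<lambda>N. (\<Sum>v\<in>V. (\<Sum>k<N. f v k) / real N) * (4 / (real L ^ s * real L ^ s)))
        \<longlonglongrightarrow> (\<Sum>v\<in>V. real (L ^ s)) * (4 / (real L ^ s * real L ^ s))"
      by (intro tendsto_mult tendsto_const)
    have "(\<Sum>v\<in>V. real (L ^ s)) * (4 / (real L ^ s * real L ^ s)) = 4 * real (card V) / real L ^ s"
      using L by (simp add: field_simps)
    \<comment> \<open>About \<open>L ^ (s - 1)\<close> cubes, each visited with asymptotic frequency
      at most \<open>4 / L ^ s\<close>, leave the required order \<open>1 / L\<close>.\<close>
    also have "\<dots> \<le> C / real (Q * L)"
    proof -
      have "real_of_int (2 * b + 1) \<le> (2 * R * real Q + 5) * real L"
      proof -
        have "real_of_int b \<le> R * real Q * real L + 2"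
          unfolding b_def \<epsilon>_def using ceiling_correct[of "R * real (Q * L)"] by (simp add: mult.assoc)
        then have "real_of_int (2 * b + 1) \<le> 2 * R * real Q * real L + 5 * 1" by simp
        also have "\<dots> \<le> 2 * R * real Q * real L + 5 * real L" using L by (intro add_left_mono mult_left_mono) auto
        finally show ?thesis by (simp add: distrib_right)
      qed
      then have "real (card V) \<le> ((2 * R * real Q + 5) * real L) ^ (s - 1)"
        unfolding V(2) using b0 by (simp add: power_mono)
      then have "4 * real (card V) / real L ^ s \<le> 4 * ((2 * R * real Q + 5) ^ (s - 1) * real L ^ (s - 1)) / real L ^ s"
        by (simp add: divide_right_mono power_mult_distrib)
      also have "\<dots> = C / real (Q * L)"
      proof -
        have "real L ^ s = real L ^ (s - 1) * real L" using s1 by (cases s) auto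
        moreover have "4 * (K * l) / (l * z) = 4 * q * K / (q * z)" if "l \<noteq> 0" "q \<noteq> 0" "z \<noteq> 0" for K l q z :: real
          using that by simp
        ultimately show ?thesis using L Q1 unfolding C_def of_nat_mult by simp
      qed
      finally show ?thesis .
    qed
    finally have le: "(\<Sum>v\<in>V. real (L ^ s)) * (4 / (real L ^ s * real L ^ s)) < C / real (Q * L) + e" using e by simp
    have "\<forall>\<^sub>F N in sequentially. (\<Sum>v\<in>V. (\<Sum>k<N. f v k) / real N) * (4 / (real L ^ s * real L ^ s)) < C / real (Q * L) + e"
      by (rule order_tendstoD(2)[OF lim le])
    then have "\<forall>\<^sub>F N in sequentially. real (card {k. k < N \<and> (T ^^ k) y \<in> {u..u + \<epsilon>}}) \<le> (C / real (Q * L) + e) * real N"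
      using eventually_gt_at_top[of 0]
    proof eventually_elim
      case (elim N)
      define A where "A = real L ^ s * real L ^ s"
      have A: "A > 0" using L by (simp add: A_def)
      have "(real L ^ s / 2)\<^sup>2 = A / 4" by (simp add: A_def power2_eq_square)
      then have "real (card {k. k < N \<and> (T ^^ k) y \<in> {u..u + \<epsilon>}}) \<le> (\<Sum>v\<in>V. \<Sum>k<N. f v k) * (4 / A)"
        using count[of N] A by (simp add: field_simps)
      also have "\<dots> = ((\<Sum>v\<in>V. (\<Sum>k<N. f v k) / real N) * (4 / A)) * real N"
        using elim(2) by (simp add: sum_divide_distrib[symmetric])
      also have "\<dots> \<le> (C / real (Q * L) + e) * real N"
        using elim by (intro mult_right_mono) (auto simp: A_def)
      finally show ?case .
    qed
    then show "\<forall>\<^sub>F N in sequentially. real (card {k. k < N \<and> (T ^^ k) y \<in> {u..u + 1 / real (Q * L)}})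
        \<le> (C / real (Q * L) + e) * real N" by (simp add: \<epsilon>_def)
  qed
qed

end

section \<open>Self-similar measures and their Fourier transforms\<close>

lemma cmod_cis_add: "cmod (cis s + cis t) = 2 * \<bar>cos ((s - t) / 2)\<bar>"
proof -
  have "cis s + cis t = cis ((s + t) / 2) * (cis ((s - t) / 2) + cis (- ((s - t) / 2)))"
    by (simp add: distrib_left cis_mult field_simps)
  also have "cis ((s - t) / 2) + cis (- ((s - t) / 2)) = complex_of_real (2 * cos ((s - t) / 2))"
    by (rule complex_eqI) auto
  finally show ?thesis by (simp add: norm_mult abs_mult del: of_real_mult)
qed

lemma cmod_cis_diff_le: "cmod (cis s - cis t) \<le> \<bar>s - t\<bar>"
proof -
  have "cis s - cis t = cis s + cis (t + pi)" by (rule complex_eqI) auto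
  then have "cmod (cis s - cis t) = 2 * \<bar>cos ((s - t) / 2 - pi / 2)\<bar>"
    by (simp only: cmod_cis_add) (simp add: diff_divide_distrib add_divide_distrib diff_diff_eq)
  also have "cos ((s - t) / 2 - pi / 2) = sin ((s - t) / 2)"
    by (simp add: cos_diff)
  also have "2 * \<bar>sin ((s - t) / 2)\<bar> \<le> 2 * \<bar>(s - t) / 2\<bar>" by (intro mult_left_mono abs_sin_x_le_abs_x) simp
  finally show ?thesis by simp
qed

text \<open>By Cauchy-Schwarz it suffices to bound
  \<open>cos^2 u + cos^2 v = 1 + cos (u + v) * cos (u - v)\<close> by \<open>1 + cos s\<close>. The
  bound 1 on the difference keeps \<open>cos (u - v)\<close> nonnegative and within the range of
  monotonicity.\<close>

lemma abs_cos_add_le: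
  fixes s u v :: real
  assumes "0 \<le> s" "s \<le> \<bar>u - v\<bar>" "\<bar>u - v\<bar> \<le> 1"
  shows "\<bar>cos u\<bar> + \<bar>cos v\<bar> \<le> 2 * cos (s / 2)"
proof (rule power2_le_imp_le)
  have "(\<bar>cos u\<bar> + \<bar>cos v\<bar>)\<^sup>2 \<le> 2 * ((cos u)\<^sup>2 + (cos v)\<^sup>2)"
  proof -
    have "0 \<le> (\<bar>cos u\<bar> - \<bar>cos v\<bar>)\<^sup>2" by simp
    then show ?thesis by (simp add: power2_sum power2_diff)
  qed
  also have "(cos u)\<^sup>2 + (cos v)\<^sup>2 = 1 + cos (u + v) * cos (u - v)"
  proof -
    have "(cos u)\<^sup>2 = (1 + cos (2 * u)) / 2" "(cos v)\<^sup>2 = (1 + cos (2 * v)) / 2"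
      using cos_double_cos[of u] cos_double_cos[of v] by simp_all
    moreover have "cos (2 * u) + cos (2 * v) = 2 * (cos (u + v) * cos (u - v))"
    proof -
      have e: "(2 * u + 2 * v) / 2 = u + v" "(2 * u - 2 * v) / 2 = u - v" by auto
      show ?thesis using cos_plus_cos[of "2 * u" "2 * v"] unfolding e by simp
    qed
    ultimately show ?thesis by simp
  qed
  also have "cos (u + v) * cos (u - v) \<le> cos s"
  proof -
    have c: "cos (u - v) = cos \<bar>u - v\<bar>" by simp
    have c0: "0 \<le> cos \<bar>u - v\<bar>" using assms pi_gt3 by (intro cos_ge_zero) auto
    have "cos (u + v) * cos (u - v) \<le> 1 * cos \<bar>u - v\<bar>"
      unfolding c using c0 by (intro mult_right_mono) auto
    also have "\<dots> \<le> 1 * cos s" using assms pi_gt3 by (simp only: mult_1) (intro cos_monotone_0_pi_le, auto)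
    finally show ?thesis by simp
  qed
  also have "2 * (1 + cos s) = (2 * cos (s / 2))\<^sup>2"
    using cos_double_cos[of "s / 2"] by (simp add: power_mult_distrib)
  finally show "(\<bar>cos u\<bar> + \<bar>cos v\<bar>)\<^sup>2 \<le> (2 * cos (s / 2))\<^sup>2" by simp
  show "0 \<le> 2 * cos (s / 2)" using assms pi_gt3 by (simp add: cos_ge_zero)
qed

text \<open>The assumption \<open>noncommuting\<close> compares the constant terms of the two
  compositions of the maps with indices 0 and 1, whose linear parts agree; it says that these maps
  do not commute. In this form the disjointness of the pieces enters the analysis.\<close>

locale self_similar =
  fixes c d :: real and r :: nat and a b p :: "nat \<Rightarrow> real" and \<mu> :: "real measure"
  assumes cd: "c < d" and r2: "r \<ge> 2"
    and contr: "\<And>i. i < r \<Longrightarrow> 0 < a i \<and> a i < 1"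
    and maps: "\<And>i. i < r \<Longrightarrow> aff a b i ` {c..d} \<subseteq> {c..d}"
    and noncommuting: "a 0 * b 1 + b 0 \<noteq> a 1 * b 0 + b 1"
    and self_sim: "self_similar_measure c d r a b p \<mu>"
begin

abbreviation "f \<equiv> aff a b"

lemma prob: "prob_space \<mu>" and sets_mu: "sets \<mu> = sets borel" and supp: "emeasure \<mu> {c..d} = 1"
  and p_pos: "i < r \<Longrightarrow> 0 < p i" and p_sum: "(\<Sum>i<r. p i) = 1"
  and ss_eq: "A \<in> sets borel \<Longrightarrow> emeasure \<mu> A = (\<Sum>i<r. ennreal (p i) * emeasure \<mu> (f i -` A))"
  using self_sim unfolding self_similar_measure_def by auto

sublocale prob_space \<mu> by (rule prob)

lemma meas_mu [measurable_cong]: "sets \<mu> = sets borel" by (rule sets_mu)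

lemma space_mu: "space \<mu> = UNIV" using sets_eq_imp_space_eq[OF sets_mu] by simp

lemma AE_supp: "AE x in \<mu>. x \<in> {c..d}"
  using supp by (subst AE_in_set_eq_1) (auto simp: sets_mu measure_def)

lemma f_measurable [measurable]: "f i \<in> borel_measurable borel"
  unfolding aff_def[abs_def] by measurable

lemma bdd_int: "bdd_borel B F \<Longrightarrow> integrable \<mu> F"
  by (rule bdd_integrable[OF finite_measure_axioms sets_mu])

lemma nn_self_sim:
  assumes "F \<in> borel_measurable borel"
  shows "(\<integral>\<^sup>+x. F x \<partial>\<mu>) = (\<Sum>i<r. ennreal (p i) * (\<integral>\<^sup>+x. F (f i x) \<partial>\<mu>))"
  using assms
proof (induction F rule: borel_measurable_induct)
  case (cong F G)
  then show ?case by (simp add: space_borel)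
next
  case (set A)
  have [measurable]: "A \<in> sets borel" by (rule set)
  have "f i -` A \<in> sets borel" for i
    using measurable_sets[OF f_measurable, of A i] set by simp
  moreover have "indicator A (f i x) = (indicator (f i -` A) x :: ennreal)" for i x
    by (simp add: indicator_def)
  ultimately show ?case using set sets_mu ss_eq[OF set] by (simp)
next
  case (mult F c)
  then show ?case
    by (simp add: nn_integral_cmult sum_distrib_left mult.left_commute)
next
  case (add F G)
  then show ?case
    by (simp add: nn_integral_add sum.distrib distrib_left)
next
  case (seq U)
  have meas: "U j \<in> borel_measurable borel" for j by (rule seq)
  have inc: "incseq U" by (rule seq)
  have lim: "(\<lambda>j. \<integral>\<^sup>+x. U j (\<phi> x) \<partial>\<mu>) \<longlonglongrightarrow> (\<integral>\<^sup>+x. (SUP j. U j (\<phi> x)) \<partial>\<mu>)"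
    if "\<phi> \<in> borel_measurable borel" for \<phi>
  proof -
    have "incseq (\<lambda>j x. U j (\<phi> x))" using inc by (auto simp: incseq_def le_fun_def)
    moreover have "(\<lambda>x. U j (\<phi> x)) \<in> borel_measurable \<mu>" for j
      using meas[of j] that by measurable
    moreover from calculation(1) have "incseq (\<lambda>j. \<integral>\<^sup>+x. U j (\<phi> x) \<partial>\<mu>)"
      unfolding incseq_def le_fun_def by (auto intro!: nn_integral_mono)
    ultimately show ?thesis
      by (simp add: nn_integral_monotone_convergence_SUP LIMSEQ_SUP)
  qed
  have 1: "(\<lambda>j. \<integral>\<^sup>+x. U j x \<partial>\<mu>) \<longlonglongrightarrow> (\<integral>\<^sup>+x. (SUP j. U j x) \<partial>\<mu>)"
    by (rule lim) simp
  have 2: "(\<lambda>j. \<Sum>i<r. ennreal (p i) * (\<integral>\<^sup>+x. U j (f i x) \<partial>\<mu>))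
     \<longlonglongrightarrow> (\<Sum>i<r. ennreal (p i) * (\<integral>\<^sup>+x. (SUP j. U j (f i x)) \<partial>\<mu>))"
    by (intro tendsto_sum ennreal_tendsto_cmult lim f_measurable) simp
  show ?case using LIMSEQ_unique[OF 1] 2 seq.IH by (simp add: image_comp SUP_apply)
qed

lemma bdd_f: "bdd_borel B F \<Longrightarrow> bdd_borel B (\<lambda>x. F (f i x))"
proof -
  assume F: "bdd_borel B F"
  then have [measurable]: "F \<in> borel_measurable borel" by (simp add: bdd_borel_def)
  have "(\<lambda>x. F (f i x)) \<in> borel_measurable borel" by measurable
  then show ?thesis using F by (simp add: bdd_borel_def)
qed

lemma ss_integral:
  assumes F: "bdd_borel B F"
  shows "(LINT x|\<mu>. F x) = (\<Sum>i<r. p i * (LINT x|\<mu>. F (f i x)))"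
proof -
  have pos: "0 \<le> F x + B" for x
  proof -
    have "\<bar>F x\<bar> \<le> B" using F by (simp add: bdd_borel_def)
    then show ?thesis by linarith
  qed
  have [measurable]: "F \<in> borel_measurable borel" using F by (simp add: bdd_borel_def)
  have nn: "ennreal ((LINT x|\<mu>. F (\<phi> x)) + B) = (\<integral>\<^sup>+x. ennreal (F (\<phi> x) + B) \<partial>\<mu>)"
    and ge: "0 \<le> (LINT x|\<mu>. F (\<phi> x)) + B"
    if bd: "bdd_borel B (\<lambda>x. F (\<phi> x))" for \<phi>
  proof -
    have i: "integrable \<mu> (\<lambda>x. F (\<phi> x))" by (rule bdd_int[OF bd])
    have eq: "(LINT x|\<mu>. F (\<phi> x) + B) = (LINT x|\<mu>. F (\<phi> x)) + B"
      using i by (simp add: prob_space)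
    show "ennreal ((LINT x|\<mu>. F (\<phi> x)) + B) = (\<integral>\<^sup>+x. ennreal (F (\<phi> x) + B) \<partial>\<mu>)"
      unfolding eq[symmetric] using i pos by (intro nn_integral_eq_integral[symmetric]) auto
    show "0 \<le> (LINT x|\<mu>. F (\<phi> x)) + B"
      unfolding eq[symmetric] by (rule Bochner_Integration.integral_nonneg) (rule pos)
  qed
  have "ennreal ((LINT x|\<mu>. F x) + B) = (\<integral>\<^sup>+x. ennreal (F x + B) \<partial>\<mu>)"
    using nn[of "\<lambda>x. x"] F by simp
  also have "\<dots> = (\<Sum>i<r. ennreal (p i) * (\<integral>\<^sup>+x. ennreal (F (f i x) + B) \<partial>\<mu>))"
    by (rule nn_self_sim) measurable
  also have "\<dots> = (\<Sum>i<r. ennreal (p i * ((LINT x|\<mu>. F (f i x)) + B)))"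
    by (intro sum.cong refl)
       (use p_pos in \<open>auto simp: nn[OF bdd_f[OF F], symmetric] ennreal_mult ge[OF bdd_f[OF F]] less_imp_le\<close>)
  also have "\<dots> = ennreal (\<Sum>i<r. p i * ((LINT x|\<mu>. F (f i x)) + B))"
    using p_pos ge[OF bdd_f[OF F]] by (intro sum_ennreal) (simp add: less_imp_le)
  finally have "(LINT x|\<mu>. F x) + B = (\<Sum>i<r. p i * ((LINT x|\<mu>. F (f i x)) + B))"
    using ge[of "\<lambda>x. x"] F ge[OF bdd_f[OF F]] p_pos
    by (subst (asm) ennreal_inj) (auto intro!: sum_nonneg mult_nonneg_nonneg simp: less_imp_le)
  then show ?thesis
    by (simp add: distrib_left sum.distrib sum_distrib_right[symmetric] p_sum)
qed

lemma cis_integrable: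
  assumes "g \<in> borel_measurable borel" shows "integrable \<mu> (\<lambda>x. cis (g x))"
proof (rule integrable_const_bound[of _ 1])
  have "continuous_on UNIV cis" by (intro continuous_intros)
  then have "cis \<in> borel_measurable borel" by (rule borel_measurable_continuous_onI)
  then show "(\<lambda>x. cis (g x)) \<in> borel_measurable \<mu>" using assms by measurable
qed simp

lemma ss_cis:
  assumes g: "g \<in> borel_measurable borel"
  shows "(LINT x|\<mu>. cis (g x)) = (\<Sum>i<r. p i *\<^sub>R (LINT x|\<mu>. cis (g (f i x))))"
proof (rule complex_eqI)
  have gi: "(\<lambda>x. g (f i x)) \<in> borel_measurable borel" for i using g by measurable
  have bc: "bdd_borel 1 (\<lambda>x. cos (g x))" and bs: "bdd_borel 1 (\<lambda>x. sin (g x))"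
    using g by (auto simp: bdd_borel_def)
  have Re: "Re (LINT x|\<mu>. cis (h x)) = (LINT x|\<mu>. cos (h x))" and Im: "Im (LINT x|\<mu>. cis (h x)) = (LINT x|\<mu>. sin (h x))"
    if "h \<in> borel_measurable borel" for h
    using integral_Re[OF cis_integrable[OF that]] integral_Im[OF cis_integrable[OF that]] by simp_all
  show "Re (LINT x|\<mu>. cis (g x)) = Re (\<Sum>i<r. p i *\<^sub>R (LINT x|\<mu>. cis (g (f i x))))"
    by (simp add: Re[OF g] Re[OF gi] ss_integral[OF bc])
  show "Im (LINT x|\<mu>. cis (g x)) = Im (\<Sum>i<r. p i *\<^sub>R (LINT x|\<mu>. cis (g (f i x))))"
    by (simp add: Im[OF g] Im[OF gi] ss_integral[OF bs])
qed

text \<open>\<open>cis\<close> is 1-Lipschitz and \<open>\<mu>\<close> is carried by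
  \<open>[c, d]\<close>, so phases have to be compared only there.\<close>

lemma cis_integral_diff:
  assumes "g \<in> borel_measurable borel" "h \<in> borel_measurable borel"
    and "\<And>x. x \<in> {c..d} \<Longrightarrow> \<bar>g x - h x\<bar> \<le> e"
  shows "\<bar>cmod (LINT x|\<mu>. cis (g x)) - cmod (LINT x|\<mu>. cis (h x))\<bar> \<le> e"
proof -
  have e0: "0 \<le> e" using assms(3)[of c] cd by auto
  have "\<bar>cmod (LINT x|\<mu>. cis (g x)) - cmod (LINT x|\<mu>. cis (h x))\<bar>
      \<le> cmod ((LINT x|\<mu>. cis (g x)) - (LINT x|\<mu>. cis (h x)))" by (rule norm_triangle_ineq3)
  also have "\<dots> = cmod (LINT x|\<mu>. cis (g x) - cis (h x))"
    by (subst Bochner_Integration.integral_diff) (auto intro: cis_integrable assms)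
  also have "\<dots> \<le> (LINT x|\<mu>. cmod (cis (g x) - cis (h x)))" by (rule integral_norm_bound)
  also have "\<dots> \<le> (LINT x|\<mu>. e)"
  proof (rule integral_mono_AE)
    show "integrable \<mu> (\<lambda>x. cmod (cis (g x) - cis (h x)))"
      by (intro integrable_norm Bochner_Integration.integrable_diff cis_integrable assms)
    show "AE x in \<mu>. cmod (cis (g x) - cis (h x)) \<le> e"
      using AE_supp by eventually_elim (use assms(3) cmod_cis_diff_le order_trans in blast)
  qed simp
  finally show ?thesis by (simp add: prob_space)
qed

text \<open>The modulus is invariant under translations of \<open>\<mu>\<close>, so a linearised
  cylinder enters through its frequency alone.\<close>

definition "FT \<theta> = cmod (LINT x|\<mu>. cis (\<theta> * x))"

lemma cis_integral_le_1: "g \<in> borel_measurable borel \<Longrightarrow> cmod (LINT x|\<mu>. cis (g x)) \<le> 1"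
proof -
  assume g: "g \<in> borel_measurable borel"
  have "cmod (LINT x|\<mu>. cis (g x)) \<le> (LINT x|\<mu>. cmod (cis (g x)))" by (rule integral_norm_bound)
  then show ?thesis by (simp add: prob_space)
qed

lemma FT_range: "0 \<le> FT \<theta>" "FT \<theta> \<le> 1"
  unfolding FT_def using cis_integral_le_1[of "\<lambda>x. \<theta> * x"] by auto

lemma cis_integral_affine:
  "(LINT x|\<mu>. cis (\<theta> * x + t)) = cis t * (LINT x|\<mu>. cis (\<theta> * x))"
  by (simp add: cis_mult[symmetric] mult.commute)

definition "radius = \<bar>c\<bar> + \<bar>d\<bar>"

lemma FT_lipschitz: "\<bar>FT \<theta> - FT \<theta>'\<bar> \<le> radius * \<bar>\<theta> - \<theta>'\<bar>"
  unfolding FT_def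
proof (rule cis_integral_diff)
  fix x assume x: "x \<in> {c..d}"
  have "\<bar>\<theta> * x - \<theta>' * x\<bar> = \<bar>x\<bar> * \<bar>\<theta> - \<theta>'\<bar>" by (simp add: left_diff_distrib[symmetric] abs_mult)
  also have "\<dots> \<le> radius * \<bar>\<theta> - \<theta>'\<bar>"
    using x by (intro mult_right_mono) (auto simp: radius_def)
  finally show "\<bar>\<theta> * x - \<theta>' * x\<bar> \<le> radius * \<bar>\<theta> - \<theta>'\<bar>" .
qed auto

lemma FT_recursion: "FT \<theta> \<le> (\<Sum>k<r. p k * FT (a k * \<theta>))"
proof -
  have "(LINT x|\<mu>. cis (\<theta> * f k x)) = cis (\<theta> * b k) * (LINT x|\<mu>. cis ((a k * \<theta>) * x))" for k
    unfolding cis_integral_affine[symmetric] by (simp add: aff_def algebra_simps)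
  then have "FT \<theta> = cmod (\<Sum>k<r. p k *\<^sub>R (cis (\<theta> * b k) * (LINT x|\<mu>. cis ((a k * \<theta>) * x))))"
    unfolding FT_def by (subst ss_cis) auto
  also have "\<dots> \<le> (\<Sum>k<r. p k * FT (a k * \<theta>))"
    by (rule order_trans[OF norm_sum sum_mono]) (use p_pos in \<open>auto simp: norm_mult FT_def less_imp_le\<close>)
  finally show ?thesis .
qed

definition "pairs = {..<r} \<times> {..<r}"

text \<open>These pairs are the words \<open>01\<close> and \<open>10\<close>. Given that one of
  them is drawn, each has probability 1/2, and both contract by \<open>a 0 * a 1\<close>.\<close>

definition coin :: "nat \<times> nat \<Rightarrow> bool" where "coin kl \<longleftrightarrow> kl = (0, 1) \<or> kl = (1, 0)"

lemma pairs_split: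
  fixes F :: "nat \<times> nat \<Rightarrow> 'b::ab_group_add"
  shows "sum F pairs = sum F {kl\<in>pairs. \<not> coin kl} + (F (0, 1) + F (1, 0))"
proof -
  have fin: "finite pairs" by (simp add: pairs_def)
  have "sum F pairs = sum F {kl\<in>pairs. \<not> coin kl} + sum F {kl\<in>pairs. coin kl}"
    by (subst sum.union_disjoint[symmetric]) (auto simp: fin intro: arg_cong[of _ _ "sum F"])
  also have "{kl\<in>pairs. coin kl} = {(0, 1), (1, 0)}" using r2 by (auto simp: pairs_def coin_def)
  finally show ?thesis by simp
qed

lemma pairs_weight: "(\<Sum>(k, l)\<in>pairs. p k * p l) = 1"
proof -
  have "(\<Sum>(k, l)\<in>pairs. p k * p l) = (\<Sum>k<r. p k) * (\<Sum>l<r. p l)"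
    unfolding pairs_def by (simp add: sum.cartesian_product sum_product)
  then show ?thesis by (simp add: p_sum)
qed

lemma ss_integral2:
  assumes F: "bdd_borel B F"
  shows "(LINT x|\<mu>. F x) = (\<Sum>(k, l)\<in>pairs. p k * p l * (LINT x|\<mu>. F (f k (f l x))))"
  unfolding pairs_def sum.cartesian_product[symmetric]
  by (subst ss_integral[OF F])
     (simp add: ss_integral[OF bdd_f[OF F]] sum_distrib_left mult.assoc)

definition "D = a 0 * b 1 + b 0 - (a 1 * b 0 + b 1)"

lemma D_nonzero: "D \<noteq> 0" using noncommuting by (simp add: D_def)

lemma coin_gap: "f 0 (f 1 x) - f 1 (f 0 x) = D"
  by (simp add: aff_def D_def algebra_simps)

lemma p01: "0 < p 0 * p 1" "2 * (p 0 * p 1) \<le> 1"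
proof -
  show pos: "0 < p 0 * p 1" using p_pos r2 by simp
  have "2 * (p 0 * p 1) = (\<Sum>(k, l)\<in>{(0,1), (1,0)}. p k * p l)" by simp
  also have "\<dots> \<le> (\<Sum>(k, l)\<in>pairs. p k * p l)"
    by (rule sum_mono2) (use r2 p_pos in \<open>auto simp: pairs_def less_imp_le\<close>)
  finally show "2 * (p 0 * p 1) \<le> 1" by (simp add: pairs_weight)
qed

definition cosw :: "real \<Rightarrow> nat \<times> nat \<Rightarrow> real" where
  "cosw \<theta> kl = (if coin kl then \<bar>cos (D * \<theta> / 2)\<bar> else 1)"

text \<open>The words \<open>01\<close> and \<open>10\<close> have equal contraction and equal weight but different translations;
  their interference produces the cosine.\<close>

lemma FT_interference:
  "FT \<theta> \<le> (\<Sum>(k, l)\<in>pairs. p k * p l * (cosw \<theta> (k, l) * FT (a k * a l * \<theta>)))"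
proof -
  let ?Z = "\<lambda>\<theta>. LINT x|\<mu>. cis (\<theta> * x)"
  let ?t = "\<lambda>k l. a k * b l + b k"
  let ?G = "\<lambda>(k, l). (p k * p l) *\<^sub>R (cis (\<theta> * ?t k l) * ?Z (a k * a l * \<theta>))"
  have Z: "(LINT x|\<mu>. cis (\<theta> * f k (f l x))) = cis (\<theta> * ?t k l) * ?Z (a k * a l * \<theta>)" for k l
    unfolding cis_integral_affine[symmetric] by (simp add: aff_def algebra_simps)
  have "(LINT x|\<mu>. cis (\<theta> * x)) = (\<Sum>k<r. p k *\<^sub>R (LINT x|\<mu>. cis (\<theta> * f k x)))"
    by (rule ss_cis) simp
  also have "\<dots> = (\<Sum>k<r. p k *\<^sub>R (\<Sum>l<r. p l *\<^sub>R (LINT x|\<mu>. cis (\<theta> * f k (f l x)))))"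
    by (intro sum.cong refl arg_cong2[of _ _ _ _ scaleR] ss_cis) measurable
  also have "\<dots> = sum ?G pairs"
    unfolding Z pairs_def sum.cartesian_product[symmetric] by (simp add: scaleR_sum_right)
  finally have "FT \<theta> = cmod (sum ?G {kl\<in>pairs. \<not> coin kl} + (?G (0, 1) + ?G (1, 0)))"
    unfolding FT_def pairs_split by simp
  also have "\<dots> \<le> (\<Sum>(k, l)\<in>{kl\<in>pairs. \<not> coin kl}. p k * p l * FT (a k * a l * \<theta>))
      + 2 * (p 0 * p 1) * (\<bar>cos (D * \<theta> / 2)\<bar> * FT (a 0 * a 1 * \<theta>))"
  proof (rule order_trans[OF norm_triangle_ineq add_mono])
    show "cmod (sum ?G {kl\<in>pairs. \<not> coin kl}) \<le> (\<Sum>(k, l)\<in>{kl\<in>pairs. \<not> coin kl}. p k * p l * FT (a k * a l * \<theta>))"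
      by (rule order_trans[OF norm_sum sum_mono])
         (use p_pos in \<open>auto simp: norm_mult FT_def pairs_def abs_mult less_imp_le\<close>)
    have "?G (0, 1) + ?G (1, 0) = (p 0 * p 1) *\<^sub>R ((cis (\<theta> * ?t 0 1) + cis (\<theta> * ?t 1 0)) * ?Z (a 0 * a 1 * \<theta>))"
      by (simp add: distrib_right scaleR_add_right mult.commute[of "p (Suc 0)"] mult.commute[of "a (Suc 0)" "a 0"])
    then have "cmod (?G (0, 1) + ?G (1, 0)) = (p 0 * p 1) * (2 * \<bar>cos ((\<theta> * ?t 0 1 - \<theta> * ?t 1 0) / 2)\<bar> * FT (a 0 * a 1 * \<theta>))"
      using p01 unfolding FT_def by (simp only: norm_scaleR norm_mult cmod_cis_add)
    also have "\<theta> * ?t 0 1 - \<theta> * ?t 1 0 = D * \<theta>" by (simp add: D_def algebra_simps)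
    finally show "cmod (?G (0, 1) + ?G (1, 0)) \<le> 2 * (p 0 * p 1) * (\<bar>cos (D * \<theta> / 2)\<bar> * FT (a 0 * a 1 * \<theta>))" by simp
  qed
  also have "\<dots> = (\<Sum>(k, l)\<in>pairs. p k * p l * (cosw \<theta> (k, l) * FT (a k * a l * \<theta>)))"
  proof -
    have "(\<Sum>(k, l)\<in>{kl\<in>pairs. \<not> coin kl}. p k * p l * FT (a k * a l * \<theta>))
       = (\<Sum>(k, l)\<in>{kl\<in>pairs. \<not> coin kl}. p k * p l * (cosw \<theta> (k, l) * FT (a k * a l * \<theta>)))"
      by (intro sum.cong refl) (auto simp: cosw_def)
    then show ?thesis unfolding pairs_split
      by (simp add: cosw_def coin_def mult.commute mult.left_commute)
  qed
  finally show ?thesis .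
qed

end

section \<open>Smoothed majorants and induction over cylinders\<close>

context self_similar
begin

definition "amin = Min (a ` {..<r})"
definition "amax = Max (a ` {..<r})"

lemma a_bounds: "k < r \<Longrightarrow> amin \<le> a k" "k < r \<Longrightarrow> a k \<le> amax"
  by (auto simp: amin_def amax_def)

lemma amin_range: "0 < amin" "amin < 1"
proof -
  have "{..<r} \<noteq> {}" using r2 by (simp add: lessThan_empty_iff)
  then have "amin \<in> a ` {..<r}" unfolding amin_def by (intro Min_in) auto
  then show "0 < amin" "amin < 1" using contr by auto
qed

lemma amax_range: "0 < amax" "amax < 1"
proof -
  have "{..<r} \<noteq> {}" using r2 by (simp add: lessThan_empty_iff)
  then have "amax \<in> a ` {..<r}" unfolding amax_def by (intro Max_in) auto
  then show "0 < amax" "amax < 1" using contr by auto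
qed

text \<open>An average of \<open>FT\<close> over the contraction ratios of all words of length
  \<open>N\<close>. Self-similarity makes it a majorant of \<open>FT\<close>, with a Lipschitz
  constant smaller by \<open>amax ^ N\<close>; it stands for the factor that hardly varies while the
  cosine oscillates.\<close>

primrec MN :: "nat \<Rightarrow> real \<Rightarrow> real" where
  "MN 0 \<theta> = FT \<theta>"
| "MN (Suc N) \<theta> = (\<Sum>k<r. p k * MN N (a k * \<theta>))"

lemma p_average_le:
  assumes "\<And>k. k < r \<Longrightarrow> x k \<le> X" shows "(\<Sum>k<r. p k * x k) \<le> X"
proof -
  have "(\<Sum>k<r. p k * x k) \<le> (\<Sum>k<r. p k * X)"
    by (intro sum_mono mult_left_mono) (use assms p_pos in \<open>auto simp: less_imp_le\<close>)
  then show ?thesis by (simp add: sum_distrib_right[symmetric] p_sum)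
qed

lemma p_sum_mono:
  assumes "\<And>k. k < r \<Longrightarrow> x k \<le> y k" shows "(\<Sum>k<r. p k * x k) \<le> (\<Sum>k<r. p k * y k)"
  by (intro sum_mono mult_left_mono) (use assms p_pos in \<open>auto simp: less_imp_le\<close>)

lemma MN_range: "0 \<le> MN N \<theta>" "MN N \<theta> \<le> 1"
proof (induction N arbitrary: \<theta>)
  case (Suc N)
  case 1
  then show ?case using Suc p_pos by (auto intro!: sum_nonneg mult_nonneg_nonneg simp: less_imp_le)
  case 2
  then show ?case using Suc by (auto intro: p_average_le)
qed (auto simp: FT_range)

lemma FT_le_MN: "FT \<theta> \<le> MN N \<theta>"
proof (induction N arbitrary: \<theta>)
  case (Suc N)
  have "FT \<theta> \<le> (\<Sum>k<r. p k * FT (a k * \<theta>))" by (rule FT_recursion)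
  also have "\<dots> \<le> MN (Suc N) \<theta>" by (simp add: p_sum_mono Suc)
  finally show ?case .
qed simp

lemma radius_nonneg: "0 \<le> radius" by (simp add: radius_def)

lemma MN_lipschitz: "\<bar>MN N \<theta> - MN N \<theta>'\<bar> \<le> amax ^ N * radius * \<bar>\<theta> - \<theta>'\<bar>"
proof (induction N arbitrary: \<theta> \<theta>')
  case 0
  then show ?case using FT_lipschitz by simp
next
  case (Suc N)
  have "\<bar>MN (Suc N) \<theta> - MN (Suc N) \<theta>'\<bar> = \<bar>\<Sum>k<r. p k * (MN N (a k * \<theta>) - MN N (a k * \<theta>'))\<bar>"
    by (simp add: sum_subtractf right_diff_distrib)
  also have "\<dots> \<le> (\<Sum>k<r. p k * \<bar>MN N (a k * \<theta>) - MN N (a k * \<theta>')\<bar>)"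
    by (rule order_trans[OF sum_abs sum_mono]) (use p_pos in \<open>auto simp: abs_mult less_imp_le\<close>)
  also have "\<dots> \<le> amax ^ Suc N * radius * \<bar>\<theta> - \<theta>'\<bar>"
  proof (rule p_average_le)
    fix k assume k: "k < r"
    have "\<bar>MN N (a k * \<theta>) - MN N (a k * \<theta>')\<bar> \<le> amax ^ N * radius * \<bar>a k * \<theta> - a k * \<theta>'\<bar>" by (rule Suc)
    also have "\<bar>a k * \<theta> - a k * \<theta>'\<bar> = a k * \<bar>\<theta> - \<theta>'\<bar>"
      using contr[OF k] by (simp add: right_diff_distrib[symmetric] abs_mult)
    also have "amax ^ N * radius * (a k * \<bar>\<theta> - \<theta>'\<bar>) \<le> amax ^ N * radius * (amax * \<bar>\<theta> - \<theta>'\<bar>)"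
      using a_bounds(2)[OF k] amax_range radius_nonneg by (intro mult_left_mono mult_right_mono) auto
    finally show "\<bar>MN N (a k * \<theta>) - MN N (a k * \<theta>')\<bar> \<le> amax ^ Suc N * radius * \<bar>\<theta> - \<theta>'\<bar>"
      by (simp add: mult_ac)
  qed
  finally show ?case .
qed

lemma MN_measurable [measurable]: "MN N \<in> borel_measurable borel"
proof (rule borel_measurable_continuous_onI)
  define L where "L = amax ^ N * radius + 1"
  have L: "L > 0" "\<bar>MN N x - MN N y\<bar> \<le> L * \<bar>x - y\<bar>" for x y
  proof -
    have "0 \<le> amax ^ N * radius" using amax_range radius_nonneg by simp
    then show "L > 0" by (simp add: L_def)
    have "amax ^ N * radius * \<bar>x - y\<bar> \<le> L * \<bar>x - y\<bar>" by (intro mult_right_mono) (auto simp: L_def)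
    then show "\<bar>MN N x - MN N y\<bar> \<le> L * \<bar>x - y\<bar>" using MN_lipschitz[of N x y] by linarith
  qed
  have "L-lipschitz_on UNIV (MN N)"
    by (rule lipschitz_onI) (use L in \<open>auto simp: dist_real_def less_imp_le\<close>)
  then show "continuous_on UNIV (MN N)" by (rule lipschitz_on_continuous_on)
qed

lemma FT_measurable [measurable]: "FT \<in> borel_measurable borel"
proof -
  have "MN 0 = FT" by (rule ext) simp
  then show ?thesis using MN_measurable[of 0] by simp
qed

text \<open>A cylinder is recorded by its affine map \<open>x \<mapsto> \<alpha> * x + t\<close>
  without its word. The exponents \<open>\<nu>\<close> are kept because they, and not the words,
  will be counted.\<close>

definition valid :: "real \<Rightarrow> real \<Rightarrow> bool" where
  "valid \<alpha> t \<longleftrightarrow> (\<exists>\<nu>. \<alpha> = (\<Prod>i<r. a i ^ \<nu> i)) \<and> (\<forall>x\<in>{c..d}. \<alpha> * x + t \<in> {c..d})"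

lemma valid_pos: "valid \<alpha> t \<Longrightarrow> 0 < \<alpha>"
  unfolding valid_def using contr by (auto intro!: prod_pos)

lemma f_maps: "k < r \<Longrightarrow> x \<in> {c..d} \<Longrightarrow> f k x \<in> {c..d}"
  using maps by blast

lemma valid_1: "valid 1 0"
  unfolding valid_def by (auto intro: exI[of _ "\<lambda>_. 0"])

lemma valid_child:
  assumes "valid \<alpha> t" "k < r" shows "valid (\<alpha> * a k) (\<alpha> * b k + t)"
proof -
  obtain \<nu> where \<nu>: "\<alpha> = (\<Prod>i<r. a i ^ \<nu> i)" using assms(1) by (auto simp: valid_def)
  have "\<alpha> * a k = (\<Prod>i<r. a i ^ (\<nu>(k := Suc (\<nu> k))) i)"
  proof -
    have "(\<Prod>i<r. a i ^ (\<nu>(k := Suc (\<nu> k))) i) = (\<Prod>i<r. a i ^ \<nu> i * (if i = k then a k else 1))"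
      by (intro prod.cong) auto
    also have "\<dots> = \<alpha> * a k" unfolding prod.distrib \<nu> using assms(2) by simp
    finally show ?thesis by simp
  qed
  moreover have "\<alpha> * a k * x + (\<alpha> * b k + t) \<in> {c..d}" if x: "x \<in> {c..d}" for x
  proof -
    have "\<alpha> * f k x + t \<in> {c..d}" using assms f_maps[OF assms(2) x] by (simp add: valid_def)
    then show ?thesis by (simp add: aff_def algebra_simps)
  qed
  ultimately show ?thesis unfolding valid_def by blast
qed

text \<open>Cylinders are subdivided until the ratio first drops to \<open>\<tau>\<close> or below;
  one letter multiplies it by at least \<open>amin\<close>, so it then still exceeds
  \<open>amin * \<tau>\<close>. Powers of \<open>amax\<close> bound the depth. Inequalities that
  hold on stopped cylinders and survive weighted averaging thus reach the whole interval.\<close>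

lemma stopping_induct:
  assumes base: "\<And>\<alpha> t. valid \<alpha> t \<Longrightarrow> amin * \<tau> < \<alpha> \<Longrightarrow> \<alpha> \<le> \<tau> \<Longrightarrow> P \<alpha> t"
    and step: "\<And>\<alpha> t. valid \<alpha> t \<Longrightarrow> \<tau> < \<alpha> \<Longrightarrow> (\<And>k. k < r \<Longrightarrow> P (\<alpha> * a k) (\<alpha> * b k + t)) \<Longrightarrow> P \<alpha> t"
    and tau: "0 < \<tau>" "amin * \<tau> < 1"
  shows "P 1 0"
proof -
  have main: "P \<alpha> t" if "valid \<alpha> t" "amin * \<tau> < \<alpha>" "\<alpha> * amax ^ n \<le> \<tau>" for n \<alpha> t
    using that
  proof (induction n arbitrary: \<alpha> t)
    case 0
    then show ?case by (auto intro: base)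
  next
    case (Suc n)
    show ?case
    proof (cases "\<alpha> \<le> \<tau>")
      case True
      then show ?thesis using Suc.prems by (intro base)
    next
      case False
      show ?thesis
      proof (rule step[OF Suc.prems(1)])
        fix k assume k: "k < r"
        show "P (\<alpha> * a k) (\<alpha> * b k + t)"
        proof (rule Suc.IH[OF valid_child[OF Suc.prems(1) k]])
          have "amin * \<tau> < amin * \<alpha>" using False amin_range by simp
          also have "\<dots> \<le> \<alpha> * a k" using a_bounds(1)[OF k] valid_pos[OF Suc.prems(1)] by (simp add: mult.commute)
          finally show "amin * \<tau> < \<alpha> * a k" .
          have "\<alpha> * a k * amax ^ n \<le> \<alpha> * amax * amax ^ n"
            using a_bounds(2)[OF k] valid_pos[OF Suc.prems(1)] amax_range by (intro mult_right_mono mult_left_mono) auto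
          then show "\<alpha> * a k * amax ^ n \<le> \<tau>" using Suc.prems(3) by (simp add: mult_ac)
        qed
      qed (use False in simp)
    qed
  qed
  obtain n where "amax ^ n < \<tau>" using real_arch_pow_inv[OF tau(1)] amax_range by blast
  then show ?thesis using main[OF valid_1 tau(2), of n] by simp
qed

end

section \<open>Averaged decay along a bilipschitz family of frequencies\<close>

locale bilipschitz_phase = self_similar +
  fixes \<psi> :: "real \<Rightarrow> real" and \<kappa> K :: real
  assumes psi_meas [measurable]: "\<psi> \<in> borel_measurable borel"
    and kappa: "0 < \<kappa>" "\<kappa> \<le> K"
    and lower: "x \<in> {c..d} \<Longrightarrow> y \<in> {c..d} \<Longrightarrow> \<kappa> * \<bar>x - y\<bar> \<le> \<bar>\<psi> x - \<psi> y\<bar>"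
    and upper: "x \<in> {c..d} \<Longrightarrow> y \<in> {c..d} \<Longrightarrow> \<bar>\<psi> x - \<psi> y\<bar> \<le> K * \<bar>x - y\<bar>"
begin

text \<open>\<open>\<delta>\<close> is chosen such that on a cylinder of contraction ratio about \<open>\<delta> / T\<close> the arguments of the
  cosine at the images under \<open>01\<close> and \<open>10\<close> differ by an amount between \<open>spread\<close> and 1.\<close>

definition "\<delta> = 2 / (D\<^sup>2 * K)"
definition "spread = \<kappa> * amin / K"
text \<open>The probability \<open>2 * (p 0 * p 1)\<close> of drawing \<open>01\<close> or
  \<open>10\<close> is the share of the mass on which the bound for the cosine drops from 1 to
  \<open>cos (spread / 2)\<close>.\<close>

definition "\<zeta> = 1 - 2 * (p 0 * p 1) * (1 - cos (spread / 2))"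

lemma K_pos: "0 < K" using kappa by simp

lemma delta_pos: "0 < \<delta>" using K_pos D_nonzero by (simp add: \<delta>_def)

lemma spread_range: "0 < spread" "spread \<le> 1"
proof -
  show "0 < spread" using kappa K_pos amin_range by (simp add: spread_def)
  have "\<kappa> * amin \<le> K * 1" using kappa amin_range by (intro mult_mono) auto
  then show "spread \<le> 1" using K_pos by (simp add: spread_def)
qed

lemma cos_spread: "0 \<le> cos (spread / 2)" "cos (spread / 2) < 1"
proof -
  show "0 \<le> cos (spread / 2)" using spread_range pi_gt3 by (intro cos_ge_zero) auto
  have "cos (spread / 2) < cos 0" using spread_range pi_gt3 by (intro cos_monotone_0_pi) auto
  then show "cos (spread / 2) < 1" by simp
qed

lemma zeta_range: "0 \<le> \<zeta>" "\<zeta> < 1"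
proof -
  have "2 * (p 0 * p 1) * (1 - cos (spread / 2)) \<le> 1 * 1"
    using p01 cos_spread by (intro mult_mono) auto
  then show "0 \<le> \<zeta>" by (simp add: \<zeta>_def)
  show "\<zeta> < 1" using p01 cos_spread by (simp add: \<zeta>_def)
qed

text \<open>The points reached through \<open>01\<close> and \<open>10\<close> are
  \<open>\<alpha> * \<bar>D\<bar>\<close> apart. By the bilipschitz bounds the arguments of the
  cosine then differ by between \<open>spread\<close> and 1, so the two moduli cannot both be close
  to 1.\<close>

lemma cos_average:
  assumes v: "valid \<alpha> t" and T: "0 < T" and al: "amin * (\<delta> / T) < \<alpha>" "\<alpha> \<le> \<delta> / T"
  shows "(LINT x|\<mu>. \<bar>cos (D * (T * \<psi> (\<alpha> * x + t)) / 2)\<bar>) \<le> \<zeta>"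
proof -
  define F where "F x = \<bar>cos (D * (T * \<psi> (\<alpha> * x + t)) / 2)\<bar>" for x
  have F: "bdd_borel 1 F" unfolding bdd_borel_def F_def by auto
  have Fi: "integrable \<mu> (\<lambda>x. F (f k (f l x)))" for k l by (rule bdd_int[OF bdd_f[OF bdd_f[OF F]]])
  have le1: "(LINT x|\<mu>. F (f k (f l x))) \<le> 1" for k l
  proof -
    have "(LINT x|\<mu>. F (f k (f l x))) \<le> (LINT x|\<mu>. 1)"
      by (rule integral_mono[OF Fi]) (auto simp: F_def)
    then show ?thesis by (simp add: prob_space)
  qed
  have two: "(LINT x|\<mu>. F (f 0 (f 1 x))) + (LINT x|\<mu>. F (f 1 (f 0 x))) \<le> 2 * cos (spread / 2)"
  proof -
    have "(LINT x|\<mu>. F (f 0 (f 1 x))) + (LINT x|\<mu>. F (f 1 (f 0 x))) = (LINT x|\<mu>. F (f 0 (f 1 x)) + F (f 1 (f 0 x)))"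
      by (rule Bochner_Integration.integral_add[OF Fi Fi, symmetric])
    also have "\<dots> \<le> (LINT x|\<mu>. 2 * cos (spread / 2))"
    proof (rule integral_mono_AE)
      show "integrable \<mu> (\<lambda>x. F (f 0 (f 1 x)) + F (f 1 (f 0 x)))"
        by (intro Bochner_Integration.integrable_add Fi)
      show "AE x in \<mu>. F (f 0 (f 1 x)) + F (f 1 (f 0 x)) \<le> 2 * cos (spread / 2)"
        using AE_supp
      proof eventually_elim
        case (elim x)
        define y z where "y = \<alpha> * f 0 (f 1 x) + t" and "z = \<alpha> * f 1 (f 0 x) + t"
        have fx: "f 0 (f 1 x) \<in> {c..d}" "f 1 (f 0 x) \<in> {c..d}"
          using elim f_maps[of 0] f_maps[of 1] r2 by auto
        then have yz: "y \<in> {c..d}" "z \<in> {c..d}" using v unfolding valid_def y_def z_def by blast+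
        have al0: "0 < \<alpha>" by (rule valid_pos[OF v])
        have dist: "\<bar>y - z\<bar> = \<alpha> * \<bar>D\<bar>"
        proof -
          have "y - z = \<alpha> * (f 0 (f 1 x) - f 1 (f 0 x))" by (simp add: y_def z_def algebra_simps)
          then show ?thesis using al0 by (simp only: coin_gap abs_mult abs_of_pos)
        qed
        have eq: "\<bar>D * (T * \<psi> y) / 2 - D * (T * \<psi> z) / 2\<bar> = \<bar>D\<bar> * T / 2 * \<bar>\<psi> y - \<psi> z\<bar>"
        proof -
          have "D * (T * \<psi> y) / 2 - D * (T * \<psi> z) / 2 = D * T / 2 * (\<psi> y - \<psi> z)" by (simp add: field_simps)
          then show ?thesis using T by (simp only: abs_mult) (simp add: abs_mult)
        qed
        have DD: "\<bar>D\<bar> * \<bar>D\<bar> = D\<^sup>2" "0 < D\<^sup>2" using D_nonzero by (simp add: power2_eq_square, simp only: zero_less_power2, simp)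
        have lo: "spread \<le> \<bar>D * (T * \<psi> y) / 2 - D * (T * \<psi> z) / 2\<bar>"
        proof -
          have "spread = D\<^sup>2 * T / 2 * (\<kappa> * (amin * (\<delta> / T)))"
            using DD T K_pos by (simp add: spread_def \<delta>_def)
          also have "\<dots> \<le> D\<^sup>2 * T / 2 * (\<kappa> * \<alpha>)"
            using al kappa DD T by (intro mult_left_mono) auto
          also have "\<dots> = \<bar>D\<bar> * T / 2 * (\<kappa> * \<bar>y - z\<bar>)"
            unfolding dist DD(1)[symmetric] by simp
          also have "\<dots> \<le> \<bar>D\<bar> * T / 2 * \<bar>\<psi> y - \<psi> z\<bar>"
            using lower[OF yz] T by (intro mult_left_mono) auto
          finally show ?thesis unfolding eq .
        qed
        have hi: "\<bar>D * (T * \<psi> y) / 2 - D * (T * \<psi> z) / 2\<bar> \<le> 1"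
        proof -
          have "\<bar>D\<bar> * T / 2 * \<bar>\<psi> y - \<psi> z\<bar> \<le> \<bar>D\<bar> * T / 2 * (K * \<bar>y - z\<bar>)"
            using upper[OF yz] T by (intro mult_left_mono) auto
          also have "\<dots> = D\<^sup>2 * T / 2 * (K * \<alpha>)"
            unfolding dist DD(1)[symmetric] by simp
          also have "\<dots> \<le> D\<^sup>2 * T / 2 * (K * (\<delta> / T))"
            using al K_pos DD T by (intro mult_left_mono) auto
          also have "\<dots> = 1" using DD T K_pos by (simp add: \<delta>_def)
          finally show ?thesis unfolding eq .
        qed
        show "F (f 0 (f 1 x)) + F (f 1 (f 0 x)) \<le> 2 * cos (spread / 2)"
          unfolding F_def y_def[symmetric] z_def[symmetric]
          by (rule abs_cos_add_le) (use spread_range lo hi in auto)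
      qed
    qed simp
    finally show ?thesis by (simp add: prob_space)
  qed
  have "(LINT x|\<mu>. F x) = (\<Sum>(k, l)\<in>{kl\<in>pairs. \<not> coin kl}. p k * p l * (LINT x|\<mu>. F (f k (f l x))))
      + p 0 * p 1 * ((LINT x|\<mu>. F (f 0 (f 1 x))) + (LINT x|\<mu>. F (f 1 (f 0 x))))"
    unfolding ss_integral2[OF F] pairs_split by (simp add: distrib_left mult.commute[of "p (Suc 0)"])
  also have "\<dots> \<le> (\<Sum>(k, l)\<in>{kl\<in>pairs. \<not> coin kl}. p k * p l) + p 0 * p 1 * (2 * cos (spread / 2))"
  proof (intro add_mono sum_mono mult_left_mono two)
    fix kl assume "kl \<in> {kl\<in>pairs. \<not> coin kl}"
    then obtain k l where kl: "kl = (k, l)" "k < r" "l < r" by (auto simp: pairs_def)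
    have "p k * p l * (LINT x|\<mu>. F (f k (f l x))) \<le> p k * p l * 1"
      using p_pos kl le1 by (intro mult_left_mono) (auto simp: less_imp_le)
    then show "(case kl of (k, l) \<Rightarrow> p k * p l * (LINT x|\<mu>. F (f k (f l x)))) \<le> (case kl of (k, l) \<Rightarrow> p k * p l)"
      by (simp add: kl)
  qed (use p01 in auto)
  also have "(\<Sum>(k, l)\<in>{kl\<in>pairs. \<not> coin kl}. p k * p l) = 1 - 2 * (p 0 * p 1)"
    using pairs_weight unfolding pairs_split by simp
  also have "1 - 2 * (p 0 * p 1) + p 0 * p 1 * (2 * cos (spread / 2)) = \<zeta>"
    by (simp add: \<zeta>_def algebra_simps)
  finally show ?thesis unfolding F_def .
qed

text \<open>On a cylinder of ratio about \<open>\<delta> / T\<close> the weight \<open>W\<close>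
  varies by at most the error term and may be replaced by its mean, while the cosine averages to at
  most \<open>\<zeta>\<close>. The condition \<open>amin * \<delta> < T\<close> lets the subdivision
  start at the whole interval.\<close>

lemma interference_gain:
  assumes T: "0 < T" "amin * \<delta> < T" and W: "bdd_borel 1 W" "\<And>y. 0 \<le> W y"
    and lip: "\<And>y y'. \<bar>W y - W y'\<bar> \<le> \<Lambda> * \<bar>y - y'\<bar>"
  shows "(LINT x|\<mu>. \<bar>cos (D * (T * \<psi> x) / 2)\<bar> * W (\<psi> x))
    \<le> \<zeta> * (LINT x|\<mu>. W (\<psi> x)) + \<Lambda> * K * (d - c) * (\<delta> / T)"
proof -
  define E where "E = \<Lambda> * K * (d - c) * (\<delta> / T)"
  define G where "G y = \<bar>cos (D * (T * \<psi> y) / 2)\<bar>" for y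
  have [measurable]: "W \<in> borel_measurable borel" using W by (simp add: bdd_borel_def)
  have W1: "W y \<le> 1" for y using W unfolding bdd_borel_def by (simp add: abs_le_iff)
  have L0: "0 \<le> \<Lambda>" using lip[of 1 0] by simp
  define J where "J \<alpha> t = (LINT x|\<mu>. G (\<alpha> * x + t) * W (\<psi> (\<alpha> * x + t)))" for \<alpha> t
  define I where "I \<alpha> t = (LINT x|\<mu>. W (\<psi> (\<alpha> * x + t)))" for \<alpha> t
  have Gm [measurable]: "G \<in> borel_measurable borel" unfolding G_def by measurable
  have bJ: "bdd_borel 1 (\<lambda>x. G (\<alpha> * x + t) * W (\<psi> (\<alpha> * x + t)))" for \<alpha> t
  proof -
    have "\<bar>G y * W z\<bar> \<le> 1 * 1" for y z
      unfolding abs_mult using W W1 by (intro mult_mono) (auto simp: G_def)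
    then show ?thesis unfolding bdd_borel_def by auto
  qed
  have bI: "bdd_borel 1 (\<lambda>x. W (\<psi> (\<alpha> * x + t)))" for \<alpha> t
    using W unfolding bdd_borel_def by auto
  have "J 1 0 \<le> \<zeta> * I 1 0 + E"
  proof (rule stopping_induct[where \<tau>="\<delta> / T" and P="\<lambda>\<alpha> t. J \<alpha> t \<le> \<zeta> * I \<alpha> t + E"])
    show "0 < \<delta> / T" using delta_pos T by simp
    show "amin * (\<delta> / T) < 1" using T by simp
  next
    fix \<alpha> t assume v: "valid \<alpha> t" and al: "amin * (\<delta> / T) < \<alpha>" "\<alpha> \<le> \<delta> / T"
    have al0: "0 < \<alpha>" by (rule valid_pos[OF v])
    define osc where "osc = \<Lambda> * (K * (\<alpha> * (d - c)))"
    have osc: "0 \<le> osc" "osc \<le> E"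
    proof -
      show "0 \<le> osc" using L0 K_pos al0 cd by (simp add: osc_def)
      have "\<Lambda> * (K * (\<alpha> * (d - c))) \<le> \<Lambda> * (K * (\<delta> / T * (d - c)))"
        using L0 K_pos al cd by (intro mult_left_mono mult_right_mono) auto
      then show "osc \<le> E" by (simp add: osc_def E_def mult_ac)
    qed
    have near: "W (\<psi> (\<alpha> * x + t)) \<le> W (\<psi> (\<alpha> * y + t)) + osc" if xy: "x \<in> {c..d}" "y \<in> {c..d}" for x y
    proof -
      have h: "\<alpha> * x + t \<in> {c..d}" "\<alpha> * y + t \<in> {c..d}" using v xy unfolding valid_def by blast+
      have "\<bar>W (\<psi> (\<alpha> * x + t)) - W (\<psi> (\<alpha> * y + t))\<bar> \<le> \<Lambda> * \<bar>\<psi> (\<alpha> * x + t) - \<psi> (\<alpha> * y + t)\<bar>" by (rule lip)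
      also have "\<dots> \<le> \<Lambda> * (K * \<bar>(\<alpha> * x + t) - (\<alpha> * y + t)\<bar>)"
        using upper[OF h] L0 by (intro mult_left_mono) auto
      also have "\<bar>(\<alpha> * x + t) - (\<alpha> * y + t)\<bar> = \<alpha> * \<bar>x - y\<bar>"
        using al0 by (simp add: right_diff_distrib[symmetric] abs_mult)
      also have "\<Lambda> * (K * (\<alpha> * \<bar>x - y\<bar>)) \<le> osc"
        unfolding osc_def using L0 K_pos al0 xy by (intro mult_left_mono) auto
      finally show ?thesis by linarith
    qed
    have nearI: "W (\<psi> (\<alpha> * x + t)) \<le> I \<alpha> t + osc" if x: "x \<in> {c..d}" for x
    proof -
      have "(LINT y|\<mu>. W (\<psi> (\<alpha> * x + t))) \<le> (LINT y|\<mu>. W (\<psi> (\<alpha> * y + t)) + osc)"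
      proof (rule integral_mono_AE)
        show "AE y in \<mu>. W (\<psi> (\<alpha> * x + t)) \<le> W (\<psi> (\<alpha> * y + t)) + osc"
          using AE_supp by eventually_elim (rule near[OF x])
      qed (use bdd_int[OF bI] in auto)
      then show ?thesis using bdd_int[OF bI, of \<alpha> t] by (simp add: prob_space I_def)
    qed
    have I0: "0 \<le> I \<alpha> t" unfolding I_def using W by (intro Bochner_Integration.integral_nonneg) auto
    have "J \<alpha> t \<le> (LINT x|\<mu>. G (\<alpha> * x + t) * (I \<alpha> t + osc))"
      unfolding J_def
    proof (rule integral_mono_AE)
      show "AE x in \<mu>. G (\<alpha> * x + t) * W (\<psi> (\<alpha> * x + t)) \<le> G (\<alpha> * x + t) * (I \<alpha> t + osc)"
        using AE_supp by eventually_elim (auto intro!: mult_left_mono nearI simp: G_def)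
      show "integrable \<mu> (\<lambda>x. G (\<alpha> * x + t) * (I \<alpha> t + osc))"
        by (intro integrable_mult_left bdd_int[of 1]) (auto simp: bdd_borel_def G_def)
    qed (rule bdd_int[OF bJ])
    also have "\<dots> = (LINT x|\<mu>. G (\<alpha> * x + t)) * (I \<alpha> t + osc)" by simp
    also have "\<dots> \<le> \<zeta> * (I \<alpha> t + osc)"
      using cos_average[OF v T(1) al] I0 osc unfolding G_def by (intro mult_right_mono) auto
    also have "\<dots> \<le> \<zeta> * I \<alpha> t + 1 * E"
      unfolding distrib_left using zeta_range osc by (intro add_left_mono mult_mono) auto
    finally show "J \<alpha> t \<le> \<zeta> * I \<alpha> t + E" by simp
  next
    fix \<alpha> t assume v: "valid \<alpha> t"
      and IH: "\<And>k. k < r \<Longrightarrow> J (\<alpha> * a k) (\<alpha> * b k + t) \<le> \<zeta> * I (\<alpha> * a k) (\<alpha> * b k + t) + E"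
    have h: "\<alpha> * f k x + t = \<alpha> * a k * x + (\<alpha> * b k + t)" for k x by (simp add: aff_def algebra_simps)
    have "J \<alpha> t = (\<Sum>k<r. p k * J (\<alpha> * a k) (\<alpha> * b k + t))"
      unfolding J_def by (subst ss_integral[OF bJ]) (simp only: h)
    also have "\<dots> \<le> (\<Sum>k<r. p k * (\<zeta> * I (\<alpha> * a k) (\<alpha> * b k + t) + E))"
      by (rule p_sum_mono[OF IH])
    also have "\<dots> = \<zeta> * (\<Sum>k<r. p k * I (\<alpha> * a k) (\<alpha> * b k + t)) + E"
      by (simp add: distrib_left sum.distrib sum_distrib_right[symmetric] p_sum sum_distrib_left mult.left_commute)
    also have "(\<Sum>k<r. p k * I (\<alpha> * a k) (\<alpha> * b k + t)) = I \<alpha> t"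
      unfolding I_def by (subst ss_integral[OF bI, of \<alpha> t]) (simp only: h)
    finally show "J \<alpha> t \<le> \<zeta> * I \<alpha> t + E" .
  qed
  then show ?thesis by (simp add: J_def I_def G_def E_def)
qed

definition "BN N T = (LINT x|\<mu>. MN N (T * \<psi> x))"

lemma bdd_MN: "bdd_borel 1 (\<lambda>x. MN N (T * \<psi> x))"
  using MN_range unfolding bdd_borel_def by (auto simp: abs_le_iff intro: order_trans[of _ 0])

lemma BN_le_1: "BN N T \<le> 1"
proof -
  have "BN N T \<le> (LINT x|\<mu>. 1)" unfolding BN_def
    by (rule integral_mono[OF bdd_int[OF bdd_MN]]) (use MN_range in auto)
  then show ?thesis by (simp add: prob_space)
qed

lemma BN_Suc: "BN (Suc N) T = (\<Sum>k<r. p k * BN N (a k * T))"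
  unfolding BN_def
  by (simp add: Bochner_Integration.integral_sum bdd_int[OF bdd_MN] mult.assoc[symmetric])

text \<open>A word of length \<open>N\<close> multiplies the frequency by at least
  \<open>amin ^ N\<close>, and an average over words does not exceed a common bound.\<close>

lemma BN_le:
  assumes "\<And>T'. amin ^ N * T \<le> T' \<Longrightarrow> BN 0 T' \<le> X" "0 \<le> T"
  shows "BN N T \<le> X"
  using assms
proof (induction N arbitrary: T)
  case (Suc N)
  show ?case unfolding BN_Suc
  proof (rule p_average_le, rule Suc.IH)
    fix k T' assume k: "k < r" and T': "amin ^ N * (a k * T) \<le> T'"
    have "amin ^ Suc N * T \<le> amin ^ N * (a k * T)"
      using a_bounds(1)[OF k] amin_range Suc.prems(2) by (simp add: mult_ac mult_left_mono)
    then show "BN 0 T' \<le> X" using T' by (intro Suc.prems(1)) simp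
  next
    fix k assume "k < r"
    then show "0 \<le> a k * T" using contr[of k] Suc.prems(2) by simp
  qed
qed simp

definition "\<zeta>' = 1 - 2 * (p 0 * p 1) * (1 - \<zeta>)"
definition "err = radius * K * (d - c) * \<delta>"

lemma zeta'_range: "0 \<le> \<zeta>'" "\<zeta>' < 1"
proof -
  have "2 * (p 0 * p 1) * (1 - \<zeta>) \<le> 1 * 1"
    using p01 zeta_range by (intro mult_mono) auto
  then show "0 \<le> \<zeta>'" by (simp add: \<zeta>'_def)
  show "\<zeta>' < 1" using p01 zeta_range by (simp add: \<zeta>'_def)
qed

lemma err_nonneg: "0 \<le> err"
  using radius_nonneg K_pos cd delta_pos by (simp add: err_def)

text \<open>Two letters are split off and the remaining \<open>FT\<close> is majorised by
  \<open>MN N\<close>; on the words \<open>01\<close> and \<open>10\<close> the cosine gains a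
  factor \<open>\<zeta>\<close>. The Lipschitz constant of the majorant is of order
  \<open>amax ^ N * T\<close>, which cancels the scale \<open>1 / T\<close> of the cylinders, so the
  error \<open>amax ^ N * err\<close> is free of \<open>T\<close>.\<close>

lemma BN_step:
  assumes T: "amin * \<delta> < T" and X: "0 \<le> X" "\<And>T'. amin ^ (N + 2) * T \<le> T' \<Longrightarrow> BN 0 T' \<le> X"
  shows "BN 0 T \<le> \<zeta>' * X + amax ^ N * err"
proof -
  have T0: "0 < T" using T delta_pos amin_range by (meson less_trans mult_pos_pos)
  have le: "BN N (a k * a l * T) \<le> X" if "k < r" "l < r" for k l
  proof (rule BN_le)
    fix T' assume T': "amin ^ N * (a k * a l * T) \<le> T'"
    have "amin * amin \<le> a k * a l" using a_bounds(1) that amin_range contr[of k] by (intro mult_mono) auto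
    then have "amin ^ N * (amin * amin * T) \<le> amin ^ N * (a k * a l * T)"
      using T0 amin_range by (intro mult_left_mono mult_right_mono) auto
    then show "BN 0 T' \<le> X" using T' by (intro X) (simp add: power_add power2_eq_square mult_ac)
  qed (use that contr T0 in \<open>simp add: less_imp_le\<close>)
  have cw: "bdd_borel 1 (\<lambda>x. cosw (T * \<psi> x) kl * MN N (T' * \<psi> x))" for kl T'
  proof -
    have "\<bar>cosw (T * \<psi> x) kl * MN N (T' * \<psi> x)\<bar> \<le> 1 * 1" for x
      unfolding abs_mult using MN_range by (intro mult_mono) (auto simp: cosw_def)
    then show ?thesis unfolding bdd_borel_def cosw_def by auto
  qed
  have "BN 0 T = (LINT x|\<mu>. FT (T * \<psi> x))" by (simp add: BN_def)
  also have "\<dots> \<le> (LINT x|\<mu>. (\<Sum>(k, l)\<in>pairs. p k * p l * (cosw (T * \<psi> x) (k, l) * MN N (a k * a l * T * \<psi> x))))"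
  proof (rule integral_mono)
    show "integrable \<mu> (\<lambda>x. FT (T * \<psi> x))" using bdd_int[OF bdd_MN[of 0]] by simp
    show "integrable \<mu> (\<lambda>x. \<Sum>(k, l)\<in>pairs. p k * p l * (cosw (T * \<psi> x) (k, l) * MN N (a k * a l * T * \<psi> x)))"
      unfolding case_prod_beta by (intro Bochner_Integration.integrable_sum integrable_mult_right bdd_int[OF cw])
    fix x
    have "FT (T * \<psi> x) \<le> (\<Sum>(k, l)\<in>pairs. p k * p l * (cosw (T * \<psi> x) (k, l) * FT (a k * a l * (T * \<psi> x))))"
      by (rule FT_interference)
    also have "\<dots> \<le> (\<Sum>(k, l)\<in>pairs. p k * p l * (cosw (T * \<psi> x) (k, l) * MN N (a k * a l * (T * \<psi> x))))"
      unfolding case_prod_beta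
      by (intro sum_mono mult_left_mono FT_le_MN) (use p_pos in \<open>auto simp: pairs_def cosw_def less_imp_le\<close>)
    finally show "FT (T * \<psi> x) \<le> (\<Sum>(k, l)\<in>pairs. p k * p l * (cosw (T * \<psi> x) (k, l) * MN N (a k * a l * T * \<psi> x)))"
      by (simp add: mult.assoc)
  qed
  also have "\<dots> = (\<Sum>(k, l)\<in>pairs. p k * p l * (LINT x|\<mu>. cosw (T * \<psi> x) (k, l) * MN N (a k * a l * T * \<psi> x)))"
    unfolding case_prod_beta by (subst Bochner_Integration.integral_sum) (auto intro: bdd_int[OF cw])
  also have "\<dots> \<le> (\<Sum>(k, l)\<in>pairs. p k * p l * (if coin (k, l) then \<zeta> * X + amax ^ N * err else X))"
  proof (rule sum_mono)
    fix kl assume "kl \<in> pairs"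
    then obtain k l where kl: "kl = (k, l)" "k < r" "l < r" by (auto simp: pairs_def)
    have "(LINT x|\<mu>. cosw (T * \<psi> x) (k, l) * MN N (a k * a l * T * \<psi> x)) \<le> (if coin (k, l) then \<zeta> * X + amax ^ N * err else X)"
    proof (cases "coin (k, l)")
      case True
      define q where "q = a k * a l * T"
      have q: "0 < q" "q \<le> T"
      proof -
        show "0 < q" using contr kl T0 by (simp add: q_def)
        have "a k * a l \<le> 1 * 1" using contr[of k] contr[of l] kl by (intro mult_mono) auto
        then show "q \<le> T" using T0 by (simp add: q_def)
      qed
      have "(LINT x|\<mu>. \<bar>cos (D * (T * \<psi> x) / 2)\<bar> * MN N (q * \<psi> x))
        \<le> \<zeta> * (LINT x|\<mu>. MN N (q * \<psi> x)) + (amax ^ N * radius * T) * K * (d - c) * (\<delta> / T)"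
      proof (rule interference_gain[OF T0 T])
        show "bdd_borel 1 (\<lambda>y. MN N (q * y))"
          using MN_range unfolding bdd_borel_def by (auto simp: abs_le_iff intro: order_trans[of _ 0])
        fix y y'
        have "\<bar>MN N (q * y) - MN N (q * y')\<bar> \<le> amax ^ N * radius * \<bar>q * y - q * y'\<bar>" by (rule MN_lipschitz)
        also have "\<bar>q * y - q * y'\<bar> = q * \<bar>y - y'\<bar>" using q by (simp add: right_diff_distrib[symmetric] abs_mult)
        also have "amax ^ N * radius * (q * \<bar>y - y'\<bar>) \<le> amax ^ N * radius * (T * \<bar>y - y'\<bar>)"
          using q amax_range radius_nonneg by (intro mult_left_mono mult_right_mono) auto
        finally show "\<bar>MN N (q * y) - MN N (q * y')\<bar> \<le> amax ^ N * radius * T * \<bar>y - y'\<bar>" by (simp add: mult.assoc)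
      qed (rule MN_range)
      also have "(amax ^ N * radius * T) * K * (d - c) * (\<delta> / T) = amax ^ N * err"
        using T0 by (simp add: err_def)
      also have "\<zeta> * (LINT x|\<mu>. MN N (q * \<psi> x)) \<le> \<zeta> * X"
        using le[OF kl(2,3)] zeta_range unfolding BN_def q_def by (intro mult_left_mono) auto
      finally show ?thesis using True by (simp add: cosw_def q_def)
    next
      case False
      then show ?thesis using le[OF kl(2,3)] by (simp add: cosw_def BN_def)
    qed
    then show "(case kl of (k, l) \<Rightarrow> p k * p l * (LINT x|\<mu>. cosw (T * \<psi> x) (k, l) * MN N (a k * a l * T * \<psi> x)))
       \<le> (case kl of (k, l) \<Rightarrow> p k * p l * (if coin (k, l) then \<zeta> * X + amax ^ N * err else X))"
      using p_pos kl by (auto intro!: mult_left_mono simp: less_imp_le)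
  qed
  also have "\<dots> = (\<Sum>(k, l)\<in>{kl\<in>pairs. \<not> coin kl}. p k * p l) * X + 2 * (p 0 * p 1) * (\<zeta> * X + amax ^ N * err)"
  proof -
    have "(\<Sum>(k, l)\<in>{kl\<in>pairs. \<not> coin kl}. p k * p l * (if coin (k, l) then \<zeta> * X + amax ^ N * err else X))
      = (\<Sum>(k, l)\<in>{kl\<in>pairs. \<not> coin kl}. p k * p l) * X"
      unfolding sum_distrib_right by (intro sum.cong) auto
    then show ?thesis unfolding pairs_split by (simp add: coin_def algebra_simps)
  qed
  also have "(\<Sum>(k, l)\<in>{kl\<in>pairs. \<not> coin kl}. p k * p l) = 1 - 2 * (p 0 * p 1)"
    using pairs_weight unfolding pairs_split by simp
  also have "(1 - 2 * (p 0 * p 1)) * X + 2 * (p 0 * p 1) * (\<zeta> * X + amax ^ N * err)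
      = \<zeta>' * X + (2 * (p 0 * p 1)) * (amax ^ N * err)"
    by (simp add: \<zeta>'_def algebra_simps)
  also have "\<dots> \<le> \<zeta>' * X + 1 * (amax ^ N * err)"
    using p01 err_nonneg amax_range by (intro add_left_mono mult_right_mono) auto
  finally show ?thesis by simp
qed

text \<open>The second term is the fixed point of
  \<open>x \<mapsto> \<zeta>' * x + amax ^ N * err\<close>, so it reproduces itself in every
  step.\<close>

lemma BN_iterate:
  assumes "\<delta> \<le> amin ^ (j * (N + 2)) * T"
  shows "BN 0 T \<le> \<zeta>' ^ j + amax ^ N * err / (1 - \<zeta>')"
  using assms
proof (induction j arbitrary: T)
  case 0
  have "0 \<le> amax ^ N * err / (1 - \<zeta>')" using err_nonneg zeta'_range amax_range by simp
  then show ?case using BN_le_1[of 0 T] by simp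
next
  case (Suc j)
  define E where "E = amax ^ N * err"
  have E: "0 \<le> E" using err_nonneg amax_range by (simp add: E_def)
  have T0: "0 < T"
  proof -
    have "0 < amin ^ (Suc j * (N + 2)) * T" using Suc.prems delta_pos by linarith
    then show ?thesis by (rule zero_less_mult_pos) (use amin_range in simp)
  qed
  have "amin ^ (Suc j * (N + 2)) * T \<le> 1 * T"
    using amin_range T0 by (intro mult_right_mono power_le_one) auto
  moreover have "amin * \<delta> < 1 * \<delta>" using amin_range delta_pos by (intro mult_strict_right_mono) auto
  ultimately have "amin * \<delta> < T" using Suc.prems by linarith
  then have "BN 0 T \<le> \<zeta>' * (\<zeta>' ^ j + E / (1 - \<zeta>')) + E"
    unfolding E_def
  proof (rule BN_step)
    show "0 \<le> \<zeta>' ^ j + amax ^ N * err / (1 - \<zeta>')"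
      using E zeta'_range unfolding E_def by (intro add_nonneg_nonneg divide_nonneg_nonneg zero_le_power) auto
    fix T' assume T': "amin ^ (N + 2) * T \<le> T'"
    have "amin ^ (j * (N + 2)) * (amin ^ (N + 2) * T) \<le> amin ^ (j * (N + 2)) * T'"
      using T' amin_range by (intro mult_left_mono) auto
    then show "BN 0 T' \<le> \<zeta>' ^ j + amax ^ N * err / (1 - \<zeta>')"
      using Suc.prems by (intro Suc.IH) (simp add: power_add mult_ac)
  qed
  also have "\<dots> = \<zeta>' ^ Suc j + E / (1 - \<zeta>')"
    using zeta'_range by (simp add: field_simps)
  finally show ?case by (simp add: E_def)
qed

text \<open>Taking as many steps as the smoothing depth, \<open>j = N\<close>, balances the gain
  \<open>\<zeta>' ^ N\<close> against the accumulated error of order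
  \<open>amax ^ N\<close>.\<close>

lemma averaged_decay:
  obtains C \<gamma> where "0 < \<gamma>" "\<gamma> < 1" "0 \<le> C"
    "\<And>N T. \<delta> \<le> amin ^ (N * (N + 2)) * T \<Longrightarrow> (LINT x|\<mu>. FT (T * \<psi> x)) \<le> C * \<gamma> ^ N"
proof -
  define \<gamma> where "\<gamma> = max \<zeta>' amax"
  define C where "C = 1 + err / (1 - \<zeta>')"
  have C0: "0 \<le> err / (1 - \<zeta>')" using err_nonneg zeta'_range by simp
  show thesis
  proof (rule that[of \<gamma> C])
    show "0 < \<gamma>" "\<gamma> < 1" using amax_range zeta'_range by (auto simp: \<gamma>_def)
    show "0 \<le> C" using C0 by (simp add: C_def)
    fix N T assume T: "\<delta> \<le> amin ^ (N * (N + 2)) * T"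
    have "(LINT x|\<mu>. FT (T * \<psi> x)) \<le> \<zeta>' ^ N + amax ^ N * (err / (1 - \<zeta>'))"
      using BN_iterate[OF T] by (simp add: BN_def)
    also have "\<dots> \<le> \<gamma> ^ N + \<gamma> ^ N * (err / (1 - \<zeta>'))"
      using amax_range zeta'_range C0 by (intro add_mono mult_right_mono power_mono) (auto simp: \<gamma>_def)
    finally show "(LINT x|\<mu>. FT (T * \<psi> x)) \<le> C * \<gamma> ^ N" by (simp add: C_def algebra_simps)
  qed
qed

end

section \<open>Fourier decay of non-linear images\<close>

lemma power_le_fact_exp:
  fixes x :: real assumes "0 \<le> x" shows "x ^ k \<le> fact k * exp x"
proof -
  have "(\<Sum>n<Suc k. x ^ n /\<^sub>R fact n) \<le> (\<Sum>n. x ^ n /\<^sub>R fact n)"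
    by (rule sum_le_suminf[OF summable_exp_generic]) (use assms in auto)
  moreover have "x ^ k /\<^sub>R fact k \<le> (\<Sum>n<Suc k. x ^ n /\<^sub>R fact n)"
    by (rule member_le_sum) (use assms in auto)
  ultimately have "x ^ k / fact k \<le> exp x" by (simp add: exp_def divide_inverse mult.commute)
  then show ?thesis by (simp add: field_simps)
qed

lemma power_exp_sqrt_bound:
  fixes L :: real assumes "0 \<le> L" "0 < q" shows "L ^ k * exp (- (q * sqrt L)) \<le> fact (2 * k) / q ^ (2 * k)"
proof -
  have "(q * sqrt L) ^ (2 * k) = q ^ (2 * k) * L ^ k"
    using assms by (simp add: power_mult power_mult_distrib)
  then have "q ^ (2 * k) * L ^ k \<le> fact (2 * k) * exp (q * sqrt L)"
    using power_le_fact_exp[of "q * sqrt L" "2 * k"] assms by simp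
  then show ?thesis using assms by (simp add: exp_minus field_simps)
qed

locale curved_phase = bilipschitz_phase +
  fixes g :: "real \<Rightarrow> real"
  assumes g_meas [measurable]: "g \<in> borel_measurable borel"
    and g_deriv: "x \<in> {c..d} \<Longrightarrow> (g has_real_derivative \<psi> x) (at x)"
begin

text \<open>\<open>\<psi>\<close> is only known to be Lipschitz, so the remainder comes from the
  mean value theorem for \<open>g\<close> instead of a second derivative.\<close>

lemma taylor:
  assumes "x \<in> {c..d}" "y \<in> {c..d}"
  shows "\<bar>g y - g x - \<psi> x * (y - x)\<bar> \<le> K * (y - x)\<^sup>2"
proof -
  obtain z where z: "z \<in> {c..d}" "\<bar>z - x\<bar> \<le> \<bar>y - x\<bar>" "g y - g x = \<psi> z * (y - x)"
  proof -
    consider "x < y" | "y < x" | "x = y" by linarith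
    then show ?thesis
    proof cases
      case 1
      have "\<exists>z. x < z \<and> z < y \<and> g y - g x = (y - x) * \<psi> z"
        by (rule MVT2[OF 1]) (use assms g_deriv in auto)
      then obtain z where "x < z" "z < y" "g y - g x = (y - x) * \<psi> z" by blast
      then show ?thesis using assms by (intro that[of z]) auto
    next
      case 2
      have "\<exists>z. y < z \<and> z < x \<and> g x - g y = (x - y) * \<psi> z"
        by (rule MVT2[OF 2]) (use assms g_deriv in auto)
      then obtain z where "y < z" "z < x" "g x - g y = (x - y) * \<psi> z" by blast
      then show ?thesis using assms by (intro that[of z]) (auto simp: algebra_simps)
    next
      case 3
      then show ?thesis using assms that by auto
    qed
  qed
  have "g y - g x - \<psi> x * (y - x) = (\<psi> z - \<psi> x) * (y - x)"
    unfolding z(3) by (simp add: left_diff_distrib)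
  also have "\<bar>\<dots>\<bar> \<le> K * \<bar>y - x\<bar> * \<bar>y - x\<bar>"
    unfolding abs_mult
  proof (rule mult_right_mono)
    have "\<bar>\<psi> z - \<psi> x\<bar> \<le> K * \<bar>z - x\<bar>" by (rule upper[OF z(1) assms(1)])
    also have "\<dots> \<le> K * \<bar>y - x\<bar>" using z(2) K_pos by (intro mult_left_mono) auto
    finally show "\<bar>\<psi> z - \<psi> x\<bar> \<le> K * \<bar>y - x\<bar>" .
  qed simp
  finally show ?thesis by (simp add: power2_eq_square mult.assoc)
qed

text \<open>The phase may be linearised at any point \<open>y\<close> of the cylinder, and the left
  side does not depend on \<open>y\<close>. Integrating the bounds over \<open>y\<close> replaces a
  single frequency by the average that decays.\<close>

lemma linearize:
  assumes v: "valid \<alpha> t" and al: "\<alpha> \<le> \<rho>" and xi: "0 < \<xi>"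
  shows "cmod (LINT x|\<mu>. cis (\<xi> * g (\<alpha> * x + t)))
    \<le> (LINT y|\<mu>. FT (\<xi> * \<alpha> * \<psi> (\<alpha> * y + t))) + \<xi> * K * \<rho>\<^sup>2 * (d - c)\<^sup>2"
proof -
  define Z where "Z = cmod (LINT x|\<mu>. cis (\<xi> * g (\<alpha> * x + t)))"
  define E where "E = \<xi> * K * \<rho>\<^sup>2 * (d - c)\<^sup>2"
  have al0: "0 < \<alpha>" by (rule valid_pos[OF v])
  have pt: "Z \<le> FT (\<xi> * \<alpha> * \<psi> (\<alpha> * y + t)) + E" if y: "y \<in> {c..d}" for y
  proof -
    define \<theta> where "\<theta> = \<xi> * \<alpha> * \<psi> (\<alpha> * y + t)"
    define s where "s = \<xi> * g (\<alpha> * y + t) - \<theta> * y"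
    have hy: "\<alpha> * y + t \<in> {c..d}" using v y by (auto simp: valid_def)
    have "\<bar>Z - cmod (LINT x|\<mu>. cis (\<theta> * x + s))\<bar> \<le> E"
      unfolding Z_def
    proof (rule cis_integral_diff)
      fix x assume x: "x \<in> {c..d}"
      have hx: "\<alpha> * x + t \<in> {c..d}" using v x by (auto simp: valid_def)
      have "\<xi> * g (\<alpha> * x + t) - (\<theta> * x + s)
        = \<xi> * (g (\<alpha> * x + t) - g (\<alpha> * y + t) - \<psi> (\<alpha> * y + t) * ((\<alpha> * x + t) - (\<alpha> * y + t)))"
        by (simp add: s_def \<theta>_def algebra_simps)
      then have "\<bar>\<xi> * g (\<alpha> * x + t) - (\<theta> * x + s)\<bar> \<le> \<xi> * (K * ((\<alpha> * x + t) - (\<alpha> * y + t))\<^sup>2)"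
        using taylor[OF hy hx] xi by (simp add: abs_mult)
      also have "((\<alpha> * x + t) - (\<alpha> * y + t))\<^sup>2 = \<alpha>\<^sup>2 * (x - y)\<^sup>2"
        by (simp add: power_mult_distrib[symmetric] right_diff_distrib)
      also have "\<xi> * (K * (\<alpha>\<^sup>2 * (x - y)\<^sup>2)) \<le> \<xi> * (K * (\<rho>\<^sup>2 * (d - c)\<^sup>2))"
      proof (intro mult_left_mono mult_mono)
        show "\<alpha>\<^sup>2 \<le> \<rho>\<^sup>2" using al al0 by (intro power_mono) auto
        have "\<bar>x - y\<bar> \<le> d - c" using x y by auto
        then show "(x - y)\<^sup>2 \<le> (d - c)\<^sup>2" using cd by (intro abs_le_square_iff[THEN iffD1]) auto
      qed (use xi K_pos in auto)
      finally show "\<bar>\<xi> * g (\<alpha> * x + t) - (\<theta> * x + s)\<bar> \<le> E" by (simp add: E_def mult_ac)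
    qed auto
    moreover have "cmod (LINT x|\<mu>. cis (\<theta> * x + s)) = FT \<theta>"
      unfolding cis_integral_affine by (simp add: norm_mult FT_def)
    ultimately show ?thesis unfolding \<theta>_def by linarith
  qed
  have bF: "bdd_borel 1 (\<lambda>y. FT (\<xi> * \<alpha> * \<psi> (\<alpha> * y + t)))"
  proof -
    have "(\<lambda>y. FT (\<xi> * \<alpha> * \<psi> (\<alpha> * y + t))) \<in> borel_measurable borel" by measurable
    then show ?thesis using FT_range by (simp add: bdd_borel_def)
  qed
  have "(LINT y|\<mu>. Z) \<le> (LINT y|\<mu>. FT (\<xi> * \<alpha> * \<psi> (\<alpha> * y + t)) + E)"
  proof (rule integral_mono_AE)
    show "AE y in \<mu>. Z \<le> FT (\<xi> * \<alpha> * \<psi> (\<alpha> * y + t)) + E"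
      using AE_supp by eventually_elim (rule pt)
  qed (use bdd_int[OF bF] in auto)
  then show ?thesis using bdd_int[OF bF] by (simp add: prob_space Z_def E_def)
qed

definition "contractions \<rho> = {\<alpha>. (\<exists>\<nu>. \<alpha> = (\<Prod>i<r. a i ^ \<nu> i)) \<and> amin * \<rho> < \<alpha> \<and> \<alpha> \<le> \<rho>}"

text \<open>Ratios are monomials in the \<open>a i\<close>, and at this scale every exponent is
  below \<open>n\<close>. So there are polynomially many ratios although exponentially many words
  occur.\<close>

lemma card_contractions:
  assumes "amax ^ n \<le> amin * \<rho>"
  shows "finite (contractions \<rho>)" "card (contractions \<rho>) \<le> n ^ r"
proof -
  let ?X = "{..<r} \<rightarrow>\<^sub>E {..<n}"
  have fin: "finite ?X" by (rule finite_PiE) auto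
  have sub: "contractions \<rho> \<subseteq> (\<lambda>\<nu>. \<Prod>i<r. a i ^ \<nu> i) ` ?X"
  proof
    fix \<alpha> assume "\<alpha> \<in> contractions \<rho>"
    then obtain \<nu> where \<nu>: "\<alpha> = (\<Prod>i<r. a i ^ \<nu> i)" "amin * \<rho> < \<alpha>" by (auto simp: contractions_def)
    have "\<nu> i < n" if i: "i < r" for i
    proof (rule ccontr)
      assume "\<not> \<nu> i < n"
      have "\<alpha> = a i ^ \<nu> i * (\<Prod>j\<in>{..<r} - {i}. a j ^ \<nu> j)"
        unfolding \<nu>(1) using i by (intro prod.remove) auto
      also have "\<dots> \<le> a i ^ \<nu> i * 1"
        using contr i by (intro mult_left_mono prod_le_1) (auto intro!: power_le_one simp: less_imp_le)
      also have "\<dots> \<le> amax ^ \<nu> i" using a_bounds(2)[OF i] contr[OF i] by (auto intro: power_mono)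
      also have "\<dots> \<le> amax ^ n" using amax_range \<open>\<not> \<nu> i < n\<close> by (intro power_decreasing) auto
      finally show False using assms \<nu>(2) by linarith
    qed
    then have "restrict \<nu> {..<r} \<in> ?X" by auto
    moreover have "\<alpha> = (\<Prod>i<r. a i ^ restrict \<nu> {..<r} i)" unfolding \<nu>(1) by (intro prod.cong) auto
    ultimately show "\<alpha> \<in> (\<lambda>\<nu>. \<Prod>i<r. a i ^ \<nu> i) ` ?X" by blast
  qed
  show "finite (contractions \<rho>)" using sub fin finite_surj by blast
  have "card (contractions \<rho>) \<le> card ((\<lambda>\<nu>. \<Prod>i<r. a i ^ \<nu> i) ` ?X)"
    using sub fin by (intro card_mono) auto
  also have "\<dots> \<le> card ?X" using fin by (rule card_image_le)
  also have "\<dots> = n ^ r" by (subst card_PiE) auto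
  finally show "card (contractions \<rho>) \<le> n ^ r" .
qed

text \<open>Summing over all contraction ratios that occur at scale \<open>\<rho>\<close> decouples the ratio of a cylinder
  from its position, at the cost of a factor polynomial in \<open>ln (1 / \<rho>)\<close>.\<close>

lemma decouple:
  assumes rho: "0 < \<rho>" "\<rho> \<le> 1" and xi: "0 < \<xi>" and n: "amax ^ n \<le> amin * \<rho>"
  shows "cmod (LINT x|\<mu>. cis (\<xi> * g x))
    \<le> (\<Sum>\<alpha>\<in>contractions \<rho>. LINT x|\<mu>. FT (\<xi> * \<alpha> * \<psi> x)) + \<xi> * K * \<rho>\<^sup>2 * (d - c)\<^sup>2"
proof -
  define E where "E = \<xi> * K * \<rho>\<^sup>2 * (d - c)\<^sup>2"
  define I where "I \<alpha>' \<alpha> t = (LINT x|\<mu>. FT (\<xi> * \<alpha>' * \<psi> (\<alpha> * x + t)))" for \<alpha>' \<alpha> t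
  define Z where "Z \<alpha> t = cmod (LINT x|\<mu>. cis (\<xi> * g (\<alpha> * x + t)))" for \<alpha> t
  note fin = card_contractions(1)[OF n]
  have bI: "bdd_borel 1 (\<lambda>x. FT (\<xi> * \<alpha>' * \<psi> (\<alpha> * x + t)))" for \<alpha>' \<alpha> t
  proof -
    have "(\<lambda>x. FT (\<xi> * \<alpha>' * \<psi> (\<alpha> * x + t))) \<in> borel_measurable borel" by measurable
    then show ?thesis using FT_range by (simp add: bdd_borel_def)
  qed
  have "Z 1 0 \<le> (\<Sum>\<alpha>'\<in>contractions \<rho>. I \<alpha>' 1 0) + E"
  proof (rule stopping_induct[where \<tau>=\<rho> and P="\<lambda>\<alpha> t. Z \<alpha> t \<le> (\<Sum>\<alpha>'\<in>contractions \<rho>. I \<alpha>' \<alpha> t) + E"])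
    show "0 < \<rho>" by fact
    have "amin * \<rho> \<le> amin * 1" using rho amin_range by (intro mult_left_mono) auto
    then show "amin * \<rho> < 1" using amin_range(2) by linarith
  next
    fix \<alpha> t assume v: "valid \<alpha> t" "amin * \<rho> < \<alpha>" "\<alpha> \<le> \<rho>"
    have "\<alpha> \<in> contractions \<rho>" using v by (auto simp: contractions_def valid_def)
    \<comment> \<open>The ratio of the cylinder itself is among the summands. The other terms are
      nonnegative and are added so that the bound has the same form on all cylinders, as averaging
      requires.\<close>
    then have "I \<alpha> \<alpha> t \<le> (\<Sum>\<alpha>'\<in>contractions \<rho>. I \<alpha>' \<alpha> t)"
      using fin by (intro member_le_sum)
        (auto simp: I_def FT_range intro!: Bochner_Integration.integral_nonneg)
    then show "Z \<alpha> t \<le> (\<Sum>\<alpha>'\<in>contractions \<rho>. I \<alpha>' \<alpha> t) + E"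
      using linearize[OF v(1,3) xi] unfolding Z_def I_def E_def by linarith
  next
    fix \<alpha> t assume v: "valid \<alpha> t"
      and IH: "\<And>k. k < r \<Longrightarrow> Z (\<alpha> * a k) (\<alpha> * b k + t) \<le> (\<Sum>\<alpha>'\<in>contractions \<rho>. I \<alpha>' (\<alpha> * a k) (\<alpha> * b k + t)) + E"
    have h: "\<alpha> * f k x + t = \<alpha> * a k * x + (\<alpha> * b k + t)" for k x by (simp add: aff_def algebra_simps)
    have "Z \<alpha> t = cmod (\<Sum>k<r. p k *\<^sub>R (LINT x|\<mu>. cis (\<xi> * g (\<alpha> * f k x + t))))"
      unfolding Z_def by (subst ss_cis) auto
    also have "\<dots> \<le> (\<Sum>k<r. p k * Z (\<alpha> * a k) (\<alpha> * b k + t))"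
      by (rule order_trans[OF norm_sum sum_mono]) (use p_pos in \<open>auto simp: Z_def h less_imp_le\<close>)
    also have "\<dots> \<le> (\<Sum>k<r. p k * ((\<Sum>\<alpha>'\<in>contractions \<rho>. I \<alpha>' (\<alpha> * a k) (\<alpha> * b k + t)) + E))"
      by (rule p_sum_mono[OF IH])
    also have "\<dots> = (\<Sum>k<r. \<Sum>\<alpha>'\<in>contractions \<rho>. p k * I \<alpha>' (\<alpha> * a k) (\<alpha> * b k + t)) + E"
      by (simp add: distrib_left sum.distrib sum_distrib_right[symmetric] p_sum sum_distrib_left)
    also have "(\<Sum>k<r. \<Sum>\<alpha>'\<in>contractions \<rho>. p k * I \<alpha>' (\<alpha> * a k) (\<alpha> * b k + t))
        = (\<Sum>\<alpha>'\<in>contractions \<rho>. \<Sum>k<r. p k * I \<alpha>' (\<alpha> * a k) (\<alpha> * b k + t))"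
      by (rule sum.swap)
    also have "\<dots> = (\<Sum>\<alpha>'\<in>contractions \<rho>. I \<alpha>' \<alpha> t)"
    proof (rule sum.cong[OF refl])
      fix \<alpha>'
      show "(\<Sum>k<r. p k * I \<alpha>' (\<alpha> * a k) (\<alpha> * b k + t)) = I \<alpha>' \<alpha> t"
        unfolding I_def by (subst ss_integral[OF bI, of \<alpha>' \<alpha> t]) (simp only: h)
    qed
    finally show "Z \<alpha> t \<le> (\<Sum>\<alpha>'\<in>contractions \<rho>. I \<alpha>' \<alpha> t) + E" .
  qed
  then show ?thesis by (simp add: Z_def I_def E_def)
qed

text \<open>For \<open>\<rho> = \<xi>^(-3/4)\<close> the linearisation error
  \<open>\<xi> * \<rho>^2\<close> is \<open>\<xi>^(-1/2)\<close>, while frequencies of order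
  \<open>\<xi>^(1/4)\<close> remain. Averaged decay yields \<open>exp (- const * sqrt L)\<close>
  with \<open>L = ln \<xi>\<close>, which absorbs both the \<open>L ^ r\<close> bound on the number
  of ratios and the factor \<open>1 + L\<close> of the claim.\<close>

lemma fourier_decay:
  obtains C where "0 \<le> C" "\<And>\<xi>. 1 \<le> \<xi> \<Longrightarrow> cmod (LINT x|\<mu>. cis (\<xi> * g x)) \<le> C / (1 + ln \<xi>)"
proof -
  obtain C0 \<gamma> where gam: "0 < \<gamma>" "\<gamma> < 1" and C0: "0 \<le> C0"
    and decay: "\<And>N T. \<delta> \<le> amin ^ (N * (N + 2)) * T \<Longrightarrow> (LINT x|\<mu>. FT (T * \<psi> x)) \<le> C0 * \<gamma> ^ N"
    by (rule averaged_decay, rule that)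
  define M m q where "M = - ln amax" and "m = - ln amin" and "q = - ln \<gamma>"
  have pos: "0 < M" "0 < m" "0 < q"
    using amax_range amin_range gam by (simp_all add: M_def m_def q_def ln_less_zero)
  have am: "amax = exp (- M)" "amin = exp (- m)" "\<gamma> = exp (- q)"
    using amax_range amin_range gam by (simp_all add: M_def m_def q_def)
  \<comment> \<open>With \<open>N + 1 \<le> w * sqrt L\<close> the loss
    \<open>amin ^ (N * (N + 2))\<close> is at least \<open>exp (- L / 8)\<close>, half of the
    available exponent \<open>L / 4\<close>.\<close>
  define w where "w = sqrt (1 / (8 * m))"
  have w: "0 < w" "w\<^sup>2 = 1 / (8 * m)" using pos by (simp_all add: w_def)
  define n1 where "n1 = (1 + m) / M + 1"
  have n1: "n1 \<ge> 1" using pos by (simp add: n1_def)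
  \<comment> \<open>Beyond \<open>L0\<close> the other half of the exponent covers
    \<open>amin\<close> and \<open>\<delta>\<close>, and \<open>w * sqrt L \<ge> 1\<close>; smaller
    \<open>L\<close> are settled by the trivial bound 1.\<close>
  define L0 where "L0 = max (max 1 (8 * (m + \<bar>ln \<delta>\<bar>))) (1 / w\<^sup>2)"
  define C1 where "C1 = 2 * (n1 ^ r * (C0 * exp (2 * q))) * (fact (2 * (r + 1)) / (q * w) ^ (2 * (r + 1)))
      + 8 * (K * (d - c)\<^sup>2)"
  define C where "C = max C1 (1 + L0)"
  show thesis
  proof (rule that[of C])
    show "0 \<le> C" by (simp add: C_def L0_def)
    fix \<xi> :: real assume xi: "1 \<le> \<xi>"
    define L where "L = ln \<xi>"
    have L: "0 \<le> L" "\<xi> = exp L" using xi by (simp_all add: L_def)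
    define Z where "Z = cmod (LINT x|\<mu>. cis (\<xi> * g x))"
    have "Z * (1 + L) \<le> C"
    proof (cases "L \<le> L0")
      case True
      have "Z \<le> 1" unfolding Z_def by (rule cis_integral_le_1) measurable
      then have "Z * (1 + L) \<le> 1 * (1 + L0)" using True L by (intro mult_mono) auto
      then show ?thesis by (simp add: C_def)
    next
      case False
      then have LL: "1 \<le> L" "8 * (m + \<bar>ln \<delta>\<bar>) \<le> L" "1 / w\<^sup>2 \<le> L" by (auto simp: L0_def)
      define \<rho> where "\<rho> = exp (- (3 * L / 4))"
      define n where "n = nat \<lceil>(3 * L / 4 + m) / M\<rceil>"
      \<comment> \<open>Subtracting 1 makes \<open>N * (N + 2) \<le> (N + 1)^2\<close> at most
        \<open>w^2 * L\<close>; the subtraction does not truncate because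
        \<open>w * sqrt L \<ge> 1\<close>.\<close>
      define N where "N = nat \<lfloor>w * sqrt L\<rfloor> - 1"
      have rho: "0 < \<rho>" "\<rho> \<le> 1" using L by (simp_all add: \<rho>_def)
      have n_ge: "(3 * L / 4 + m) / M \<le> real n" unfolding n_def by linarith
      have n_le: "real n \<le> n1 * L"
      proof -
        have "0 \<le> (3 * L / 4 + m) / M" using L pos by simp
        then have "real n \<le> (3 * L / 4 + m) / M + 1" unfolding n_def by linarith
        also have "\<dots> \<le> (L + m * L) / M + L"
          using LL(1) pos by (intro add_mono divide_right_mono) auto
        also have "\<dots> = n1 * L" using pos by (simp add: n1_def field_simps)
        finally show ?thesis .
      qed
      have n: "amax ^ n \<le> amin * \<rho>"
      proof -
        have "3 * L / 4 + m \<le> real n * M" using n_ge pos by (simp add: field_simps)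
        then have "exp (- (real n * M)) \<le> exp (- (m + 3 * L / 4))" by simp
        moreover have "amax ^ n = exp (- (real n * M))" unfolding am by (simp add: exp_of_nat_mult[symmetric])
        moreover have "amin * \<rho> = exp (- (m + 3 * L / 4))" unfolding am \<rho>_def by (simp add: exp_add[symmetric])
        ultimately show ?thesis by simp
      qed
      have "1 = w\<^sup>2 * (1 / w\<^sup>2)" using w(1) by simp
      also have "\<dots> \<le> w\<^sup>2 * L" by (intro mult_left_mono LL) simp
      finally have "1\<^sup>2 \<le> (w * sqrt L)\<^sup>2" using L by (simp add: power_mult_distrib)
      then have one: "1 \<le> w * sqrt L" by (rule power2_le_imp_le) (use w L in simp)
      have N: "real N + 1 \<le> w * sqrt L" "w * sqrt L - 2 \<le> real N"
        using one unfolding N_def by linarith+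
      have NN: "real (N * (N + 2)) * m \<le> L / 8"
      proof -
        have "real (N * (N + 2)) \<le> (real N + 1)\<^sup>2" by (simp add: power2_eq_square algebra_simps)
        also have "\<dots> \<le> (w * sqrt L)\<^sup>2" using N by (intro power_mono) auto
        also have "\<dots> = L / (8 * m)" using w L by (simp add: power_mult_distrib)
        finally show ?thesis using pos by (simp add: field_simps)
      qed
      have each: "(LINT x|\<mu>. FT (\<xi> * \<alpha> * \<psi> x)) \<le> C0 * \<gamma> ^ N" if al: "\<alpha> \<in> contractions \<rho>" for \<alpha>
      proof (rule decay)
        have "\<delta> = exp (ln \<delta>)" using delta_pos by simp
        also have "\<dots> \<le> exp (- (real (N * (N + 2)) * m) + (L + (- m + - (3 * L / 4))))"
          using NN LL by (simp only: exp_le_cancel_iff) (auto simp: abs_le_iff)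
        also have "\<dots> = amin ^ (N * (N + 2)) * (\<xi> * (amin * \<rho>))"
          unfolding am L(2) \<rho>_def exp_add by (simp only: exp_of_nat_mult[symmetric]) simp
        also have "\<dots> \<le> amin ^ (N * (N + 2)) * (\<xi> * \<alpha>)"
          using al xi amin_range by (intro mult_left_mono) (auto simp: contractions_def)
        finally show "\<delta> \<le> amin ^ (N * (N + 2)) * (\<xi> * \<alpha>)" .
      qed
      have "Z \<le> (\<Sum>\<alpha>\<in>contractions \<rho>. LINT x|\<mu>. FT (\<xi> * \<alpha> * \<psi> x)) + \<xi> * K * \<rho>\<^sup>2 * (d - c)\<^sup>2"
        unfolding Z_def by (rule decouple[OF rho _ n]) (use xi in simp)
      also have "(\<Sum>\<alpha>\<in>contractions \<rho>. LINT x|\<mu>. FT (\<xi> * \<alpha> * \<psi> x)) \<le> real (card (contractions \<rho>)) * (C0 * \<gamma> ^ N)"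
        by (rule sum_bounded_above[OF each])
      also have "\<dots> \<le> (n1 * L) ^ r * (C0 * (exp (2 * q) * exp (- (q * w * sqrt L))))"
      proof (intro mult_mono)
        have "real (card (contractions \<rho>)) \<le> real (n ^ r)" using card_contractions(2)[OF n] by (simp only: of_nat_le_iff)
        also have "\<dots> \<le> (n1 * L) ^ r" using n_le by (simp add: power_mono)
        finally show "real (card (contractions \<rho>)) \<le> (n1 * L) ^ r" .
        have "\<gamma> ^ N = exp (- (q * real N))" unfolding am by (simp add: exp_of_nat_mult[symmetric] mult.commute)
        also have "\<dots> \<le> exp (2 * q + - (q * w * sqrt L))"
        proof -
          have "q * (w * sqrt L - 2) \<le> q * real N" using N pos by (intro mult_left_mono) auto
          then show ?thesis by (simp add: right_diff_distrib mult.assoc)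
        qed
        finally show "\<gamma> ^ N \<le> exp (2 * q) * exp (- (q * w * sqrt L))" by (simp only: exp_add)
      qed (use C0 gam n1 LL in auto)
      finally have ZL: "Z \<le> (n1 * L) ^ r * (C0 * (exp (2 * q) * exp (- (q * w * sqrt L)))) + \<xi> * K * \<rho>\<^sup>2 * (d - c)\<^sup>2"
        by simp
      have xr: "\<xi> * \<rho>\<^sup>2 = exp (- (L / 2))"
        unfolding L(2) \<rho>_def power2_eq_square exp_add[symmetric] by (simp add: field_simps)
      have "Z * (1 + L) \<le> Z * (2 * L)" using LL by (intro mult_left_mono) (auto simp: Z_def)
      also have "\<dots> \<le> ((n1 * L) ^ r * (C0 * (exp (2 * q) * exp (- (q * w * sqrt L)))) + (\<xi> * \<rho>\<^sup>2) * (K * (d - c)\<^sup>2)) * (2 * L)"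
        using ZL LL by (intro mult_right_mono) (auto simp: mult_ac)
      also have "\<dots> = 2 * (n1 ^ r * (C0 * exp (2 * q))) * (L ^ (r + 1) * exp (- ((q * w) * sqrt L)))
          + 2 * (K * (d - c)\<^sup>2) * (L * exp (- (L / 2)))"
        unfolding xr by (simp add: power_mult_distrib algebra_simps)
      also have "\<dots> \<le> 2 * (n1 ^ r * (C0 * exp (2 * q))) * (fact (2 * (r + 1)) / (q * w) ^ (2 * (r + 1)))
          + 2 * (K * (d - c)\<^sup>2) * 4"
      proof (intro add_mono mult_left_mono)
        show "L ^ (r + 1) * exp (- ((q * w) * sqrt L)) \<le> fact (2 * (r + 1)) / (q * w) ^ (2 * (r + 1))"
          by (rule power_exp_sqrt_bound) (use L pos w in auto)
        have "L / 2 \<le> exp (L / 2)" using power_le_fact_exp[of "L / 2" 1] L by simp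
        then have "L \<le> 4 * exp (L / 2)" using exp_gt_zero[of "L / 2"] by linarith
        then show "L * exp (- (L / 2)) \<le> 4" by (simp add: exp_minus field_simps)
      qed (use n1 C0 K_pos in auto)
      also have "\<dots> = C1" by (simp add: C1_def)
      finally show ?thesis by (simp add: C_def)
    qed
    then show "cmod (LINT x|\<mu>. cis (\<xi> * g x)) \<le> C / (1 + ln \<xi>)"
      using L unfolding Z_def L_def by (simp add: field_simps)
  qed
qed

end

section \<open>Almost everywhere decay of exponential sums\<close>

text \<open>From the largest square \<open>m^2 \<le> N\<close> at most \<open>2 * m\<close>
  increments of modulus at most 1 lead to \<open>N\<close>, which is negligible against
  \<open>m^2\<close>.\<close>

lemma square_subsequence_average:
  fixes S :: "nat \<Rightarrow> complex"
  assumes inc: "\<And>N. cmod (S (Suc N) - S N) \<le> 1"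
    and sq: "(\<lambda>m. S (m\<^sup>2) / of_nat (m\<^sup>2)) \<longlonglongrightarrow> 0"
  shows "(\<lambda>N. S N / of_nat N) \<longlonglongrightarrow> 0"
proof (rule LIMSEQ_I)
  fix e :: real assume e: "e > 0"
  obtain M where M: "\<And>m. m \<ge> M \<Longrightarrow> cmod (S (m\<^sup>2) / of_nat (m\<^sup>2)) < e / 2"
    using LIMSEQ_D[OF sq, of "e / 2"] e by auto
  obtain M' where M': "real M' > 4 / e" using reals_Archimedean2 by blast
  define M0 where "M0 = Suc (max M M')"
  have step: "cmod (S (n + k) - S n) \<le> real k" for n k
  proof (induction k)
    case (Suc k)
    have "cmod (S (n + Suc k) - S n) \<le> cmod (S (Suc (n + k)) - S (n + k)) + cmod (S (n + k) - S n)"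
      using norm_triangle_ineq[of "S (Suc (n + k)) - S (n + k)" "S (n + k) - S n"] by simp
    then show ?case using Suc inc[of "n + k"] by simp
  qed simp
  have "cmod (S N / of_nat N - 0) < e" if N: "N \<ge> M0\<^sup>2" for N
  proof -
    define m where "m = nat \<lfloor>sqrt (real N)\<rfloor>"
    have "real M0 \<le> sqrt (real N)" using N by (intro real_le_rsqrt) (simp only: of_nat_power[symmetric] of_nat_le_iff)
    then have mM: "M0 \<le> m" unfolding m_def by linarith
    have m1: "m \<ge> 1" "m \<ge> M" "m \<ge> M'" using mM by (auto simp: M0_def)
    have "0 \<le> sqrt (real N)" by simp
    then have m_le: "real m \<le> sqrt (real N)" and m_gt: "sqrt (real N) < real m + 1"
      unfolding m_def by linarith+
    have "(real m)\<^sup>2 \<le> (sqrt (real N))\<^sup>2" using m_le by (intro power_mono) auto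
    then have lo: "m\<^sup>2 \<le> N" by (simp only: real_sqrt_pow2 of_nat_0_le_iff of_nat_power[symmetric] of_nat_le_iff)
    have "(sqrt (real N))\<^sup>2 < (real m + 1)\<^sup>2" using m_gt by (intro power_strict_mono) auto
    then have "real N < real ((m + 1)\<^sup>2)" by (simp add: add.commute)
    then have "N < (m + 1)\<^sup>2" by (simp only: of_nat_less_iff)
    then have hi: "N \<le> m\<^sup>2 + 2 * m" by (simp add: power2_eq_square)
    have "real N \<le> real (m\<^sup>2 + 2 * m)" using hi by (simp only: of_nat_le_iff)
    then have "cmod (S N) \<le> cmod (S (m\<^sup>2)) + 2 * real m"
      using step[of "m\<^sup>2" "N - m\<^sup>2"] norm_triangle_ineq[of "S N - S (m\<^sup>2)" "S (m\<^sup>2)"] lo hi by simp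
    then have "cmod (S N) / real N \<le> (cmod (S (m\<^sup>2)) + 2 * real m) / real N" by (intro divide_right_mono) auto
    also have "\<dots> \<le> (cmod (S (m\<^sup>2)) + 2 * real m) / real (m\<^sup>2)"
    proof (rule divide_left_mono)
      show "real (m\<^sup>2) \<le> real N" using lo by (simp only: of_nat_le_iff)
      have "1 \<le> m\<^sup>2" using m1 by simp
      then show "0 < real N * real (m\<^sup>2)" using lo by (intro mult_pos_pos) linarith+
    qed simp
    also have "\<dots> = cmod (S (m\<^sup>2) / of_nat (m\<^sup>2)) + 2 / real m"
      unfolding norm_divide norm_of_nat using m1 by (simp add: add_divide_distrib power2_eq_square)
    also have "\<dots> < e / 2 + e / 2"
    proof (rule add_strict_mono[OF M[OF m1(2)]])
      have "4 / e < real m" using M' m1(3) by linarith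
      then show "2 / real m < e / 2" using e m1 by (simp add: field_simps)
    qed
    finally show ?thesis by (simp add: norm_divide)
  qed
  then show "\<exists>no. \<forall>N\<ge>no. norm (S N / of_nat N - 0) < e" by blast
qed

section \<open>Absence of atoms and reduction to cylinders\<close>

context self_similar
begin

text \<open>The preimages of an atom of maximal mass under the \<open>f i\<close> have masses
  averaging to the maximum, so all are maximal atoms. As \<open>f i\<close> contracts, the backward
  orbit leaves \<open>[c, d]\<close> unless the atom is the fixed point of \<open>f i\<close>; a
  common fixed point of \<open>f 0\<close> and \<open>f 1\<close> would make them commute.\<close>

lemma measure_singleton: "measure \<mu> {x} = 0"
proof (rule ccontr)
  assume nz: "measure \<mu> {x} \<noteq> 0"
  define e where "e = measure \<mu> {x}"
  have e0: "0 < e" using nz measure_nonneg[of \<mu> "{x}"] by (simp add: e_def less_le)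
  define At where "At = {y. e \<le> measure \<mu> {y}}"
  \<comment> \<open>At most \<open>1 / e\<close> points carry mass \<open>e\<close> or more, so a
    maximal atom exists.\<close>
  have "finite At \<and> card At \<le> nat \<lfloor>1 / e\<rfloor>"
  proof (rule finite_if_finite_subsets_card_bdd)
    fix G assume G: "G \<subseteq> At" "finite G"
    have "real (card G) * e = (\<Sum>y\<in>G. e)" by simp
    also have "\<dots> \<le> (\<Sum>y\<in>G. measure \<mu> {y})" using G by (intro sum_mono) (auto simp: At_def)
    also have "\<dots> = measure \<mu> G"
      using G(2) by (intro finite_measure_eq_sum_singleton[symmetric]) (auto simp: sets_mu)
    also have "\<dots> \<le> 1" by simp
    finally have "real (card G) \<le> 1 / e" using e0 by (simp add: field_simps)
    then show "card G \<le> nat \<lfloor>1 / e\<rfloor>" by linarith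
  qed
  then have fin: "finite At" by simp
  have "x \<in> At" by (simp add: At_def e_def)
  define s where "s = Max ((\<lambda>y. measure \<mu> {y}) ` At)"
  have "s \<in> (\<lambda>y. measure \<mu> {y}) ` At" unfolding s_def using fin \<open>x \<in> At\<close> by (intro Max_in) auto
  then obtain X where X: "X \<in> At" "measure \<mu> {X} = s" by auto
  have s0: "0 < s" using X e0 by (auto simp: At_def)
  have le_s: "measure \<mu> {y} \<le> s" for y
  proof (cases "y \<in> At")
    case True
    then show ?thesis unfolding s_def using fin by (intro Max_ge) auto
  next
    case False
    then show ?thesis using X by (auto simp: At_def)
  qed
  have pre: "f i -` {y} = {(y - b i) / a i}" if "i < r" for i y
    using contr[OF that] by (auto simp: aff_def field_simps)
  have child: "measure \<mu> {(y - b i) / a i} = s" if y: "measure \<mu> {y} = s" and i: "i < r" for y i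
  proof -
    have "bdd_borel 1 (indicator {y})" by (auto simp: bdd_borel_def indicator_def)
    then have "(LINT z|\<mu>. indicator {y} z) = (\<Sum>k<r. p k * (LINT z|\<mu>. indicator {y} (f k z)))"
      by (rule ss_integral)
    moreover have "(LINT z|\<mu>. indicator {y} (f k z)) = measure \<mu> {(y - b k) / a k}" if "k < r" for k
    proof -
      have "(indicator {y} (f k z) :: real) = indicator {(y - b k) / a k} z" for z
        using pre[OF that, of y] by (auto simp: indicator_def vimage_def set_eq_iff)
      then show ?thesis by (simp add: space_mu)
    qed
    ultimately have eq: "s = (\<Sum>k<r. p k * measure \<mu> {(y - b k) / a k})"
      using y by (simp add: space_mu)
    have "(\<Sum>k<r. p k * (s - measure \<mu> {(y - b k) / a k})) = 0"
      using eq by (simp add: right_diff_distrib sum_subtractf sum_distrib_right[symmetric] p_sum)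
    then have "p i * (s - measure \<mu> {(y - b i) / a i}) = 0"
      using i le_s p_pos by (subst (asm) sum_nonneg_eq_0_iff) (auto simp: less_imp_le)
    then show ?thesis using p_pos[OF i] by simp
  qed
  have fixed: "X = b i / (1 - a i)" if i: "i < r" for i
  proof (rule ccontr)
    define x0 where "x0 = b i / (1 - a i)"
    assume "X \<noteq> b i / (1 - a i)"
    then have ne: "0 < \<bar>X - x0\<bar>" by (simp add: x0_def)
    have ai: "0 < a i" "a i < 1" using contr[OF i] by auto
    have bi: "b i = x0 * (1 - a i)" using ai by (simp add: x0_def)
    have orbit: "measure \<mu> {x0 + (X - x0) / a i ^ n} = s" for n
    proof (induction n)
      case 0
      then show ?case using X by simp
    next
      case (Suc n)
      have "(x0 + (X - x0) / a i ^ n - b i) / a i = x0 + (X - x0) / a i ^ Suc n"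
        unfolding bi using ai by (simp add: field_simps)
      then show ?case using child[OF Suc i] by simp
    qed
    obtain n where n: "(1 / a i) ^ n > (\<bar>x0\<bar> + radius + 1) / \<bar>X - x0\<bar>"
      using real_arch_pow[of "1 / a i" "(\<bar>x0\<bar> + radius + 1) / \<bar>X - x0\<bar>"] ai by auto
    define y where "y = x0 + (X - x0) / a i ^ n"
    have "\<bar>x0\<bar> + radius + 1 < \<bar>X - x0\<bar> / a i ^ n"
      using n ne ai by (simp add: field_simps)
    also have "\<dots> = \<bar>y - x0\<bar>" using ai by (simp add: y_def abs_divide)
    also have "\<dots> \<le> \<bar>y\<bar> + \<bar>x0\<bar>" by simp
    finally have "y \<notin> {c..d}" by (auto simp: radius_def)
    have "AE z in \<mu>. z \<notin> {y}" using AE_supp by eventually_elim (use \<open>y \<notin> {c..d}\<close> in auto)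
    then have "measure \<mu> {y} = 0" by (subst (asm) AE_iff_measurable[of "{y}"]) (auto simp: sets_mu space_mu measure_def)
    then show False using orbit[of n] s0 by (simp add: y_def)
  qed
  have "b 0 / (1 - a 0) = b 1 / (1 - a 1)" using fixed[of 0] fixed[of 1] r2 by simp
  then have "b 0 * (1 - a 1) = b 1 * (1 - a 0)"
    using contr[of 0] contr[of 1] r2 by (simp add: field_simps)
  then have "D = 0" by (simp add: D_def algebra_simps)
  then show False using D_nonzero by simp
qed

lemma measure_finite_set: "finite Z \<Longrightarrow> measure \<mu> Z = 0"
  by (subst finite_measure_eq_sum_singleton) (auto simp: sets_mu measure_singleton)

text \<open>Cylinders of ratio at most \<open>\<tau>\<close> that meet \<open>Z\<close> stay in the
  neighbourhood \<open>U \<tau>\<close>, whose measure tends to that of the finite set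
  \<open>Z\<close>, which is 0; the other cylinders contribute nothing to \<open>E\<close>.\<close>

lemma null_by_cylinders:
  assumes E: "E \<in> sets borel" and Z: "finite Z"
    and null: "\<And>\<alpha> t. valid \<alpha> t \<Longrightarrow> (\<And>x. x \<in> {c..d} \<Longrightarrow> \<alpha> * x + t \<notin> Z) \<Longrightarrow> AE x in \<mu>. \<alpha> * x + t \<notin> E"
  shows "AE x in \<mu>. x \<notin> E"
proof -
  define U where "U \<tau> = (\<Union>z\<in>Z. cball z (\<tau> * (d - c)))" for \<tau>
  have U: "U \<tau> \<in> sets borel" for \<tau> unfolding U_def using Z by (intro borel_closed closed_UN) auto
  have bE: "bdd_borel 1 (\<lambda>x. indicator E (\<alpha> * x + t))" for \<alpha> t
    using E by (auto simp: bdd_borel_def indicator_def)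
  have bU: "bdd_borel 1 (\<lambda>x. indicator (U \<tau>) (\<alpha> * x + t))" for \<tau> \<alpha> t
    using U by (auto simp: bdd_borel_def indicator_def)
  have le: "(LINT x|\<mu>. indicator E (1 * x + 0) :: real) \<le> (LINT x|\<mu>. indicator (U \<tau>) (1 * x + 0))"
    if tau: "0 < \<tau>" "\<tau> \<le> 1" for \<tau>
  proof (rule stopping_induct[where \<tau>=\<tau> and P="\<lambda>\<alpha> t. (LINT x|\<mu>. indicator E (\<alpha> * x + t) :: real) \<le> (LINT x|\<mu>. indicator (U \<tau>) (\<alpha> * x + t))"])
    show "0 < \<tau>" by fact
    have "amin * \<tau> \<le> amin * 1" using tau amin_range by (intro mult_left_mono) auto
    then show "amin * \<tau> < 1" using amin_range(2) by linarith
  next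
    fix \<alpha> t assume v: "valid \<alpha> t" "\<alpha> \<le> \<tau>"
    show "(LINT x|\<mu>. indicator E (\<alpha> * x + t) :: real) \<le> (LINT x|\<mu>. indicator (U \<tau>) (\<alpha> * x + t))"
    proof (cases "\<exists>x0\<in>{c..d}. \<alpha> * x0 + t \<in> Z")
      case True
      then obtain x0 where x0: "x0 \<in> {c..d}" "\<alpha> * x0 + t \<in> Z" by blast
      show ?thesis
      proof (rule integral_mono_AE[OF bdd_int[OF bE] bdd_int[OF bU]])
        show "AE x in \<mu>. (indicator E (\<alpha> * x + t) :: real) \<le> indicator (U \<tau>) (\<alpha> * x + t)"
          using AE_supp
        proof eventually_elim
          case (elim x)
          have "dist (\<alpha> * x0 + t) (\<alpha> * x + t) = \<alpha> * \<bar>x0 - x\<bar>"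
            using valid_pos[OF v(1)] by (simp add: dist_real_def right_diff_distrib[symmetric] abs_mult)
          also have "\<dots> \<le> \<tau> * (d - c)"
            using valid_pos[OF v(1)] v(2) x0(1) elim by (intro mult_mono) auto
          finally have "\<alpha> * x + t \<in> U \<tau>"
            unfolding U_def by (intro UN_I[OF x0(2)]) (simp only: mem_cball)
          then show ?case by (simp add: indicator_def)
        qed
      qed
    next
      case False
      then have "AE x in \<mu>. \<alpha> * x + t \<notin> E" by (intro null[OF v(1)]) auto
      then have "(LINT x|\<mu>. indicator E (\<alpha> * x + t) :: real) = (LINT x|\<mu>. 0)"
        using bE by (intro integral_cong_AE) (auto simp: bdd_borel_def)
      also have "\<dots> \<le> (LINT x|\<mu>. indicator (U \<tau>) (\<alpha> * x + t))"
        by (simp add: Bochner_Integration.integral_nonneg)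
      finally show ?thesis .
    qed
  next
    fix \<alpha> t assume v: "valid \<alpha> t"
      and IH: "\<And>k. k < r \<Longrightarrow> (LINT x|\<mu>. indicator E (\<alpha> * a k * x + (\<alpha> * b k + t)) :: real)
        \<le> (LINT x|\<mu>. indicator (U \<tau>) (\<alpha> * a k * x + (\<alpha> * b k + t)))"
    have h: "\<alpha> * f k x + t = \<alpha> * a k * x + (\<alpha> * b k + t)" for k x by (simp add: aff_def algebra_simps)
    show "(LINT x|\<mu>. indicator E (\<alpha> * x + t) :: real) \<le> (LINT x|\<mu>. indicator (U \<tau>) (\<alpha> * x + t))"
      using p_sum_mono[OF IH] by (simp only: ss_integral[OF bE, of \<alpha> t] ss_integral[OF bU, of \<tau> \<alpha> t] h)
  qed
  have mono: "measure \<mu> E \<le> measure \<mu> (U (1 / real (Suc n)))" for n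
    using le[of "1 / real (Suc n)"] by (simp add: space_mu)
  have "(\<lambda>n. measure \<mu> (U (1 / real (Suc n)))) \<longlonglongrightarrow> measure \<mu> (\<Inter>n. U (1 / real (Suc n)))"
  proof (rule finite_Lim_measure_decseq)
    show "range (\<lambda>n. U (1 / real (Suc n))) \<subseteq> sets \<mu>" using U by (auto simp: sets_mu)
    show "decseq (\<lambda>n. U (1 / real (Suc n)))"
    proof (rule decseq_SucI)
      fix n
      have "1 / real (Suc (Suc n)) * (d - c) \<le> 1 / real (Suc n) * (d - c)"
        using cd by (intro mult_right_mono divide_left_mono) auto
      then show "U (1 / real (Suc (Suc n))) \<subseteq> U (1 / real (Suc n))" unfolding U_def by fastforce
    qed
  qed
  moreover have "(\<Inter>n. U (1 / real (Suc n))) = Z"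
  proof
    show "Z \<subseteq> (\<Inter>n. U (1 / real (Suc n)))" unfolding U_def using cd by auto
    show "(\<Inter>n. U (1 / real (Suc n))) \<subseteq> Z"
    proof
      fix x assume x: "x \<in> (\<Inter>n. U (1 / real (Suc n)))"
      show "x \<in> Z"
      proof (rule ccontr)
        assume "x \<notin> Z"
        then obtain e where e: "e > 0" "\<forall>z\<in>Z. z \<noteq> x \<longrightarrow> e \<le> dist x z"
          using finite_set_avoid[OF Z, of x] by blast
        obtain n where n: "inverse (real (Suc n)) < e / (d - c)"
          using reals_Archimedean[of "e / (d - c)"] e cd by auto
        obtain z where z: "z \<in> Z" "dist z x \<le> 1 / real (Suc n) * (d - c)" using x unfolding U_def by auto
        have "1 / real (Suc n) * (d - c) < e" using n cd by (simp add: field_simps)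
        then show False using z e(2) \<open>x \<notin> Z\<close> by (auto simp: dist_commute)
      qed
    qed
  qed
  ultimately have "(\<lambda>n. measure \<mu> (U (1 / real (Suc n)))) \<longlonglongrightarrow> 0"
    using measure_finite_set[OF Z] by simp
  then have "measure \<mu> E \<le> 0" by (rule LIMSEQ_le_const) (use mono in auto)
  then have "measure \<mu> E = 0" using measure_nonneg[of \<mu> E] by linarith
  then show ?thesis
    using E by (subst AE_iff_measurable[of E]) (auto simp: sets_mu space_mu emeasure_eq_measure)
qed

end

context curved_phase
begin

text \<open>Davenport-Erdos-LeVeque: the decay makes the second moment of the \<open>N\<close>-th exponential sum \<open>O(N)\<close>,
  which is summable along the squares after normalisation.\<close>

lemma weyl_null_ae:
  assumes beta: "1 < \<beta>" and t: "t \<noteq> 0"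
  shows "AE x in \<mu>. weyl_null \<beta> t (g x)"
proof -
  obtain C where C: "0 \<le> C" and dec: "\<And>\<xi>. 1 \<le> \<xi> \<Longrightarrow> cmod (LINT x|\<mu>. cis (\<xi> * g x)) \<le> C / (1 + ln \<xi>)"
    by (rule fourier_decay, rule that)
  define G where "G \<theta> = cmod (LINT x|\<mu>. cis (\<theta> * g x))" for \<theta>
  have G1: "G \<theta> \<le> 1" for \<theta> unfolding G_def by (rule cis_integral_le_1) measurable
  have Gdec: "G \<theta> \<le> C / (1 + ln \<bar>\<theta>\<bar>)" if "1 \<le> \<bar>\<theta>\<bar>" for \<theta>
  proof (cases "0 \<le> \<theta>")
    case True
    then show ?thesis using dec[of \<theta>] that by (simp add: G_def)
  next
    case False
    have "cis (\<theta> * g x) = cnj (cis (\<bar>\<theta>\<bar> * g x))" for x using False by (simp add: cis_cnj)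
    then have "(LINT x|\<mu>. cis (\<theta> * g x)) = cnj (LINT x|\<mu>. cis (\<bar>\<theta>\<bar> * g x))"
      using integral_bounded_linear[OF bounded_linear_cnj cis_integrable[of "\<lambda>x. \<bar>\<theta>\<bar> * g x"]] by simp
    then have "G \<theta> = cmod (LINT x|\<mu>. cis (\<bar>\<theta>\<bar> * g x))" unfolding G_def by (simp only: complex_mod_cnj)
    then show ?thesis using dec[OF that] by simp
  qed
  \<comment> \<open>For \<open>l < N\<close> the difference \<open>\<beta> ^ N - \<beta> ^ l\<close>
    is at least \<open>(1 - 1 / \<beta>) * \<beta> ^ N\<close>.\<close>
  define c0 where "c0 = \<bar>t\<bar> * (1 - 1 / \<beta>)"
  have c0: "0 < c0" using beta t by (simp add: c0_def)
  have lb: "0 < ln \<beta>" using beta by simp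
  \<comment> \<open>From \<open>k0\<close> on, half of the exponent \<open>N * ln \<beta>\<close>
    compensates \<open>ln c0\<close>, so the logarithm of the frequency is at least
    \<open>N * ln \<beta> / 2\<close> and correlations are of order \<open>1 / N\<close>. Smaller
    \<open>N\<close> are covered by the term \<open>real k0 + 1\<close> in
    \<open>C4\<close>.\<close>
  obtain k0 :: nat where k0: "real k0 \<ge> 2 * \<bar>ln c0\<bar> / ln \<beta>" using real_arch_simple by blast
  define \<mu>0 where "\<mu>0 = min 1 (ln \<beta> / 2)"
  have mu0: "0 < \<mu>0" using lb by (simp add: \<mu>0_def)
  define C4 where "C4 = max (C / \<mu>0) (real k0 + 1)"
  have C40: "0 \<le> C4" by (simp add: C4_def)
  have cor: "G (t * (\<beta> ^ l - \<beta> ^ N)) \<le> C4 / (real N + 1)" if l: "l < N" for l N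
  proof (cases "N \<ge> k0")
    case False
    have "1 * (real N + 1) \<le> C4" using False by (auto simp: C4_def)
    then have "1 \<le> C4 / (real N + 1)" by (simp add: field_simps)
    then show ?thesis using G1 order_trans by blast
  next
    case True
    define \<theta> where "\<theta> = t * (\<beta> ^ l - \<beta> ^ N)"
    have "\<beta> * \<beta> ^ l \<le> \<beta> ^ N"
      using power_increasing[of "Suc l" N \<beta>] l beta by simp
    then have "\<beta> ^ l \<le> \<beta> ^ N / \<beta>" using beta by (simp add: field_simps)
    then have "\<beta> ^ N * (1 - 1 / \<beta>) \<le> \<bar>\<beta> ^ l - \<beta> ^ N\<bar>" by (simp add: right_diff_distrib)
    then have "c0 * \<beta> ^ N \<le> \<bar>\<theta>\<bar>"
      unfolding \<theta>_def c0_def abs_mult mult.assoc by (intro mult_left_mono) (auto simp: mult.commute)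
    moreover have "c0 * \<beta> ^ N = exp (ln c0 + real N * ln \<beta>)"
      using c0 beta by (simp add: exp_add exp_of_nat_mult)
    moreover have ge: "real N * (ln \<beta> / 2) \<le> ln c0 + real N * ln \<beta>"
    proof -
      have "2 * \<bar>ln c0\<bar> \<le> real k0 * ln \<beta>" using k0 lb by (simp add: field_simps)
      also have "\<dots> \<le> real N * ln \<beta>" using True lb by (intro mult_right_mono) auto
      finally show ?thesis by (simp add: abs_le_iff)
    qed
    ultimately have big: "exp (real N * (ln \<beta> / 2)) \<le> \<bar>\<theta>\<bar>"
      by (metis exp_le_cancel_iff order_trans)
    have "1 \<le> exp (real N * (ln \<beta> / 2))" using lb by simp
    then have th1: "1 \<le> \<bar>\<theta>\<bar>" using big by linarith
    have "real N * (ln \<beta> / 2) \<le> ln \<bar>\<theta>\<bar>" using big th1 by (subst ln_ge_iff) auto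
    moreover have "\<mu>0 * (real N + 1) \<le> real N * (ln \<beta> / 2) + 1"
    proof -
      have "\<mu>0 * real N \<le> (ln \<beta> / 2) * real N" by (intro mult_right_mono) (auto simp: \<mu>0_def)
      moreover have "\<mu>0 \<le> 1" by (simp add: \<mu>0_def)
      ultimately show ?thesis by (simp add: distrib_left mult.commute)
    qed
    ultimately have "\<mu>0 * (real N + 1) \<le> 1 + ln \<bar>\<theta>\<bar>" by linarith
    moreover have pos: "0 < \<mu>0 * (real N + 1)" using mu0 by simp
    ultimately have "0 < 1 + ln \<bar>\<theta>\<bar>" "\<mu>0 * (real N + 1) \<le> 1 + ln \<bar>\<theta>\<bar>" by linarith+
    then have "C / (1 + ln \<bar>\<theta>\<bar>) \<le> C / (\<mu>0 * (real N + 1))"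
      using divide_left_mono[OF _ C mult_pos_pos[OF _ pos]] by blast
    also have "\<dots> = (C / \<mu>0) / (real N + 1)" by simp
    also have "\<dots> \<le> C4 / (real N + 1)" by (intro divide_right_mono) (auto simp: C4_def)
    finally show ?thesis using Gdec[OF th1] unfolding \<theta>_def by linarith
  qed
  define u where "u k x = cis (t * \<beta> ^ k * g x)" for k x
  define S where "S N x = (\<Sum>k<N. u k x)" for N x
  have cism: "cis \<in> borel_measurable borel"
    by (rule borel_measurable_continuous_onI) (intro continuous_intros)
  have um [measurable]: "u k \<in> borel_measurable borel" for k
    unfolding u_def using measurable_compose[OF _ cism] by measurable
  have Sm [measurable]: "S N \<in> borel_measurable borel" for N unfolding S_def[abs_def] by measurable
  have u1: "cmod (u k x) = 1" for k x by (simp add: u_def)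
  have Sle: "cmod (S N x) \<le> real N" for N x
    unfolding S_def using norm_sum[of "\<lambda>k. u k x" "{..<N}"] by (simp add: u1)
  have bS: "bdd_borel ((real N)\<^sup>2) (\<lambda>x. (cmod (S N x))\<^sup>2)" for N
    unfolding bdd_borel_def using Sle by (auto intro: power_mono)
  define Q where "Q N = (LINT x|\<mu>. (cmod (S N x))\<^sup>2)" for N
  \<comment> \<open>Adding the \<open>N\<close>-th term changes the second moment by 1 plus twice a
    sum of \<open>N\<close> correlations of size at most \<open>C4 / (N + 1)\<close>, hence by at
    most a constant.\<close>
  have Qle: "Q N \<le> (1 + 2 * C4) * real N" for N
  proof (induction N)
    case 0
    then show ?case by (simp add: Q_def S_def)
  next
    case (Suc N)
    have b2: "bdd_borel (real N) (\<lambda>x. Re (S N x * cnj (u N x)))"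
    proof -
      have "\<bar>Re (S N x * cnj (u N x))\<bar> \<le> real N" for x
        using abs_Re_le_cmod[of "S N x * cnj (u N x)"] Sle[of N x] by (simp add: norm_mult u1)
      moreover have "(\<lambda>x. Re (S N x * cnj (u N x))) \<in> borel_measurable borel"
      proof -
        have "cnj \<in> borel_measurable borel"
          by (rule borel_measurable_continuous_onI) (intro continuous_intros)
        then have [measurable]: "(\<lambda>x. cnj (u N x)) \<in> borel_measurable borel"
          using measurable_compose[OF um] by blast
        show ?thesis by measurable
      qed
      ultimately show ?thesis unfolding bdd_borel_def by blast
    qed
    have expand: "(cmod (S (Suc N) x))\<^sup>2 = (cmod (S N x))\<^sup>2 + (1 + 2 * Re (S N x * cnj (u N x)))" for x
    proof -
      have "complex_of_real ((cmod (S N x + u N x))\<^sup>2)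
        = complex_of_real ((cmod (S N x))\<^sup>2 + ((cmod (u N x))\<^sup>2 + 2 * Re (S N x * cnj (u N x))))"
        using complex_add_cnj[of "S N x * cnj (u N x)"]
        by (simp only: complex_norm_square of_real_add) (simp add: algebra_simps)
      then show ?thesis unfolding of_real_eq_iff by (simp add: S_def u1)
    qed
    have cross: "(LINT x|\<mu>. Re (S N x * cnj (u N x))) \<le> real N * (C4 / (real N + 1))"
    proof -
      have uu: "u l x * cnj (u N x) = cis (t * (\<beta> ^ l - \<beta> ^ N) * g x)" for l x
        by (simp add: u_def cis_cnj cis_mult algebra_simps)
      have i: "integrable \<mu> (\<lambda>x. cis (t * (\<beta> ^ l - \<beta> ^ N) * g x))" for l
        by (rule cis_integrable) measurable
      have "(LINT x|\<mu>. Re (S N x * cnj (u N x))) = (LINT x|\<mu>. Re (\<Sum>l<N. cis (t * (\<beta> ^ l - \<beta> ^ N) * g x)))"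
        unfolding S_def sum_distrib_right uu ..
      also have "\<dots> = Re (LINT x|\<mu>. (\<Sum>l<N. cis (t * (\<beta> ^ l - \<beta> ^ N) * g x)))"
        by (rule integral_Re) (rule Bochner_Integration.integrable_sum[OF i])
      also have "\<dots> = (\<Sum>l<N. Re (LINT x|\<mu>. cis (t * (\<beta> ^ l - \<beta> ^ N) * g x)))"
        by (subst Bochner_Integration.integral_sum[OF i]) simp
      also have "\<dots> \<le> (\<Sum>l<N. C4 / (real N + 1))"
      proof (rule sum_mono)
        fix l assume "l \<in> {..<N}"
        then show "Re (LINT x|\<mu>. cis (t * (\<beta> ^ l - \<beta> ^ N) * g x)) \<le> C4 / (real N + 1)"
          using cor[of l N] complex_Re_le_cmod[of "LINT x|\<mu>. cis (t * (\<beta> ^ l - \<beta> ^ N) * g x)"]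
          unfolding G_def by simp
      qed
      finally show ?thesis by simp
    qed
    have "(LINT x|\<mu>. A x + (1 + 2 * R x)) = (LINT x|\<mu>. A x) + (1 + 2 * (LINT x|\<mu>. R x))"
      if "integrable \<mu> A" "integrable \<mu> R" for A R :: "real \<Rightarrow> real"
      using that by (simp add: prob_space)
    from this[OF bdd_int[OF bS] bdd_int[OF b2]]
    have "Q (Suc N) = Q N + (1 + 2 * (LINT x|\<mu>. Re (S N x * cnj (u N x))))"
      unfolding Q_def expand .
    also have "real N * (C4 / (real N + 1)) \<le> C4"
      using C40 by (simp add: field_simps)
    then have "Q N + (1 + 2 * (LINT x|\<mu>. Re (S N x * cnj (u N x)))) \<le> (1 + 2 * C4) * real N + (1 + 2 * C4)"
      using cross Suc by linarith
    finally show ?case by (simp add: algebra_simps)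
  qed
  \<comment> \<open>The term \<open>m = 0\<close> is 0 by the convention for division by
    zero.\<close>
  define h where "h m x = (cmod (S (m\<^sup>2) x))\<^sup>2 / (real (m\<^sup>2))\<^sup>2" for m x
  have hm [measurable]: "h m \<in> borel_measurable borel" for m unfolding h_def[abs_def] by measurable
  have "(\<integral>\<^sup>+x. (\<Sum>m. ennreal (h m x)) \<partial>\<mu>) = (\<Sum>m. \<integral>\<^sup>+x. ennreal (h m x) \<partial>\<mu>)"
    by (rule nn_integral_suminf) measurable
  also have "\<dots> \<le> (\<Sum>m. ennreal ((1 + 2 * C4) * inverse (real m ^ 2)))"
  proof (rule suminf_le)
    fix m
    have i: "integrable \<mu> (h m)" unfolding h_def using bdd_int[OF bS] by (intro integrable_divide) auto
    have "(\<integral>\<^sup>+x. ennreal (h m x) \<partial>\<mu>) = ennreal (LINT x|\<mu>. h m x)"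
      by (rule nn_integral_eq_integral[OF i]) (simp add: h_def)
    also have "(LINT x|\<mu>. h m x) = Q (m\<^sup>2) / (real (m\<^sup>2))\<^sup>2" unfolding h_def Q_def by simp
    also have "\<dots> \<le> ((1 + 2 * C4) * real (m\<^sup>2)) / (real (m\<^sup>2))\<^sup>2"
      by (intro divide_right_mono Qle) simp
    also have "\<dots> = (1 + 2 * C4) * inverse (real m ^ 2)"
      by (cases "m = 0") (simp_all add: power2_eq_square field_simps)
    finally show "(\<integral>\<^sup>+x. ennreal (h m x) \<partial>\<mu>) \<le> ennreal ((1 + 2 * C4) * inverse (real m ^ 2))"
      by (simp add: ennreal_leI)
  qed auto
  also have "\<dots> < \<infinity>"
  proof -
    have "summable (\<lambda>m. (1 + 2 * C4) * inverse (real m ^ 2))"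
      by (intro summable_mult inverse_power_summable) simp
    then show ?thesis using C40 by (simp add: suminf_ennreal2 less_top[symmetric])
  qed
  finally have "AE x in \<mu>. (\<Sum>m. ennreal (h m x)) \<noteq> \<infinity>"
    by (intro nn_integral_PInf_AE) auto
  then show ?thesis
  proof eventually_elim
    case (elim x)
    have "summable (\<lambda>m. h m x)" by (rule summable_suminf_not_top) (use elim in \<open>auto simp: h_def\<close>)
    then have "(\<lambda>m. sqrt (h m x)) \<longlonglongrightarrow> sqrt 0" by (intro tendsto_real_sqrt summable_LIMSEQ_zero)
    moreover have "sqrt (h m x) = norm (S (m\<^sup>2) x / of_nat (m\<^sup>2))" for m
      unfolding h_def by (simp only: real_sqrt_divide real_sqrt_abs norm_divide norm_of_nat abs_norm_cancel abs_of_nat)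
    ultimately have "(\<lambda>m. S (m\<^sup>2) x / of_nat (m\<^sup>2)) \<longlonglongrightarrow> 0"
      by (simp only: real_sqrt_zero tendsto_norm_zero_iff)
    then have "(\<lambda>N. S N x / of_nat N) \<longlonglongrightarrow> 0"
      by (intro square_subsequence_average[of "\<lambda>N. S N x"]) (auto simp: S_def u1)
    then show ?case by (simp add: weyl_null_def S_def u_def)
  qed
qed

end

section \<open>Non-affine analytic maps\<close>

text \<open>If \<open>cf m\<close> is the first nonzero coefficient, the series is
  \<open>h ^ m\<close> times a function that is continuous and nonzero at 0, so its zeros cannot
  accumulate there.\<close>

lemma powser_zeros_accumulate:
  fixes cf :: "nat \<Rightarrow> real"
  assumes "\<rho> > 0" "\<And>h. \<bar>h\<bar> < \<rho> \<Longrightarrow> summable (\<lambda>n. cf n * h ^ n)"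
    and acc: "\<And>e. e > 0 \<Longrightarrow> \<exists>h. 0 < \<bar>h\<bar> \<and> \<bar>h\<bar> < e \<and> (\<Sum>n. cf n * h ^ n) = 0"
  shows "cf n = 0"
proof (rule ccontr)
  assume nz: "cf n \<noteq> 0"
  define m where "m = (LEAST n. cf n \<noteq> 0)"
  have m: "cf m \<noteq> 0" unfolding m_def by (rule LeastI[of "\<lambda>n. cf n \<noteq> 0", OF nz])
  have m0: "cf i = 0" if "i < m" for i
    using not_less_Least[of i "\<lambda>n. cf n \<noteq> 0"] that by (simp add: m_def)
  define G where "G h = (\<Sum>n. cf (n + m) * h ^ n)" for h
  have sm: "summable (\<lambda>n. cf (n + m) * h ^ n)" if "\<bar>h\<bar> < \<rho>" for h
  proof (cases "h = 0")
    case False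
    have "summable (\<lambda>n. cf (n + m) * h ^ (n + m))"
      using assms(2)[OF that] by (subst summable_iff_shift)
    then have "summable (\<lambda>n. (cf (n + m) * h ^ (n + m)) * inverse (h ^ m))" by (rule summable_mult2)
    moreover have "(cf (n + m) * h ^ (n + m)) * inverse (h ^ m) = cf (n + m) * h ^ n" for n
      using False by (simp add: power_add)
    ultimately show ?thesis by (simp only:)
  qed simp
  have factor: "(\<Sum>n. cf n * h ^ n) = h ^ m * G h" if "\<bar>h\<bar> < \<rho>" for h
  proof -
    have "(\<Sum>n. cf n * h ^ n) = (\<Sum>n. cf (n + m) * h ^ (n + m)) + (\<Sum>n<m. cf n * h ^ n)"
      by (rule suminf_split_initial_segment[OF assms(2)[OF that]])
    also have "(\<Sum>n<m. cf n * h ^ n) = 0" using m0 by simp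
    also have "(\<Sum>n. cf (n + m) * h ^ (n + m)) = (\<Sum>n. h ^ m * (cf (n + m) * h ^ n))"
      by (simp add: power_add mult_ac)
    also have "\<dots> = h ^ m * G h" unfolding G_def by (rule suminf_mult[OF sm[OF that]])
    finally show ?thesis by simp
  qed
  have "isCont G 0" unfolding G_def
    by (rule isCont_powser[OF sm[of "\<rho> / 2"]]) (use assms(1) in auto)
  moreover have "G 0 \<noteq> 0" using m by (simp add: G_def)
  ultimately have "\<forall>\<^sub>F h in at 0. G h \<noteq> 0"
    using tendsto_imp_eventually_ne[of G "G 0" "at 0" 0] by (simp add: isCont_def)
  then obtain e where e: "e > 0" "\<And>h. h \<noteq> 0 \<Longrightarrow> \<bar>h\<bar> < e \<Longrightarrow> G h \<noteq> 0"
    unfolding eventually_at by (auto simp: dist_real_def)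
  have "0 < min e \<rho>" using e(1) assms(1) by simp
  from acc[OF this] obtain h where h: "0 < \<bar>h\<bar>" "\<bar>h\<bar> < min e \<rho>" "(\<Sum>n. cf n * h ^ n) = 0"
    by blast
  then have "G h \<noteq> 0" by (intro e(2)) auto
  then show False using factor[of h] h by simp
qed

text \<open>The last clause is the local identity theorem for the second derivative: a point where
  its zeros accumulate has a neighbourhood of zeros. Both derivatives are defined globally by
  \<open>deriv\<close>, so the local expansions need no gluing.\<close>

lemma real_analytic_second_deriv:
  assumes "real_analytic g"
  obtains g1 g2 where "\<And>x. (g has_real_derivative g1 x) (at x)"
    "\<And>x. (g1 has_real_derivative g2 x) (at x)" "\<And>x. isCont g2 x"
    "\<forall>x. (\<forall>e>0. \<exists>y. 0 < \<bar>y - x\<bar> \<and> \<bar>y - x\<bar> < e \<and> g2 y = 0) \<longrightarrow> (\<exists>\<rho>>0. \<forall>y. \<bar>y - x\<bar> < \<rho> \<longrightarrow> g2 y = 0)"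
proof -
  define g1 where "g1 = deriv g"
  define g2 where "g2 = deriv g1"
  have loc: "\<exists>\<rho>>0. \<exists>k. (\<forall>y. \<bar>y - x\<bar> < \<rho> \<longrightarrow> (g has_real_derivative g1 y) (at y) \<and> (g1 has_real_derivative g2 y) (at y)
      \<and> isCont g2 y \<and> summable (\<lambda>n. k n * (y - x) ^ n) \<and> g2 y = (\<Sum>n. k n * (y - x) ^ n))" for x
  proof -
    obtain \<rho> cf where rho: "\<rho> > 0" and cf: "\<And>y. \<bar>y - x\<bar> < \<rho> \<Longrightarrow> (\<lambda>n. cf n * (y - x) ^ n) sums g y"
      using assms unfolding real_analytic_def by blast
    have s0: "summable (\<lambda>n. cf n * h ^ n)" if "\<bar>h\<bar> < \<rho>" for h
      using cf[of "x + h"] that by (auto simp: sums_iff)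
    have s1: "summable (\<lambda>n. diffs cf n * h ^ n)" if "\<bar>h\<bar> < \<rho>" for h
      by (rule termdiff_converges[of h \<rho>]) (use that s0 in auto)
    have s2: "summable (\<lambda>n. diffs (diffs cf) n * h ^ n)" if "\<bar>h\<bar> < \<rho>" for h
      by (rule termdiff_converges[of h \<rho>]) (use that s1 in auto)
    define G where "G k y = (\<Sum>n. k n * (y - x) ^ n)" for k :: "nat \<Rightarrow> real" and y
    have D: "(G k has_real_derivative G (diffs k) y) (at y)"
      if s: "\<And>h. \<bar>h\<bar> < \<rho> \<Longrightarrow> summable (\<lambda>n. k n * h ^ n)" and y: "\<bar>y - x\<bar> < \<rho>" for k y
    proof -
      have "((\<lambda>h. \<Sum>n. k n * h ^ n) has_real_derivative (\<Sum>n. diffs k n * (y - x) ^ n)) (at (y - x))"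
        by (rule termdiffs_strong'[of \<rho>]) (use s y in auto)
      then have "((\<lambda>y. \<Sum>n. k n * (y - x) ^ n) has_real_derivative (\<Sum>n. diffs k n * (y - x) ^ n) * 1) (at y)"
        by (intro DERIV_chain2[of "\<lambda>h. \<Sum>n. k n * h ^ n"]) (auto intro!: derivative_eq_intros)
      then show ?thesis by (simp add: G_def[abs_def])
    qed
    have gG: "g y = G cf y" if "\<bar>y - x\<bar> < \<rho>" for y using cf[OF that] by (simp add: G_def sums_iff)
    have nhd: "\<forall>\<^sub>F z in nhds y. \<bar>z - x\<bar> < \<rho>" if "\<bar>y - x\<bar> < \<rho>" for y
    proof -
      have "open {z. \<bar>z - x\<bar> < \<rho>}" by (intro open_Collect_less continuous_intros)
      then show ?thesis using that by (auto simp: eventually_nhds)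
    qed
    have d0: "(g has_real_derivative G (diffs cf) y) (at y)" if y: "\<bar>y - x\<bar> < \<rho>" for y
    proof -
      have "\<forall>\<^sub>F z in nhds y. g z = G cf z" using nhd[OF y] by eventually_elim (rule gG)
      then show ?thesis using D[OF s0 y] by (subst DERIV_cong_ev[OF refl _ refl])
    qed
    then have g1: "g1 y = G (diffs cf) y" if "\<bar>y - x\<bar> < \<rho>" for y
      using that by (simp add: g1_def DERIV_imp_deriv)
    have d1: "(g1 has_real_derivative G (diffs (diffs cf)) y) (at y)" if y: "\<bar>y - x\<bar> < \<rho>" for y
    proof -
      have "\<forall>\<^sub>F z in nhds y. g1 z = G (diffs cf) z" using nhd[OF y] by eventually_elim (rule g1)
      then show ?thesis using D[OF s1 y] by (subst DERIV_cong_ev[OF refl _ refl])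
    qed
    then have g2: "g2 y = G (diffs (diffs cf)) y" if "\<bar>y - x\<bar> < \<rho>" for y
      using that by (simp add: g2_def DERIV_imp_deriv)
    have d2: "isCont g2 y" if y: "\<bar>y - x\<bar> < \<rho>" for y
    proof -
      have "\<forall>\<^sub>F z in nhds y. g2 z = G (diffs (diffs cf)) z" using nhd[OF y] by eventually_elim (rule g2)
      then have "(g2 has_real_derivative G (diffs (diffs (diffs cf))) y) (at y)"
        using D[OF s2 y] by (subst DERIV_cong_ev[OF refl _ refl])
      then show ?thesis by (rule DERIV_isCont)
    qed
    show ?thesis
      by (rule exI[of _ \<rho>], rule conjI[OF rho], rule exI[of _ "diffs (diffs cf)"])
         (use d0 g1 d1 g2 d2 s2 in \<open>auto simp: G_def\<close>)
  qed
  show thesis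
  proof (rule that[of g1 g2])
    show "(g has_real_derivative g1 x) (at x)" "(g1 has_real_derivative g2 x) (at x)" "isCont g2 x" for x
    proof -
      obtain \<rho> k where rho: "\<rho> > 0" and k: "\<And>y. \<bar>y - x\<bar> < \<rho> \<Longrightarrow> (g has_real_derivative g1 y) (at y) \<and> (g1 has_real_derivative g2 y) (at y)
        \<and> isCont g2 y \<and> summable (\<lambda>n. k n * (y - x) ^ n) \<and> g2 y = (\<Sum>n. k n * (y - x) ^ n)"
        using loc[of x] by blast
      have "\<bar>x - x\<bar> < \<rho>" using rho by simp
      from k[OF this] show "(g has_real_derivative g1 x) (at x)"
        "(g1 has_real_derivative g2 x) (at x)" "isCont g2 x" by blast+
    qed
    show "\<forall>x. (\<forall>e>0. \<exists>y. 0 < \<bar>y - x\<bar> \<and> \<bar>y - x\<bar> < e \<and> g2 y = 0) \<longrightarrow> (\<exists>\<rho>>0. \<forall>y. \<bar>y - x\<bar> < \<rho> \<longrightarrow> g2 y = 0)"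
    proof (intro allI impI)
      fix x
      obtain \<rho> k where rho: "\<rho> > 0" and k: "\<And>y. \<bar>y - x\<bar> < \<rho> \<Longrightarrow> (g has_real_derivative g1 y) (at y) \<and> (g1 has_real_derivative g2 y) (at y)
        \<and> isCont g2 y \<and> summable (\<lambda>n. k n * (y - x) ^ n) \<and> g2 y = (\<Sum>n. k n * (y - x) ^ n)"
        using loc[of x] by blast
      assume acc: "\<forall>e>0. \<exists>y. 0 < \<bar>y - x\<bar> \<and> \<bar>y - x\<bar> < e \<and> g2 y = 0"
      have "k n = 0" for n
      proof (rule powser_zeros_accumulate[OF rho])
        show "summable (\<lambda>n. k n * h ^ n)" if "\<bar>h\<bar> < \<rho>" for h using k[of "x + h"] that by simp
        fix e :: real assume "e > 0"
        then have "0 < min e \<rho>" using rho by simp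
        then obtain y where "0 < \<bar>y - x\<bar>" "\<bar>y - x\<bar> < min e \<rho>" "g2 y = 0" using acc by blast
        then show "\<exists>h. 0 < \<bar>h\<bar> \<and> \<bar>h\<bar> < e \<and> (\<Sum>n. k n * h ^ n) = 0"
          using k[of y] by (intro exI[of _ "y - x"]) auto
      qed
      then show "\<exists>\<rho>>0. \<forall>y. \<bar>y - x\<bar> < \<rho> \<longrightarrow> g2 y = 0" using rho k by auto
    qed
  qed
qed

text \<open>The set \<open>W\<close> of points near which \<open>g2\<close> vanishes is open, and
  closed by the local identity theorem. It is not the whole line, since then \<open>g\<close> would
  be affine, so it is empty by connectedness; infinitely many zeros in \<open>[c, d]\<close> would
  accumulate at a point of \<open>W\<close>.\<close>

lemma real_analytic_nonaffine:
  assumes g: "real_analytic g" and na: "\<not> affine_fun g"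
  obtains g1 g2 where "\<And>x. (g has_real_derivative g1 x) (at x)"
    "\<And>x. (g1 has_real_derivative g2 x) (at x)" "\<And>x. isCont g2 x"
    "\<And>c d. finite {x\<in>{c..d}. g2 x = 0}"
proof -
  obtain g1 g2 where d: "\<And>x. (g has_real_derivative g1 x) (at x)"
    "\<And>x. (g1 has_real_derivative g2 x) (at x)" "\<And>x. isCont g2 x"
    and zero: "\<forall>x. (\<forall>e>0. \<exists>y. 0 < \<bar>y - x\<bar> \<and> \<bar>y - x\<bar> < e \<and> g2 y = 0) \<longrightarrow> (\<exists>\<rho>>0. \<forall>y. \<bar>y - x\<bar> < \<rho> \<longrightarrow> g2 y = 0)"
    by (rule real_analytic_second_deriv[OF g], rule that)
  define W where "W = {x. \<exists>\<rho>>0. \<forall>y. \<bar>y - x\<bar> < \<rho> \<longrightarrow> g2 y = 0}"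
  have "open W"
    unfolding open_dist dist_real_def
  proof (intro ballI)
    fix x assume "x \<in> W"
    then obtain \<rho> where rho: "\<rho> > 0" "\<And>y. \<bar>y - x\<bar> < \<rho> \<Longrightarrow> g2 y = 0" by (auto simp: W_def)
    have "y \<in> W" if "\<bar>y - x\<bar> < \<rho> / 2" for y
    proof -
      have "g2 z = 0" if "\<bar>z - y\<bar> < \<rho> / 2" for z
      proof (rule rho(2))
        show "\<bar>z - x\<bar> < \<rho>" using that \<open>\<bar>y - x\<bar> < \<rho> / 2\<close> by linarith
      qed
      then show ?thesis unfolding W_def using rho(1) by (intro CollectI exI[of _ "\<rho> / 2"]) auto
    qed
    then show "\<exists>e>0. \<forall>y. \<bar>y - x\<bar> < e \<longrightarrow> y \<in> W" using rho(1) by (intro exI[of _ "\<rho> / 2"]) auto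
  qed
  moreover have "closed W"
    unfolding closed_limpt
  proof (intro allI impI)
    fix x assume x: "x islimpt W"
    have "\<exists>y. 0 < \<bar>y - x\<bar> \<and> \<bar>y - x\<bar> < e \<and> g2 y = 0" if e: "e > 0" for e
    proof -
      obtain y where y: "y \<in> W" "y \<noteq> x" "dist y x < e" using x e unfolding islimpt_approachable by blast
      then have "g2 y = 0" by (auto simp: W_def)
      then show ?thesis using y by (intro exI[of _ y]) (auto simp: dist_real_def)
    qed
    then show "x \<in> W" unfolding W_def mem_Collect_eq by (intro zero[THEN spec, THEN mp] allI impI)
  qed
  ultimately have "W = {} \<or> W = UNIV" using clopen by blast
  moreover have "W \<noteq> UNIV"
  proof
    assume "W = UNIV"
    have z: "g2 x = 0" for x
    proof -
      have "x \<in> W" using \<open>W = UNIV\<close> by simp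
      then show ?thesis unfolding W_def by auto
    qed
    have "\<exists>s. \<forall>x. g1 x = s"
    proof (rule exI[of _ "g1 0"], rule allI)
      fix x
      have "\<forall>x. (g1 has_real_derivative 0) (at x)" using d(2) unfolding z by blast
      then show "g1 x = g1 0" by (rule DERIV_isconst_all)
    qed
    then obtain s where s: "\<And>x. g1 x = s" by blast
    have "((\<lambda>x. g x - s * x) has_real_derivative g1 x - s * 1) (at x)" for x
      by (intro DERIV_diff d(1) DERIV_cmult DERIV_ident)
    then have "\<forall>x. ((\<lambda>x. g x - s * x) has_real_derivative 0) (at x)" by (simp add: s)
    then have eq: "g x - s * x = g 0 - s * 0" for x by (rule DERIV_isconst_all)
    have "g x = s * x + g 0" for x using eq[of x] by linarith
    then have "affine_fun g" unfolding affine_fun_def by blast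
    then show False using na by simp
  qed
  ultimately have W: "W = {}" by blast
  show thesis
  proof (rule that[OF d])
    fix c d :: real
    show "finite {x\<in>{c..d}. g2 x = 0}"
    proof (rule ccontr)
      assume inf: "infinite {x\<in>{c..d}. g2 x = 0}"
      have "\<exists>x\<in>{c..d}. x islimpt {x\<in>{c..d}. g2 x = 0}"
        by (rule compact_Icc[of c d, unfolded compact_eq_Bolzano_Weierstrass, rule_format]) (use inf in auto)
      then obtain x where x: "x islimpt {x\<in>{c..d}. g2 x = 0}" by blast
      have "\<exists>y. 0 < \<bar>y - x\<bar> \<and> \<bar>y - x\<bar> < e \<and> g2 y = 0" if e: "e > 0" for e
      proof -
        obtain y where "y \<in> {x\<in>{c..d}. g2 x = 0}" "y \<noteq> x" "dist y x < e"
          using x e unfolding islimpt_approachable by blast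
        then show ?thesis by (intro exI[of _ y]) (auto simp: dist_real_def)
      qed
      then have "x \<in> W" unfolding W_def mem_Collect_eq by (intro zero[THEN spec, THEN mp] allI impI)
      then show False using W by simp
    qed
  qed
qed

lemma bilipschitz_of_nonzero_deriv:
  fixes \<psi> \<psi>' :: "real \<Rightarrow> real"
  assumes cd: "c < d" and D: "\<And>x. x \<in> {c..d} \<Longrightarrow> (\<psi> has_real_derivative \<psi>' x) (at x)"
    and cont: "continuous_on {c..d} \<psi>'" and nz: "\<And>x. x \<in> {c..d} \<Longrightarrow> \<psi>' x \<noteq> 0"
  obtains \<kappa> K where "0 < \<kappa>" "\<kappa> \<le> K"
    "\<And>x y. x \<in> {c..d} \<Longrightarrow> y \<in> {c..d} \<Longrightarrow> \<kappa> * \<bar>x - y\<bar> \<le> \<bar>\<psi> x - \<psi> y\<bar>"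
    "\<And>x y. x \<in> {c..d} \<Longrightarrow> y \<in> {c..d} \<Longrightarrow> \<bar>\<psi> x - \<psi> y\<bar> \<le> K * \<bar>x - y\<bar>"
proof -
  have ac: "continuous_on {c..d} (\<lambda>x. \<bar>\<psi>' x\<bar>)" using cont by (intro continuous_intros)
  have ne: "{c..d} \<noteq> {}" using cd by simp
  obtain x0 where x0: "x0 \<in> {c..d}" "\<And>x. x \<in> {c..d} \<Longrightarrow> \<bar>\<psi>' x0\<bar> \<le> \<bar>\<psi>' x\<bar>"
    using continuous_attains_inf[OF compact_Icc ne ac] by blast
  obtain x1 where x1: "x1 \<in> {c..d}" "\<And>x. x \<in> {c..d} \<Longrightarrow> \<bar>\<psi>' x\<bar> \<le> \<bar>\<psi>' x1\<bar>"
    using continuous_attains_sup[OF compact_Icc ne ac] by blast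
  have mvt: "\<exists>z\<in>{c..d}. \<bar>\<psi> x - \<psi> y\<bar> = \<bar>\<psi>' z\<bar> * \<bar>x - y\<bar>" if "x \<in> {c..d}" "y \<in> {c..d}" for x y
  proof -
    have *: "\<exists>z\<in>{c..d}. \<bar>\<psi> x - \<psi> y\<bar> = \<bar>\<psi>' z\<bar> * \<bar>x - y\<bar>" if xy: "x < y" "x \<in> {c..d}" "y \<in> {c..d}" for x y
    proof -
      have "\<exists>z. x < z \<and> z < y \<and> \<psi> y - \<psi> x = (y - x) * \<psi>' z"
        by (rule MVT2[OF xy(1)]) (use xy D in auto)
      then obtain z where "x < z" "z < y" "\<psi> y - \<psi> x = (y - x) * \<psi>' z" by blast
      then have "\<bar>\<psi> x - \<psi> y\<bar> = \<bar>\<psi>' z\<bar> * \<bar>x - y\<bar>"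
        by (simp add: abs_minus_commute[of "\<psi> x"] abs_minus_commute[of x] abs_mult)
      then show ?thesis using xy \<open>x < z\<close> \<open>z < y\<close> by (intro bexI[of _ z]) auto
    qed
    consider "x < y" | "y < x" | "x = y" by linarith
    then show ?thesis
    proof cases
      case 2
      then show ?thesis using *[of y x] that by (simp add: abs_minus_commute)
    qed (use * that in auto)
  qed
  show thesis
  proof (rule that[of "\<bar>\<psi>' x0\<bar>" "\<bar>\<psi>' x1\<bar>"])
    show "0 < \<bar>\<psi>' x0\<bar>" using nz[OF x0(1)] by simp
    show "\<bar>\<psi>' x0\<bar> \<le> \<bar>\<psi>' x1\<bar>" by (rule x0(2)[OF x1(1)])
    fix x y assume xy: "x \<in> {c..d}" "y \<in> {c..d}"
    then obtain z where z: "z \<in> {c..d}" "\<bar>\<psi> x - \<psi> y\<bar> = \<bar>\<psi>' z\<bar> * \<bar>x - y\<bar>" using mvt by blast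
    show "\<bar>\<psi>' x0\<bar> * \<bar>x - y\<bar> \<le> \<bar>\<psi> x - \<psi> y\<bar>"
      unfolding z(2) by (intro mult_right_mono x0(2)[OF z(1)]) simp
    show "\<bar>\<psi> x - \<psi> y\<bar> \<le> \<bar>\<psi>' x1\<bar> * \<bar>x - y\<bar>"
      unfolding z(2) by (intro mult_right_mono x1(2)[OF z(1)]) simp
  qed
qed

text \<open>Measurability allows almost sure statements to pass through the image measure and
  through the subdivision into cylinders.\<close>

lemma weyl_null_measurable: "{y. weyl_null \<beta> t y} \<in> sets borel"
proof -
  define F where "F N y = cmod ((\<Sum>k<N. cis (t * \<beta> ^ k * y)) / of_nat N)" for N y
  have cism: "cis \<in> borel_measurable borel"
    by (rule borel_measurable_continuous_onI) (intro continuous_intros)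
  have [measurable]: "(\<lambda>y. cis (t * \<beta> ^ k * y)) \<in> borel_measurable borel" for k
    by (rule measurable_compose[OF _ cism]) measurable
  have [measurable]: "F N \<in> borel_measurable borel" for N
    unfolding F_def[abs_def] by measurable
  have "weyl_null \<beta> t y \<longleftrightarrow> (\<forall>j. \<exists>M. \<forall>N\<ge>M. F N y < inverse (real (Suc j)))" for y
  proof
    assume "weyl_null \<beta> t y"
    then have lim: "(\<lambda>N. (\<Sum>k<N. cis (t * \<beta> ^ k * y)) / of_nat N) \<longlonglongrightarrow> 0" by (simp add: weyl_null_def)
    show "\<forall>j. \<exists>M. \<forall>N\<ge>M. F N y < inverse (real (Suc j))"
    proof
      fix j
      have "0 < inverse (real (Suc j))" by simp
      from LIMSEQ_D[OF lim this] show "\<exists>M. \<forall>N\<ge>M. F N y < inverse (real (Suc j))"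
        unfolding F_def diff_zero .
    qed
  next
    assume *: "\<forall>j. \<exists>M. \<forall>N\<ge>M. F N y < inverse (real (Suc j))"
    show "weyl_null \<beta> t y" unfolding weyl_null_def
    proof (rule LIMSEQ_I)
      fix e :: real assume "e > 0"
      then obtain j where j: "inverse (real (Suc j)) < e" using reals_Archimedean by blast
      obtain M where M: "\<forall>N\<ge>M. F N y < inverse (real (Suc j))" using * by blast
      show "\<exists>M. \<forall>N\<ge>M. norm ((\<Sum>k<N. cis (t * \<beta> ^ k * y)) / of_nat N - 0) < e"
        unfolding diff_zero F_def[symmetric]
      proof (intro exI allI impI)
        fix N assume "M \<le> N"
        then have "F N y < inverse (real (Suc j))" using M by blast
        then show "F N y < e" using j by (rule less_trans)
      qed
    qed
  qed
  then have "{y. weyl_null \<beta> t y} = {y \<in> space borel. \<forall>j. \<exists>M. \<forall>N\<ge>M. F N y < inverse (real (Suc j))}" by auto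
  also have "\<dots> \<in> sets borel" by measurable
  finally show ?thesis .
qed

text \<open>Exceptional points are tested on cylinders that avoid the zeros of \<open>g2\<close>.
  There \<open>x \<mapsto> g (\<alpha> * x + s)\<close> is a curved phase for the same measure
  \<open>\<mu>\<close>, with second derivative bounded away from 0 by compactness.\<close>

lemma (in self_similar) weyl_null_analytic:
  assumes g: "real_analytic g" "\<not> affine_fun g" and beta: "1 < \<beta>" and t: "t \<noteq> 0"
  shows "AE x in \<mu>. weyl_null \<beta> t (g x)"
proof -
  obtain g1 g2 where d1: "\<And>x. (g has_real_derivative g1 x) (at x)"
    and d2: "\<And>x. (g1 has_real_derivative g2 x) (at x)" and cont: "\<And>x. isCont g2 x"
    and fin: "\<And>c d. finite {x\<in>{c..d}. g2 x = 0}"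
    by (rule real_analytic_nonaffine[OF g], rule that)
  have gc: "continuous_on UNIV g" "continuous_on UNIV g1"
    using DERIV_isCont[OF d1] DERIV_isCont[OF d2] by (auto simp: continuous_on_eq_continuous_at)
  have [measurable]: "g \<in> borel_measurable borel" "g1 \<in> borel_measurable borel"
    using gc by (auto intro: borel_measurable_continuous_onI)
  define E where "E = {x. \<not> weyl_null \<beta> t (g x)}"
  have E: "E \<in> sets borel"
  proof -
    have "E = space borel - g -` {y. weyl_null \<beta> t y} \<inter> space borel" by (auto simp: E_def)
    also have "\<dots> \<in> sets borel"
      by (intro sets.Diff sets.top measurable_sets[OF _ weyl_null_measurable]) measurable
    finally show ?thesis .
  qed
  have "AE x in \<mu>. x \<notin> E"
  proof (rule null_by_cylinders[OF E fin[of c d]])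
    fix \<alpha> s assume v: "valid \<alpha> s" and avoid: "\<And>x. x \<in> {c..d} \<Longrightarrow> \<alpha> * x + s \<notin> {x\<in>{c..d}. g2 x = 0}"
    define G where "G x = g (\<alpha> * x + s)" for x
    define \<psi> where "\<psi> x = \<alpha> * g1 (\<alpha> * x + s)" for x
    have al0: "0 < \<alpha>" by (rule valid_pos[OF v])
    have D1: "(G has_real_derivative \<psi> x) (at x)" for x
    proof -
      have "((\<lambda>x. g (\<alpha> * x + s)) has_real_derivative g1 (\<alpha> * x + s) * \<alpha>) (at x)"
        by (rule DERIV_chain2[OF d1]) (auto intro!: derivative_eq_intros)
      then show ?thesis by (simp add: G_def[abs_def] \<psi>_def mult.commute)
    qed
    have D2: "(\<psi> has_real_derivative \<alpha> * (g2 (\<alpha> * x + s) * \<alpha>)) (at x)" for x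
    proof -
      have "((\<lambda>x. g1 (\<alpha> * x + s)) has_real_derivative g2 (\<alpha> * x + s) * \<alpha>) (at x)"
        by (rule DERIV_chain2[OF d2]) (auto intro!: derivative_eq_intros)
      then show ?thesis unfolding \<psi>_def[abs_def] by (rule DERIV_cmult)
    qed
    have c2: "continuous_on {c..d} (\<lambda>x. \<alpha> * (g2 (\<alpha> * x + s) * \<alpha>))"
    proof -
      have "continuous_on UNIV g2" using cont by (simp add: continuous_on_eq_continuous_at)
      then have "continuous_on {c..d} (\<lambda>x. g2 (\<alpha> * x + s))"
        by (rule continuous_on_compose2) (auto intro!: continuous_intros)
      then show ?thesis by (intro continuous_intros)
    qed
    have nz: "\<alpha> * (g2 (\<alpha> * x + s) * \<alpha>) \<noteq> 0" if "x \<in> {c..d}" for x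
      using avoid[OF that] v that al0 unfolding valid_def by auto
    obtain \<kappa> K where kK: "0 < \<kappa>" "\<kappa> \<le> K"
      "\<And>x y. x \<in> {c..d} \<Longrightarrow> y \<in> {c..d} \<Longrightarrow> \<kappa> * \<bar>x - y\<bar> \<le> \<bar>\<psi> x - \<psi> y\<bar>"
      "\<And>x y. x \<in> {c..d} \<Longrightarrow> y \<in> {c..d} \<Longrightarrow> \<bar>\<psi> x - \<psi> y\<bar> \<le> K * \<bar>x - y\<bar>"
      by (rule bilipschitz_of_nonzero_deriv[OF cd D2 c2 nz], assumption, rule that)
    interpret curved_phase c d r a b p \<mu> \<psi> \<kappa> K G
    proof unfold_locales
      show "\<psi> \<in> borel_measurable borel" unfolding \<psi>_def by measurable
      show "G \<in> borel_measurable borel" unfolding G_def by measurable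
    qed (use kK D1 in auto)
    have "AE x in \<mu>. weyl_null \<beta> t (G x)" by (rule weyl_null_ae[OF beta t])
    then show "AE x in \<mu>. \<alpha> * x + s \<notin> E" by (simp add: E_def G_def)
  qed
  then show ?thesis by (simp add: E_def)
qed

text \<open>If the two maps commute, the image of their composition lies in both pieces, hence among
  the two endpoints of the first. The second map would then take at most two values on
  \<open>[c, d]\<close>, which strict monotonicity forbids.\<close>

lemma regular_noncommuting:
  assumes reg: "regular_linear_IFS c d r a b" and r: "r \<ge> 2"
  shows "a 0 * b 1 + b 0 \<noteq> a 1 * b 0 + b 1"
proof
  assume eq: "a 0 * b 1 + b 0 = a 1 * b 0 + b 1"
  have cd: "c < d" and A: "\<And>i. i < r \<Longrightarrow> 0 < a i \<and> a i < 1 \<and> aff a b i ` {c..d} \<subseteq> {c..d}"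
    and disj: "\<And>i j. i < r \<Longrightarrow> j < r \<Longrightarrow> i \<noteq> j \<Longrightarrow> aff a b i ` {c..d} \<inter> aff a b j ` {c..d} \<subseteq> {aff a b i c, aff a b i d}"
    using reg by (auto simp: regular_linear_IFS_def)
  have a0: "0 < a 0" "a 0 < 1" and a1: "0 < a 1" "a 1 < 1" using A[of 0] A[of 1] r by auto
  have comm: "aff a b 0 (aff a b 1 x) = aff a b 1 (aff a b 0 x)" for x
    using eq by (simp add: aff_def algebra_simps)
  have img: "aff a b i x \<in> {c..d}" if "i < r" "x \<in> {c..d}" for i x
    using A[OF that(1)] that(2) by blast
  have "aff a b 0 (aff a b 1 x) \<in> {aff a b 0 c, aff a b 0 d}" if x: "x \<in> {c..d}" for x
  proof -
    have "aff a b 0 (aff a b 1 x) \<in> aff a b 0 ` {c..d}" using img[of 1 x] r x by auto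
    moreover have "aff a b 0 (aff a b 1 x) \<in> aff a b 1 ` {c..d}" unfolding comm using img[of 0 x] r x by auto
    ultimately show ?thesis using disj[of 0 1] r by auto
  qed
  then have ends: "aff a b 1 x = c \<or> aff a b 1 x = d" if "x \<in> {c..d}" for x
    using that a0 by (auto simp: aff_def)
  have "aff a b 1 c < aff a b 1 ((c + d) / 2)" "aff a b 1 ((c + d) / 2) < aff a b 1 d"
    using cd a1 by (simp_all add: aff_def)
  then show False using ends[of c] ends[of d] ends[of "(c + d) / 2"] cd by auto
qed

theorem theorem1p7:
  fixes c d :: real and r :: nat and a b p :: "nat \<Rightarrow> real" and \<mu> :: "real measure"
  assumes "r \<ge> 2"
    and "regular_linear_IFS c d r a b"
    and "self_similar_measure c d r a b p \<mu>"
  shows "\<forall>g. analytic_diffeo g \<and> \<not> affine_fun g \<longrightarrow>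
           (\<forall>\<beta>. pisot \<beta> \<longrightarrow> pointwise_beta_normal \<beta> (distr \<mu> borel g))"
proof (intro allI impI)
  fix g \<beta> assume g: "analytic_diffeo g \<and> \<not> affine_fun g" and pisot: "pisot \<beta>"
  interpret self_similar c d r a b p \<mu>
    using assms regular_noncommuting[OF assms(2,1)]
    by unfold_locales (auto simp: regular_linear_IFS_def)
  have beta: "1 < \<beta>" using pisot by (simp add: pisot_def)
  interpret beta_transformation \<beta> by unfold_locales (rule beta)
  have an: "real_analytic g" "\<not> affine_fun g" using g by (auto simp: analytic_diffeo_def)
  have gm: "g \<in> borel_measurable \<mu>"
  proof -
    obtain g1 g2 where d1: "\<And>x. (g has_real_derivative g1 x) (at x)"
      "\<And>x. (g1 has_real_derivative g2 x) (at x)" "\<And>x. isCont g2 x" "\<And>c d. finite {x\<in>{c..d}. g2 x = 0}"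
      by (rule real_analytic_nonaffine[OF an], rule that)
    have "continuous_on UNIV g" using DERIV_isCont[OF d1(1)] by (auto simp: continuous_on_eq_continuous_at)
    then show ?thesis by (simp add: measurable_cong_sets[OF sets_mu refl] borel_measurable_continuous_onI)
  qed
  \<comment> \<open>The nonzero frequencies from the ring generated by \<open>\<beta>\<close>,
    indexed by coefficient lists to see that they are countable; one null set then serves for all of
    them.\<close>
  define \<Lambda> where "\<Lambda> = (\<lambda>xs :: int list. 2 * pi * (\<Sum>i<length xs. of_int (xs ! i) * \<beta> ^ i)) ` UNIV - {0}"
  have "countable \<Lambda>" by (simp add: \<Lambda>_def)
  have "AE x in \<mu>. \<forall>t\<in>\<Lambda>. weyl_null \<beta> t (g x)"
    unfolding AE_ball_countable[OF \<open>countable \<Lambda>\<close>]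
    by (intro ballI weyl_null_analytic an beta) (simp add: \<Lambda>_def)
  moreover have "{y. \<forall>t\<in>\<Lambda>. weyl_null \<beta> t y} \<in> sets borel"
  proof -
    have "{y. \<forall>t\<in>\<Lambda>. weyl_null \<beta> t y} = space borel \<inter> (\<Inter>t\<in>\<Lambda>. {y. weyl_null \<beta> t y})" by auto
    also have "\<dots> \<in> sets borel"
      by (intro sets.Int sets.top sets.countable_INT'' \<open>countable \<Lambda>\<close> weyl_null_measurable) simp
    finally show ?thesis .
  qed
  ultimately have "AE y in distr \<mu> borel g. \<forall>t\<in>\<Lambda>. weyl_null \<beta> t y"
    using gm by (subst AE_distr_iff) auto
  then show "pointwise_beta_normal \<beta> (distr \<mu> borel g)"
    unfolding pointwise_beta_normal_def
  proof eventually_elim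
    case (elim y)
    show ?case
    proof (rule weyl_imp_beta_normal[OF pisot])
      fix k :: "nat \<Rightarrow> int" and n
      assume nz: "(\<Sum>i<n. of_int (k i) * \<beta> ^ i) \<noteq> 0"
      have "(\<Sum>i<length (map k [0..<n]). of_int (map k [0..<n] ! i) * \<beta> ^ i) = (\<Sum>i<n. of_int (k i) * \<beta> ^ i)"
        by (intro sum.cong) auto
      then have "2 * pi * (\<Sum>i<n. of_int (k i) * \<beta> ^ i) \<in> \<Lambda>"
        unfolding \<Lambda>_def using nz by (intro DiffI image_eqI[of _ _ "map k [0..<n]"]) auto
      then show "weyl_null \<beta> (2 * pi * (\<Sum>i<n. of_int (k i) * \<beta> ^ i)) y" using elim by blast
    qed
  qed
qed

end
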